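(* Let $T_1=\left(-\frac35,-\frac13\right)\cup\left(\frac15,\frac7{15}\right)$. Then $\mathcal{B}(23,6;T_1)=\mathcal{B}(23,7;T_1)=47104$. Consequently, the code $C_{1/4}$ is a tight $T_1$-avoiding spherical $7$-design.
   Context: A spherical code is a finite set $C\subset\mathbb{S}^{n-1}$; $I(C)=\{x\cdot y: x,y\in C,\ x\ne y\}$. For $T\subset[-1,1)$, $C$ is $T$-avoiding if $I(C)\cap T=\varnothing$. A spherical $\tau$-design is a spherical code $C$ such that the average over $C$ of every polynomial in $n$ variables of total degree at most $\tau$ equals its average over $\mathbb{S}^{n-1}$ with respect to normalized surface measure. $\mathcal{B}(n,\tau;T)$ is the minimum of $|C|$ over all $T$-avoiding spherical $\tau$-designs $C\subset\mathbb{S}^{n-1}$. Let $P_i^{(n)}$ be the Gegenbauer polynomials: orthogonal on $[-1,1]$ with weight $(1-t^2)^{(n-3)/2}$, $\deg P_i^{(n)}=i$, $P_i^{(n)}(1)=1$; write a real polynomial as $f=\sum_i f_iP_i^{(n)}$. Linear programming gives $\mathcal{B}(n,\tau;T)\ge f(1)/f_0$ for every real polynomial $f$ with $f\ge0$ on $[-1,1]\setminus T$, $f_0>0$, and $f_i\le0$ for all $i\ge\tau+1$. A $T$-avoiding spherical $\tau$-design $C\subset\mathbb{S}^{n-1}$ is called tight if $|C|=f(1)/f_0$ for some such $f$. The code $C_{1/4}$: let $L\subset\mathbb{S}^{23}$ be the set of the $196560$ minimal vectors of the Leech lattice rescaled to unit length. Fix $x\in L$; $C_{1/4}$ is the set of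 vectors $(y-\frac14x)/\sqrt{1-\frac1{16}}$ with $y\in L$, $x\cdot y=\frac14$, regarded as a subset of the unit sphere $\mathbb{S}^{22}$ of $x^\perp\cong\mathbb{R}^{23}$. It is a spherical $7$-design with $47104$ points and inner products $-\frac35,-\frac13,-\frac1{15},\frac15,\frac7{15}$. *)

theory Defs
  imports "HOL-Analysis.Analysis" "HOL-Computational_Algebra.Polynomial"
begin

section \<open>Spherical codes and designs\<close>

definition spherical_code :: "(real ^ 'n) set \<Rightarrow> bool" where
  "spherical_code C \<longleftrightarrow> finite C \<and> C \<subseteq> sphere 0 1"

definition inner_products :: "(real ^ 'n) set \<Rightarrow> real set" where
  "inner_products C = {x \<bullet> y | x y. x \<in> C \<and> y \<in> C \<and> x \<noteq> y}"

definition avoiding :: "real set \<Rightarrow> (real ^ 'n) set \<Rightarrow> bool" where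
  "avoiding T C \<longleftrightarrow> inner_products C \<inter> T = {}"

text \<open>The normalized surface measure on the unit sphere: the measure of a Borel set \<open>E\<close> of the
  sphere is the volume of the cone \<open>{r u | u \<in> E, 0 < r \<le> 1}\<close> divided by the volume of the ball.
  Here \<open>sgn x = x / |x|\<close>; the origin, which \<open>sgn\<close> does not send to the sphere, is a null set.\<close>

definition sphere_measure :: "(real ^ 'n) measure" where
  "sphere_measure = distr (uniform_measure lborel (cball 0 1)) borel sgn"

text \<open>Real polynomial functions in the coordinates, of total degree at most \<open>d\<close>. The set of
  exponent vectors is finite, so the sum below is a genuine one.\<close>

definition exponents :: "nat \<Rightarrow> ('n::finite \<Rightarrow> nat) set" where
  "exponents d = {\<alpha>. (\<Sum>i\<in>UNIV. \<alpha> i) \<le> d}"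

lemma finite_exponents: "finite (exponents d :: ('n::finite \<Rightarrow> nat) set)"
proof (rule finite_subset)
  show "exponents d \<subseteq> (UNIV :: 'n set) \<rightarrow>\<^sub>E {..d}"
  proof
    fix \<alpha> :: "'n \<Rightarrow> nat"
    assume "\<alpha> \<in> exponents d"
    then have "\<alpha> i \<le> d" for i
      using member_le_sum[of i UNIV \<alpha>] by (simp add: exponents_def)
    then show "\<alpha> \<in> UNIV \<rightarrow>\<^sub>E {..d}"
      by auto
  qed
qed (intro finite_PiE; simp)

definition polynomials_upto :: "nat \<Rightarrow> (real ^ 'n \<Rightarrow> real) set" where
  "polynomials_upto d =
     {p. \<exists>c. p = (\<lambda>x. \<Sum>\<alpha>\<in>exponents d. c \<alpha> * (\<Prod>i\<in>UNIV. x $ i ^ \<alpha> i))}"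

definition spherical_design :: "nat \<Rightarrow> (real ^ 'n) set \<Rightarrow> bool" where
  "spherical_design \<tau> C \<longleftrightarrow> spherical_code C \<and> C \<noteq> {} \<and>
     (\<forall>p\<in>polynomials_upto \<tau>. (\<Sum>x\<in>C. p x) / real (card C) = (\<integral>x. p x \<partial>sphere_measure))"

text \<open>\<open>min_design_size TYPE('n) \<tau> T\<close> is the quantity \<open>B(n, \<tau>; T)\<close> with \<open>n = CARD('n)\<close>. If there are
  no such designs the value is the infimum of the empty set of naturals, which is \<open>0\<close> and hence is
  not the size of a design.\<close>

definition min_design_size :: "'n::finite itself \<Rightarrow> nat \<Rightarrow> real set \<Rightarrow> nat" where
  "min_design_size _ \<tau> T =
     Inf {card C | C :: (real ^ 'n) set. spherical_design \<tau> C \<and> avoiding T C}"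


section \<open>Gegenbauer polynomials and tightness\<close>

text \<open>\<open>gegenbauer n i\<close> is the polynomial of degree \<open>i\<close> with value \<open>1\<close> at \<open>1\<close> that is orthogonal to
  all its predecessors for the weight \<open>(1 - t\<^sup>2) powr ((n - 3) / 2)\<close> on \<open>[-1, 1]\<close> (\<open>n \<ge> 2\<close>).\<close>

function gegenbauer :: "nat \<Rightarrow> nat \<Rightarrow> real poly" where
  "gegenbauer n i = (THE P. degree P = i \<and> poly P 1 = 1 \<and>
     (\<forall>j\<in>{..<i}. integral {-1..1}
        (\<lambda>t. (1 - t\<^sup>2) powr ((real n - 3) / 2) * poly P t * poly (gegenbauer n j) t) = 0))"
  by pat_completeness auto
termination
  by (relation "Wellfounded.measure snd") auto

declare gegenbauer.simps [simp del]

definition gegenbauer_expansion :: "nat \<Rightarrow> (nat \<Rightarrow> real) \<Rightarrow> real poly \<Rightarrow> bool" where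
  "gegenbauer_expansion n c f \<longleftrightarrow>
     finite {i. c i \<noteq> 0} \<and> f = (\<Sum>i | c i \<noteq> 0. smult (c i) (gegenbauer n i))"

definition tight_avoiding_design :: "nat \<Rightarrow> real set \<Rightarrow> (real ^ 'n) set \<Rightarrow> bool" where
  "tight_avoiding_design \<tau> T C \<longleftrightarrow> spherical_design \<tau> C \<and> avoiding T C \<and>
     (\<exists>f c. gegenbauer_expansion CARD('n) c f \<and>
            (\<forall>t\<in>{-1..1} - T. poly f t \<ge> 0) \<and> c 0 > 0 \<and> (\<forall>i\<ge>\<tau> + 1. c i \<le> 0) \<and>
            real (card C) = poly f 1 / c 0)"


section \<open>The Leech lattice and the code \<open>C\<^bsub>1/4\<^esub>\<close>\<close>

text \<open>The 24 coordinates are indexed by the projective line over the field with 23 elements: the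
  numeral type \<open>23\<close> is the ring of integers modulo 23, and \<open>None\<close> is the point at infinity.\<close>

type_synonym real24 = "(real, 23 option) vec"

text \<open>The extended binary Golay code as the extended quadratic residue code modulo 23, with words
  given by their supports, so that addition is symmetric difference. It is spanned by the
  translates of the set of nonzero squares, each extended by the point at infinity.\<close>

definition golay_generator :: "23 \<Rightarrow> 23 option set" where
  "golay_generator a = insert None (Some ` {a + b\<^sup>2 | b. b \<noteq> 0})"

inductive_set golay_code :: "23 option set set" where
  "{} \<in> golay_code"
| "W \<in> golay_code \<Longrightarrow> sym_diff W (golay_generator a) \<in> golay_code"

text \<open>Conway's coordinates for the Leech lattice, normalized to be even unimodular.\<close>

definition leech_lattice :: "real24 set" where
  "leech_lattice = {(1 / sqrt 8) *\<^sub>R (\<chi> i. of_int (z i)) | z :: 23 option \<Rightarrow> int.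
     \<exists>m::int. (\<forall>i. z i mod 2 = m mod 2) \<and>
        (\<forall>k::int. 0 \<le> k \<and> k < 4 \<longrightarrow> {i. z i mod 4 = k} \<in> golay_code) \<and>
        (\<Sum>i\<in>UNIV. z i) mod 8 = (4 * m) mod 8}"

definition minimal_vectors :: "'a::real_normed_vector set \<Rightarrow> 'a set" where
  "minimal_vectors \<Lambda> = {v \<in> \<Lambda>. v \<noteq> 0 \<and> (\<forall>w\<in>\<Lambda>. w \<noteq> 0 \<longrightarrow> norm v \<le> norm w)}"

definition leech_code :: "real24 set" where
  "leech_code = (\<lambda>v. v /\<^sub>R norm v) ` minimal_vectors leech_lattice"

definition quarter_code :: "real24 \<Rightarrow> real24 set" where
  "quarter_code x =
     {(y - (1 / 4) *\<^sub>R x) /\<^sub>R sqrt (1 - 1 / 16) | y. y \<in> leech_code \<and> x \<bullet> y = 1 / 4}"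

text \<open>Identifications of the orthogonal complement of \<open>x\<close> with another Euclidean space. Only the
  values of \<open>\<phi>\<close> on the complement matter; every linear map on the complement extends to the whole
  space.\<close>

definition complement_isometry :: "'a::euclidean_space \<Rightarrow> ('a \<Rightarrow> 'b::euclidean_space) \<Rightarrow> bool" where
  "complement_isometry x \<phi> \<longleftrightarrow> linear \<phi> \<and> \<phi> ` {v. x \<bullet> v = 0} = UNIV \<and>
     (\<forall>v. x \<bullet> v = 0 \<longrightarrow> norm (\<phi> v) = norm v)"

lemma complement_isometry_exists:
  fixes x :: real24
  assumes "x \<noteq> 0"
  shows "\<exists>\<phi> :: real24 \<Rightarrow> real ^ 23. complement_isometry x \<phi>"
proof -
  have "dim {v. x \<bullet> v = 0} = dim (UNIV :: (real ^ 23) set)"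
    using assms by (simp add: dim_hyperplane)
  then obtain \<phi> :: "real24 \<Rightarrow> real ^ 23" and \<psi> where
    "linear \<phi>" "\<phi> ` {v. x \<bullet> v = 0} = UNIV" "\<And>v. v \<in> {v. x \<bullet> v = 0} \<Longrightarrow> norm (\<phi> v) = norm v"
    using isometries_subspaces[OF subspace_hyperplane subspace_UNIV] by metis
  then show ?thesis
    unfolding complement_isometry_def by blast
qed

end

theory Submission
  imports Defs "HOL-Library.Option_ord"
begin

text \<open>Lower bound: the sextic
  \<open>f(t) = (t + 3/5)(t + 1/3)(t + 1/15)\<^sup>2(t - 1/5)(t - 7/15)\<close> is nonnegative outside \<open>T\<^sub>1\<close> and vanishes
  at all inner products of \<open>C\<^bsub>1/4\<^esub>\<close>. Summing it over all pairs of points of an avoiding \<open>6\<close>-design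
  bounds the size by \<open>f(1) / f\<^sub>0 = 47104\<close>.

  Attainment: the signs attached to the words of the Golay code are four-wise independent, because
  any four columns of its generator matrix are linearly independent. This gives the weight
  distribution of the code, the octad counts \<open>253\<close> and \<open>77\<close>, and the fourth moment of the minimal
  vectors of the Leech lattice. As their inner products are \<open>0, \<plusminus>1/4, \<plusminus>1/2, \<plusminus>1\<close>, the moments of
  degrees \<open>0, 2, 4\<close> fix the distance distribution, and with it the sums of \<open>(x \<bullet> y)\<^sup>d\<close> over all pairs
  for \<open>d \<le> 11\<close>. A finite spherical set whose pair sums agree with those of the sphere is a design,
  since the difference of the averages of the tensors \<open>x \<otimes> \<dots> \<otimes> x\<close> then has norm zero. Weighting
  the resulting \<open>11\<close>-design by a quartic in \<open>x \<bullet> y\<close> that isolates the inner product \<open>1/4\<close> leaves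
  degree \<open>7\<close> for the derived code.\<close>

section \<open>Rotation invariance of the surface measure\<close>

text \<open>Integrals over the sphere are needed only for the powers
  \<open>(a \<bullet> u) ^ d\<close>: they control all polynomials through the tensors, rotation
  invariance leaves one constant per degree, and the constants satisfy a recurrence. The same
  recurrence, read downwards for a counting measure, recovers the second moment and the number
  196560 of minimal vectors from the fourth moment. The vectors are too many to enumerate, so the
  fourth moment is the only quantity computed from coordinates; evaluation is confined to residues
  modulo 23 and the incidence matrix of the Golay generators. For a fixed minimal vector, the counts
  at the inner products 1/2 and 1/4 then solve two linear equations, and the moments of degrees 6, 8
  and 10 agree with those of the sphere as numerical identities. Gegenbauer polynomials enter only
  in the certificate of tightness; the bound uses the moments directly. As \<open>f\<close> has
  degree 6, it serves the strengths 6 and 7 alike.\<close>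

text \<open>The library results on linear images of measurable sets require a well-ordered index type;
  for \<open>23 option\<close> the order comes from \<open>Option_ord\<close>.\<close>

lemma emeasure_orthogonal_image:
  fixes f :: "real ^ 'n::{finite,wellorder} \<Rightarrow> real ^ 'n::{finite,wellorder}"
  assumes f: "orthogonal_transformation f" and S: "S \<in> lmeasurable"
  shows "emeasure lebesgue (f ` S) = emeasure lebesgue S"
  using measurable_orthogonal_image[OF f S] measure_orthogonal_image[OF f S] S
  by (metis emeasure_eq_measure2)

lemma orthogonal_transformation_borel:
  fixes f :: "real ^ 'n \<Rightarrow> real ^ 'n"
  assumes "orthogonal_transformation f"
  shows "f \<in> borel \<rightarrow>\<^sub>M borel"
  by (intro borel_measurable_continuous_onI linear_continuous_on)
     (simp add: assms orthogonal_transformation_linear flip: linear_conv_bounded_linear)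

text \<open>\<open>lborel_eqI\<close> reduces the claim to boxes. The preimage of a box is its image
  under the inverse rotation; its volume is found in the completed measure, where
  \<open>emeasure_orthogonal_image\<close> applies.\<close>

lemma distr_lborel_orthogonal:
  fixes f :: "real ^ 'n::{finite,wellorder} \<Rightarrow> real ^ 'n::{finite,wellorder}"
  assumes f: "orthogonal_transformation f"
  shows "distr lborel borel f = lborel"
proof (rule lborel_eqI[symmetric])
  fix l u :: "real ^ 'n::{finite,wellorder}"
  assume le: "\<And>b. b \<in> Basis \<Longrightarrow> l \<bullet> b \<le> u \<bullet> b"
  define g where "g = inv f"
  have g: "orthogonal_transformation g"
    unfolding g_def using f by (rule orthogonal_transformation_inv)
  have bij: "bij f" using f by (rule orthogonal_transformation_bij)
  have vim: "f -` box l u = g ` box l u"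
    unfolding g_def using bij by (rule bij_vimage_eq_inv_image)
  have "emeasure (distr lborel borel f) (box l u) = emeasure lborel (g ` box l u)"
    using orthogonal_transformation_borel[OF f] by (simp add: emeasure_distr vim)
  also have "\<dots> = emeasure lebesgue (g ` box l u)"
    using orthogonal_transformation_borel[OF f] measurable_sets_borel[of f borel "box l u"]
    by (simp add: vim emeasure_completion flip: vim)
  also have "\<dots> = emeasure lebesgue (box l u)"
    using g by (rule emeasure_orthogonal_image) simp
  also have "\<dots> = (\<Prod>b\<in>Basis. (u - l) \<bullet> b)"
    using le by (simp add: emeasure_lborel_box)
  finally show "emeasure (distr lborel borel f) (box l u) = (\<Prod>b\<in>Basis. (u - l) \<bullet> b)" .
qed simp

text \<open>Conditioning an invariant measure on an invariant set keeps it invariant. It is used for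
  the unit ball.\<close>

lemma distr_uniform_measure:
  assumes "distr M M f = M" "f \<in> M \<rightarrow>\<^sub>M M" "A \<in> sets M" "f -` A \<inter> space M = A"
  shows "distr (uniform_measure M A) M f = uniform_measure M A"
proof (rule measure_eqI)
  fix B assume "B \<in> sets (distr (uniform_measure M A) M f)"
  then have B: "B \<in> sets M" by simp
  have "emeasure M (A \<inter> (f -` B \<inter> space M)) = emeasure M (f -` (A \<inter> B) \<inter> space M)"
    by (subst assms(4)[symmetric]) (rule arg_cong[where f = "emeasure M"], auto)
  also have "\<dots> = emeasure (distr M M f) (A \<inter> B)"
    using assms B by (subst emeasure_distr) auto
  finally show "emeasure (distr (uniform_measure M A) M f) B = emeasure (uniform_measure M A) B"
    using assms B by (simp add: emeasure_distr measurable_sets)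
qed simp

lemma space_sphere_measure [simp]: "space sphere_measure = UNIV"
  and sets_sphere_measure [simp, measurable_cong]: "sets sphere_measure = sets borel"
  by (simp_all add: sphere_measure_def)

lemma borel_measurable_sgn [measurable]: "sgn \<in> (borel :: (real ^ 'n) measure) \<rightarrow>\<^sub>M borel"
  unfolding sgn_div_norm[abs_def] by measurable

lemma emeasure_sphere_measure: "emeasure (sphere_measure :: (real ^ 'n) measure) UNIV = 1"
proof -
  have "0 < measure lborel (cball (0 :: real ^ 'n) 1)"
    by (simp add: content_cball_pos)
  then have "emeasure lborel (cball (0 :: real ^ 'n) 1) \<noteq> 0"
    by (auto simp: measure_def)
  moreover have "emeasure lborel (cball (0 :: real ^ 'n) 1) < \<infinity>"
    by (rule emeasure_bounded_finite) simp
  ultimately show ?thesis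
    unfolding sphere_measure_def
    by (subst emeasure_distr)
       (auto simp: ennreal_divide_self)
qed

lemma AE_sphere_measure: "AE u in (sphere_measure :: (real ^ 'n) measure). norm u = 1"
proof -
  have "AE x in uniform_measure lborel (cball (0 :: real ^ 'n) 1). norm (sgn x) = 1"
    by (rule AE_uniform_measureI) (use AE_lborel_singleton[of 0] in \<open>auto simp: norm_sgn\<close>)
  then show ?thesis
    unfolding sphere_measure_def by (subst AE_distr_iff) auto
qed

text \<open>A norm-preserving linear map commutes with \<open>sgn\<close>, so the invariance of the
  uniform measure on the ball passes to its radial projection.\<close>

lemma distr_sphere_measure_orthogonal:
  fixes f :: "real ^ 'n::{finite,wellorder} \<Rightarrow> real ^ 'n::{finite,wellorder}"
  assumes f: "orthogonal_transformation f"
  shows "distr sphere_measure borel f = sphere_measure"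
proof -
  let ?U = "uniform_measure lborel (cball (0 :: real ^ 'n::{finite,wellorder}) 1)"
  note [measurable] = orthogonal_transformation_borel[OF f]
  have lin: "linear f" and norm: "\<And>x. norm (f x) = norm x"
    using f by (auto simp: orthogonal_transformation)
  have *: "distr ?U lborel f = ?U"
    using distr_lborel_orthogonal[OF f]
    by (intro distr_uniform_measure) (auto simp: norm cong: distr_cong)
  have "distr sphere_measure borel f = distr ?U borel (f \<circ> sgn)"
    unfolding sphere_measure_def by (subst distr_distr) auto
  also have "f \<circ> sgn = sgn \<circ> f"
    by (simp add: fun_eq_iff sgn_div_norm norm linear_cmul[OF lin])
  also have "distr ?U borel (sgn \<circ> f) = distr (distr ?U lborel f) borel sgn"
    by (subst distr_distr) auto
  finally show ?thesis
    by (simp add: * sphere_measure_def)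
qed

section \<open>Moments of isotropic measures\<close>

text \<open>For a unit vector \<open>b\<close>, the squared norm of \<open>a + s *\<^sub>R b\<close>
  is the quadratic in \<open>s\<close> with \<open>A = norm a ^ 2\<close>,
  \<open>B = 2 * (a \<bullet> b)\<close> and \<open>C = 1\<close>. The truncated exponents
  \<open>k - 1\<close> and \<open>k - 2\<close> do no harm, because \<open>k\<close> and
  \<open>k choose 2\<close> vanish where truncation occurs.\<close>

lemma coeff_quadratic_power:
  fixes A B C :: real
  shows "coeff ([:A, B, C:] ^ k) 0 = A ^ k"
    and "coeff ([:A, B, C:] ^ k) 1 = k * A ^ (k - 1) * B"
    and "coeff ([:A, B, C:] ^ k) 2 = k * A ^ (k - 1) * C + (k choose 2) * A ^ (k - 2) * B\<^sup>2"
proof -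
  have mult: "coeff ([:A, B, C:] * q) 0 = A * coeff q 0"
    "coeff ([:A, B, C:] * q) 1 = A * coeff q 1 + B * coeff q 0"
    "coeff ([:A, B, C:] * q) 2 = A * coeff q 2 + B * coeff q 1 + C * coeff q 0" for q
    by (simp_all add: numeral_2_eq_2)
  show c0: "coeff ([:A, B, C:] ^ k) 0 = A ^ k" for k
    by (induction k) (simp_all add: mult)
  show c1: "coeff ([:A, B, C:] ^ k) 1 = k * A ^ (k - 1) * B" for k
  proof (induction k)
    case (Suc k)
    then show ?case
      unfolding power_Suc mult c0 by (cases k) (simp_all add: algebra_simps)
  qed simp
  show "coeff ([:A, B, C:] ^ k) 2 = k * A ^ (k - 1) * C + (k choose 2) * A ^ (k - 2) * B\<^sup>2"
  proof (induction k)
    case (Suc k)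
    consider "k = 0" | "k = 1" | l where "k = Suc (Suc l)"
      by (metis One_nat_def not0_implies_Suc)
    then show ?case
      unfolding power_Suc mult c0 c1 Suc
      by cases (simp_all add: numeral_2_eq_2 algebra_simps)
  qed (simp add: numeral_2_eq_2)
qed

lemma coeff_even_quadratic_power:
  fixes A :: real
  shows "coeff ([:A, 0, 1:] ^ k) (2 * i) = (k choose i) * A ^ (k - i)"
    and "coeff ([:A, 0, 1:] ^ k) (2 * i + 1) = 0"
proof -
  have mult: "[:A, 0, 1:] * q = smult A q + pCons 0 (pCons 0 q)" for q :: "real poly"
    by simp
  show "coeff ([:A, 0, 1:] ^ k) (2 * i) = (k choose i) * A ^ (k - i)"
  proof (induction k arbitrary: i)
    case (Suc k)
    show ?case
    proof (cases i)
      case (Suc j)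
      have "A * ((k choose Suc j) * A ^ (k - Suc j)) = (k choose Suc j) * A ^ (k - j)"
        by (cases "Suc j \<le> k") (simp_all add: binomial_eq_0 flip: power_Suc Suc_diff_Suc)
      then show ?thesis
        using Suc.IH[of "Suc j"] Suc.IH[of j]
        by (simp add: Suc mult algebra_simps del: mult_pCons_left)
    qed (use Suc.IH[of 0] in \<open>simp add: mult del: mult_pCons_left\<close>)
  qed (cases i; simp)
  show "coeff ([:A, 0, 1:] ^ k) (2 * i + 1) = 0"
  proof (induction k arbitrary: i)
    case (Suc k)
    show ?case
      using Suc.IH[of i] Suc.IH[of "i - 1"]
      by (cases i) (simp_all add: mult del: mult_pCons_left)
  qed simp
qed

text \<open>By the binomial theorem the left-hand side of \<open>eq\<close> is a polynomial in
  \<open>s\<close> whose coefficients are the scaled mixed moments; agreeing with \<open>q\<close>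
  at every real \<open>s\<close>, it is \<open>q\<close>.\<close>

lemma moment_binomial_coeff:
  fixes M :: "'a::euclidean_space measure"
  assumes int: "\<And>i j. integrable M (\<lambda>u. (a \<bullet> u) ^ i * (b \<bullet> u) ^ j)"
    and eq: "\<And>s. (\<integral>u. ((a + s *\<^sub>R b) \<bullet> u) ^ m \<partial>M) = poly q s"
    and i: "i \<le> m"
  shows "(m choose i) * (\<integral>u. (a \<bullet> u) ^ (m - i) * (b \<bullet> u) ^ i \<partial>M) = coeff q i"
proof -
  define J where "J j = (m choose j) * (\<integral>u. (a \<bullet> u) ^ (m - j) * (b \<bullet> u) ^ j \<partial>M)" for j
  define p where "p = (\<Sum>j\<le>m. monom (J j) j)"
  have "poly p s = poly q s" for s
  proof -
    have "((a + s *\<^sub>R b) \<bullet> u) ^ m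
        = (\<Sum>j\<le>m. ((m choose j) * s ^ j) * ((a \<bullet> u) ^ (m - j) * (b \<bullet> u) ^ j))" for u
      unfolding inner_add_left inner_scaleR_left add.commute[of "a \<bullet> u"] binomial_ring
      by (simp add: power_mult_distrib mult_ac)
    then have "poly q s = (\<Sum>j\<le>m. ((m choose j) * s ^ j) * (\<integral>u. (a \<bullet> u) ^ (m - j) * (b \<bullet> u) ^ j \<partial>M))"
      unfolding eq[symmetric] by (simp add: int)
    also have "\<dots> = poly p s"
      by (simp add: p_def J_def poly_sum poly_monom mult_ac)
    finally show ?thesis ..
  qed
  then have "p = q"
    by (intro poly_eq_poly_eq_iff[THEN iffD1] ext)
  moreover have "coeff p i = J i"
    using i by (simp add: p_def coeff_sum)
  ultimately show ?thesis
    by (simp add: J_def)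
qed

text \<open>The factors come from comparing the coefficients of \<open>s\<^sup>2\<close> in the moments of \<open>a + s b\<close> and summing
  over an orthonormal basis of vectors \<open>b\<close>.\<close>

lemma moment_descent:
  fixes M :: "'a::euclidean_space measure" and K :: real
  assumes int: "\<And>a b i j. integrable M (\<lambda>u. (a \<bullet> u) ^ i * (b \<bullet> u) ^ j)"
    and norm: "AE u in M. norm u = r"
    and eq: "\<And>a. (\<integral>u. (a \<bullet> u) ^ (2 * k + 2) \<partial>M) = K * norm a ^ (2 * k + 2)"
  shows "(2 * real k + 1) * r\<^sup>2 * (\<integral>u. (a \<bullet> u) ^ (2 * k) \<partial>M) = K * (real DIM('a) + 2 * real k) * norm a ^ (2 * k)"
proof -
  define A where "A = norm a ^ 2"
  have *: "((2 * k + 2) choose 2) * (\<integral>u. (a \<bullet> u) ^ (2 * k) * (b \<bullet> u) ^ 2 \<partial>M)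
      = K * ((k + 1) * A ^ k + (Suc k choose 2) * A ^ (k - 1) * (2 * (a \<bullet> b))\<^sup>2)"
    if "b \<in> Basis" for b
  proof -
    have "norm (a + s *\<^sub>R b) ^ (2 * k + 2) = poly ([:A, 2 * (a \<bullet> b), 1:] ^ Suc k) s" for s
    proof -
      have "norm (a + s *\<^sub>R b) ^ 2 = A + 2 * (a \<bullet> b) * s + s\<^sup>2"
        using that unfolding A_def power2_norm_eq_inner
        by (simp add: algebra_simps inner_simps inner_commute power2_eq_square)
      then have "norm (a + s *\<^sub>R b) ^ 2 = poly [:A, 2 * (a \<bullet> b), 1:] s"
        by (simp add: algebra_simps power2_eq_square)
      moreover have "norm (a + s *\<^sub>R b) ^ (2 * k + 2) = (norm (a + s *\<^sub>R b) ^ 2) ^ Suc k"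
        unfolding power_mult[symmetric] by simp
      ultimately show ?thesis by (simp only: poly_power)
    qed
    then have "(\<integral>u. ((a + s *\<^sub>R b) \<bullet> u) ^ (2 * k + 2) \<partial>M) = poly (smult K ([:A, 2 * (a \<bullet> b), 1:] ^ Suc k)) s" for s
      unfolding eq by simp
    from moment_binomial_coeff[OF int this, of 2] show ?thesis
      unfolding coeff_smult coeff_quadratic_power by simp
  qed
  \<comment> \<open>By Parseval the squares \<open>(b \<bullet> u) ^ 2\<close> add up to
    \<open>norm u ^ 2\<close>, which is \<open>r\<^sup>2\<close> almost everywhere.\<close>
  have "(\<Sum>b\<in>Basis. \<integral>u. (a \<bullet> u) ^ (2 * k) * (b \<bullet> u) ^ 2 \<partial>M) = (\<integral>u. r\<^sup>2 * (a \<bullet> u) ^ (2 * k) \<partial>M)"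
  proof -
    have "(\<Sum>b\<in>Basis. \<integral>u. (a \<bullet> u) ^ (2 * k) * (b \<bullet> u) ^ 2 \<partial>M)
        = (\<integral>u. (\<Sum>b\<in>Basis. (a \<bullet> u) ^ (2 * k) * (b \<bullet> u) ^ 2) \<partial>M)"
      by (rule Bochner_Integration.integral_sum[symmetric]) (rule int)
    also have "\<dots> = (\<integral>u. r\<^sup>2 * (a \<bullet> u) ^ (2 * k) \<partial>M)"
    proof (rule integral_cong_AE)
      have "(\<Sum>b\<in>Basis. (a \<bullet> u) ^ (2 * k) * (b \<bullet> u) ^ 2) = (norm u)\<^sup>2 * (a \<bullet> u) ^ (2 * k)" for u :: 'a
        unfolding power2_norm_eq_inner sum_distrib_left[symmetric]
        by (subst euclidean_inner) (simp add: inner_commute power2_eq_square)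
      then show "AE u in M. (\<Sum>b\<in>Basis. (a \<bullet> u) ^ (2 * k) * (b \<bullet> u) ^ 2) = r\<^sup>2 * (a \<bullet> u) ^ (2 * k)"
        using norm by auto
    qed (use int[of a "2 * k" _ 2] int[of a "2 * k" _ 0] in \<open>auto intro!: borel_measurable_sum borel_measurable_integrable\<close>)
    finally show ?thesis .
  qed
  then have "((2 * k + 2) choose 2) * r\<^sup>2 * (\<integral>u. (a \<bullet> u) ^ (2 * k) \<partial>M)
      = (\<Sum>b\<in>Basis. ((2 * k + 2) choose 2) * (\<integral>u. (a \<bullet> u) ^ (2 * k) * (b \<bullet> u) ^ 2 \<partial>M))"
    by (simp add: sum_distrib_left[symmetric])
  also have "\<dots> = (\<Sum>b\<in>Basis. K * ((k + 1) * A ^ k + (Suc k choose 2) * A ^ (k - 1) * 4 * (a \<bullet> b)\<^sup>2))"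
    by (intro sum.cong refl) (subst *, simp_all add: power_mult_distrib)
  also have "\<dots> = K * ((k + 1) * A ^ k * DIM('a) + (Suc k choose 2) * A ^ (k - 1) * 4 * A)"
    unfolding A_def power2_norm_eq_inner euclidean_inner[of a a]
    by (simp add: sum.distrib sum_distrib_left[symmetric] mult.assoc power2_eq_square)
  \<comment> \<open>At \<open>k = 0\<close> the product \<open>A ^ (k - 1) * A\<close> is not
    \<open>A ^ k\<close>, but the binomial coefficient vanishes.\<close>
  also have "(Suc k choose 2) * A ^ (k - 1) * 4 * A = 2 * k * (k + 1) * A ^ k"
  proof (cases k)
    case (Suc l)
    have "real (2 * (Suc k choose 2)) = Suc k * k"
      by (simp only: choose_two) simp
    then have c: "real (Suc k choose 2) = (real k + 1) * real k / 2"
      by (simp add: field_simps)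
    show ?thesis unfolding c using Suc by (simp add: field_simps)
  qed simp
  finally have "((2 * k + 2) choose 2) * r\<^sup>2 * (\<integral>u. (a \<bullet> u) ^ (2 * k) \<partial>M)
      = (K * (DIM('a) + 2 * k) * A ^ k) * (real k + 1)"
    by (simp add: algebra_simps)
  moreover have "real ((2 * k + 2) choose 2) = (real k + 1) * (2 * k + 1)"
    by (simp add: choose_two algebra_simps)
  moreover have "d * q * X = R" if "b * q * X = R * c" "b = c * d" "c \<noteq> 0" for b c d q X R :: real
    using that by (simp add: mult.assoc mult.left_commute[of _ c] mult.commute[of _ c])
  moreover have "real k + 1 \<noteq> 0" by linarith
  ultimately have "(2 * k + 1) * r\<^sup>2 * (\<integral>u. (a \<bullet> u) ^ (2 * k) \<partial>M) = K * (DIM('a) + 2 * k) * A ^ k"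
    by blast
  then show ?thesis
    by (simp add: A_def add.commute power_mult)
qed

text \<open>By orthogonality the squared norm of \<open>a + s *\<^sub>R b\<close> is
  \<open>norm a ^ 2 + s\<^sup>2\<close>, and the coefficients of its \<open>k\<close>-th power give
  the mixed moments. The use is to separate the direction \<open>b\<close> of a minimal vector from
  its orthogonal complement.\<close>

lemma joint_moments:
  fixes M :: "'a::euclidean_space measure" and K :: real
  assumes int: "\<And>a b i j. integrable M (\<lambda>u. (a \<bullet> u) ^ i * (b \<bullet> u) ^ j)"
    and eq: "\<And>a. (\<integral>u. (a \<bullet> u) ^ (2 * k) \<partial>M) = K * norm a ^ (2 * k)"
    and b: "norm b = 1" "a \<bullet> b = 0"
  shows "i \<le> k \<Longrightarrow> ((2 * k) choose (2 * i)) * (\<integral>u. (a \<bullet> u) ^ (2 * k - 2 * i) * (b \<bullet> u) ^ (2 * i) \<partial>M)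
      = K * (k choose i) * norm a ^ (2 * (k - i))"
    and "i < k \<Longrightarrow> (\<integral>u. (a \<bullet> u) ^ (2 * k - (2 * i + 1)) * (b \<bullet> u) ^ (2 * i + 1) \<partial>M) = 0"
proof -
  define A where "A = norm a ^ 2"
  have "norm (a + s *\<^sub>R b) ^ (2 * k) = poly ([:A, 0, 1:] ^ k) s" for s
  proof -
    have "norm (a + s *\<^sub>R b) ^ 2 = A + s\<^sup>2"
      using b unfolding A_def power2_norm_eq_inner norm_eq_1
      by (simp add: algebra_simps inner_simps inner_commute power2_eq_square)
    then have "norm (a + s *\<^sub>R b) ^ 2 = poly [:A, 0, 1:] s"
      by (simp add: algebra_simps power2_eq_square)
    then show ?thesis by (simp only: poly_power power_mult)
  qed
  then have *: "(\<integral>u. ((a + s *\<^sub>R b) \<bullet> u) ^ (2 * k) \<partial>M) = poly (smult K ([:A, 0, 1:] ^ k)) s" for s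
    unfolding eq by simp
  show "i \<le> k \<Longrightarrow> ((2 * k) choose (2 * i)) * (\<integral>u. (a \<bullet> u) ^ (2 * k - 2 * i) * (b \<bullet> u) ^ (2 * i) \<partial>M)
      = K * (k choose i) * norm a ^ (2 * (k - i))"
    using moment_binomial_coeff[OF int *, of "2 * i"]
    unfolding coeff_smult coeff_even_quadratic_power by (simp add: A_def power_mult)
  show "i < k \<Longrightarrow> (\<integral>u. (a \<bullet> u) ^ (2 * k - (2 * i + 1)) * (b \<bullet> u) ^ (2 * i + 1) \<partial>M) = 0"
    using moment_binomial_coeff[OF int *, of "2 * i + 1"]
    unfolding coeff_smult coeff_even_quadratic_power by simp
qed

section \<open>Designs and moments\<close>

text \<open>The \<open>d\<close>-th moment of one coordinate of a uniformly distributed unit vector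
  in dimension \<open>n\<close>; for even \<open>d\<close> it is 1 * 3 * ... * (d - 1) over n (n +
  2) ... (n + d - 2).\<close>

definition sphere_moment :: "nat \<Rightarrow> nat \<Rightarrow> real" where
  "sphere_moment n d =
     (if even d then \<Prod>j<d div 2. (2 * real j + 1) / (real n + 2 * real j) else 0)"

lemma integrable_sphere_moment:
  "integrable sphere_measure (\<lambda>u :: real ^ 'n. (a \<bullet> u) ^ i * (b \<bullet> u) ^ j)"
proof -
  interpret finite_measure "sphere_measure :: (real ^ 'n) measure"
    by (rule finite_measureI) (simp add: emeasure_sphere_measure)
  show ?thesis
  proof (rule integrable_const_bound[where B = "norm a ^ i * norm b ^ j"])
    show "AE u in sphere_measure. norm ((a \<bullet> u) ^ i * (b \<bullet> u) ^ j) \<le> norm a ^ i * norm b ^ j"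
      using AE_sphere_measure
    proof eventually_elim
      case (elim u)
      have "\<bar>c \<bullet> u\<bar> \<le> norm c" for c :: "real ^ 'n"
        using Cauchy_Schwarz_ineq2[of c u] elim by simp
      then show ?case
        by (auto simp: abs_mult power_abs intro!: mult_mono power_mono)
    qed
  qed simp
qed

lemma integral_sphere_orthogonal:
  fixes f :: "real ^ 'n::{finite,wellorder} \<Rightarrow> real ^ 'n::{finite,wellorder}"
  assumes f: "orthogonal_transformation f"
  shows "(\<integral>u. (f a \<bullet> u) ^ d \<partial>sphere_measure) = (\<integral>u. (a \<bullet> u) ^ d \<partial>sphere_measure)"
proof -
  note [measurable] = orthogonal_transformation_borel[OF f]
  have "(\<integral>u. (f a \<bullet> u) ^ d \<partial>sphere_measure) = (\<integral>u. (f a \<bullet> u) ^ d \<partial>distr sphere_measure borel f)"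
    by (simp add: distr_sphere_measure_orthogonal f)
  also have "\<dots> = (\<integral>u. (f a \<bullet> f u) ^ d \<partial>sphere_measure)"
    by (rule integral_distr) auto
  finally show ?thesis
    using f by (simp add: orthogonal_transformation_def)
qed

text \<open>Rotations act transitively on the vectors of a given norm, so one constant
  \<open>K k\<close> remains per even degree. \<open>moment_descent\<close> at a unit vector makes
  \<open>K (Suc k)\<close> equal to \<open>K k\<close> times
  \<open>(2 * k + 1) / (n + 2 * k)\<close>, with \<open>n\<close> the dimension.\<close>

theorem integral_sphere_inner_power:
  fixes a :: "real ^ 'n::{finite,wellorder}"
  shows "(\<integral>u. (a \<bullet> u) ^ d \<partial>sphere_measure) = sphere_moment CARD('n) d * norm a ^ d"
proof (cases "even d")
  case False
  \<comment> \<open>The antipodal map is orthogonal, so an odd moment equals its own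
    negative.\<close>
  have "(\<integral>u. (- a \<bullet> u) ^ d \<partial>sphere_measure) = (\<integral>u. (a \<bullet> u) ^ d \<partial>sphere_measure)"
    by (rule integral_sphere_orthogonal[of uminus]) (simp add: orthogonal_transformation linear_uminus)
  then show ?thesis
    using False by (simp add: sphere_moment_def)
next
  case True
  define e :: "(real, 'n) vec" where "e = axis undefined 1"
  define K where "K k = (\<integral>u. (e \<bullet> u) ^ (2 * k) \<partial>sphere_measure)" for k
  have e: "norm e = 1" by (simp add: e_def)
  have iso: "(\<integral>u. (a \<bullet> u) ^ (2 * k) \<partial>sphere_measure) = K k * norm a ^ (2 * k)" for a :: "(real, 'n) vec" and k
  proof -
    have "norm (norm a *\<^sub>R e) = norm a" by (simp add: e)
    then obtain f where f: "orthogonal_transformation f" "f (norm a *\<^sub>R e) = a"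
      by (rule orthogonal_transformation_exists)
    show ?thesis
      using integral_sphere_orthogonal[OF f(1), of "norm a *\<^sub>R e" "2 * k"]
      by (simp add: f(2) K_def power_mult_distrib mult.commute)
  qed
  have "K k = (\<Prod>j<k. (2 * real j + 1) / (real CARD('n) + 2 * real j))" for k
  proof (induction k)
    case 0
    then show ?case
      by (simp add: K_def measure_def emeasure_sphere_measure)
  next
    case (Suc k)
    have "(2 * real k + 1) * 1\<^sup>2 * K k = K (Suc k) * (real DIM((real, 'n) vec) + 2 * real k) * norm e ^ (2 * k)"
      unfolding K_def[of k]
      using iso[where k = "Suc k"]
      by (intro moment_descent integrable_sphere_moment AE_sphere_measure) simp
    moreover have "real CARD('n) + 2 * real k > 0"
      by (simp add: add_pos_nonneg)
    ultimately show ?case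
      using Suc by (simp add: e field_simps)
  qed
  then show ?thesis
    using iso[of a "d div 2"] True by (simp add: sphere_moment_def)
qed

section \<open>Powers of inner products as pairings of tensors\<close>

definition index_functions :: "nat \<Rightarrow> (nat \<Rightarrow> 'n) set" where
  "index_functions d = PiE {..<d} (\<lambda>_. UNIV)"

text \<open>A coordinate of the \<open>d\<close>-fold tensor power of \<open>x\<close>. Index tuples
  that differ by a permutation are kept apart, so that all coefficients in the expansion of
  \<open>(x \<bullet> y) ^ d\<close> are 1.\<close>

definition monomial :: "nat \<Rightarrow> (nat \<Rightarrow> 'n) \<Rightarrow> real ^ 'n::finite \<Rightarrow> real" where
  "monomial d f x = (\<Prod>j<d. x $ f j)"

lemma finite_index_functions [simp]: "finite (index_functions d :: (nat \<Rightarrow> 'n::finite) set)"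
  by (simp add: index_functions_def finite_PiE)

lemma inner_power_eq_sum_monomials:
  "(x \<bullet> y) ^ d = (\<Sum>f\<in>index_functions d. monomial d f x * monomial d f y)"
proof -
  have "(x \<bullet> y) ^ d = (\<Prod>j<d. \<Sum>i\<in>UNIV. x $ i * y $ i)"
    by (simp add: inner_vec_def)
  also have "\<dots> = (\<Sum>f\<in>index_functions d. \<Prod>j<d. x $ f j * y $ f j)"
    unfolding index_functions_def by (rule prod_sum_PiE) auto
  finally show ?thesis
    by (simp add: monomial_def prod.distrib)
qed

lemma integrable_monomial: "integrable sphere_measure (monomial d f :: real ^ 'n \<Rightarrow> real)"
proof -
  interpret finite_measure "sphere_measure :: (real ^ 'n) measure"
    by (rule finite_measureI) (simp add: emeasure_sphere_measure)
  show ?thesis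
  proof (rule integrable_const_bound[where B = 1])
    show "AE u in sphere_measure. norm (monomial d f u :: real) \<le> 1"
      using AE_sphere_measure
    proof eventually_elim
      case (elim u)
      then have "\<bar>u $ i\<bar> \<le> 1" for i
        using component_le_norm_cart[of u i] by simp
      then show ?case
        by (auto simp: monomial_def abs_prod intro!: prod_le_1)
    qed
  qed (simp add: monomial_def[abs_def])
qed

text \<open>The left-hand sides of the conclusion, minus the right-hand sides, are the coordinates of a
  tensor whose squared norm is the difference of the two sides of the hypothesis.\<close>

lemma monomial_averages_eq:
  fixes C :: "(real ^ 'n::{finite,wellorder}) set"
  assumes fin: "finite C" and sph: "C \<subseteq> sphere 0 1"
    and pairs: "(\<Sum>x\<in>C. \<Sum>y\<in>C. (x \<bullet> y) ^ d) = (card C)\<^sup>2 * sphere_moment CARD('n) d"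
    and f: "f \<in> index_functions d"
  shows "(\<Sum>x\<in>C. monomial d f x) = card C * (\<integral>u. monomial d f u \<partial>sphere_measure)"
proof -
  let ?F = "index_functions d :: (nat \<Rightarrow> 'n) set"
  define m where "m f = (\<integral>u. monomial d f u \<partial>(sphere_measure :: ((real, 'n) vec) measure))" for f
  define s where "s f = (\<Sum>x\<in>C. monomial d f x)" for f
  let ?c = "sphere_moment CARD('n) d" and ?N = "real (card C)"
  have m: "(\<Sum>f\<in>?F. monomial d f x * m f) = ?c" if "norm x = 1" for x :: "(real, 'n) vec"
  proof -
    have "(\<Sum>f\<in>?F. monomial d f x * m f) = (\<integral>u. (x \<bullet> u) ^ d \<partial>sphere_measure)"
      unfolding m_def inner_power_eq_sum_monomials
      by (simp add: integrable_monomial)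
    then show ?thesis
      using that by (simp add: integral_sphere_inner_power)
  qed
  have ss: "(\<Sum>f\<in>?F. s f * s f) = ?N\<^sup>2 * ?c"
  proof -
    have "(\<Sum>f\<in>?F. s f * s f) = (\<Sum>f\<in>?F. \<Sum>x\<in>C. \<Sum>y\<in>C. monomial d f x * monomial d f y)"
      by (simp add: s_def sum_product)
    also have "\<dots> = (\<Sum>x\<in>C. \<Sum>y\<in>C. \<Sum>f\<in>?F. monomial d f x * monomial d f y)"
      by (subst sum.swap) (intro sum.cong refl sum.swap)
    finally show ?thesis
      using pairs by (simp add: inner_power_eq_sum_monomials)
  qed
  have sm: "(\<Sum>f\<in>?F. s f * m f) = ?N * ?c"
  proof -
    have "(\<Sum>f\<in>?F. s f * m f) = (\<Sum>x\<in>C. \<Sum>f\<in>?F. monomial d f x * m f)"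
      unfolding s_def sum_distrib_right by (rule sum.swap)
    also have "\<dots> = (\<Sum>x\<in>C. ?c)"
      using sph by (intro sum.cong m) auto
    finally show ?thesis by simp
  qed
  have mm: "(\<Sum>f\<in>?F. m f * m f) = ?c"
  proof -
    have "(\<Sum>f\<in>?F. m f * m f) = (\<integral>u. (\<Sum>f\<in>?F. monomial d f u * m f) \<partial>(sphere_measure :: ((real, 'n) vec) measure))"
      unfolding m_def[of "_ :: nat \<Rightarrow> 'n"] by (simp add: integrable_monomial)
    also have "\<dots> = (\<integral>u. ?c \<partial>(sphere_measure :: ((real, 'n) vec) measure))"
    proof (rule integral_cong_AE)
      show "AE u in sphere_measure. (\<Sum>f\<in>?F. monomial d f u * m f) = ?c"
        using AE_sphere_measure by eventually_elim (rule m)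
    qed (simp_all add: monomial_def[abs_def])
    finally show ?thesis
      by (simp add: measure_def emeasure_sphere_measure)
  qed
  \<comment> \<open>The three inner products are \<open>?N\<^sup>2 * ?c\<close>,
    \<open>?N * ?c\<close> and \<open>?c\<close>, so the expansion cancels.\<close>
  have "(\<Sum>f\<in>?F. (s f - ?N * m f)\<^sup>2)
      = (\<Sum>f\<in>?F. s f * s f) - 2 * ?N * (\<Sum>f\<in>?F. s f * m f) + ?N\<^sup>2 * (\<Sum>f\<in>?F. m f * m f)"
    by (simp add: power2_eq_square algebra_simps sum.distrib sum_subtractf sum_distrib_left)
  also have "\<dots> = 0"
    unfolding ss sm mm by (simp add: power2_eq_square)
  finally have "\<forall>f\<in>?F. (s f - ?N * m f)\<^sup>2 = 0"
    by (subst (asm) sum_nonneg_eq_0_iff) auto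
  then show ?thesis
    using f by (simp add: s_def m_def)
qed

text \<open>The hypothesis involves directions in \<open>C\<close> only; equality of the averaged
  tensors carries the moment over to every direction \<open>a\<close>.\<close>

lemma sum_inner_power_eq:
  fixes C :: "(real ^ 'n::{finite,wellorder}) set"
  assumes "finite C" "C \<subseteq> sphere 0 1"
    and "(\<Sum>x\<in>C. \<Sum>y\<in>C. (x \<bullet> y) ^ d) = (card C)\<^sup>2 * sphere_moment CARD('n) d"
  shows "(\<Sum>y\<in>C. (a \<bullet> y) ^ d) = card C * sphere_moment CARD('n) d * norm a ^ d"
proof -
  have "(\<Sum>y\<in>C. (a \<bullet> y) ^ d) = (\<Sum>f\<in>index_functions d. monomial d f a * (\<Sum>y\<in>C. monomial d f y))"
    unfolding inner_power_eq_sum_monomials sum_distrib_left by (rule sum.swap)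
  also have "\<dots> = (\<Sum>f\<in>index_functions d. monomial d f a * (card C * (\<integral>u. monomial d f u \<partial>sphere_measure)))"
    by (intro sum.cong refl) (simp add: monomial_averages_eq[OF assms])
  also have "\<dots> = card C * (\<integral>u. (a \<bullet> u) ^ d \<partial>sphere_measure)"
    unfolding inner_power_eq_sum_monomials by (simp add: integrable_monomial sum_distrib_left mult_ac)
  finally show ?thesis
    by (simp add: integral_sphere_inner_power)
qed

section \<open>Polynomials and designs in terms of tensor coordinates\<close>

lemma exponents_monomial:
  fixes \<alpha> :: "'n::finite \<Rightarrow> nat"
  assumes "(\<Sum>i\<in>UNIV. \<alpha> i) = d"
  shows "\<exists>f\<in>index_functions d. \<forall>x. (\<Prod>i\<in>UNIV. x $ i ^ \<alpha> i) = monomial d f x"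
  using assms
proof (induction d arbitrary: \<alpha>)
  case 0
  then show ?case by (simp add: index_functions_def monomial_def)
next
  case (Suc d)
  then obtain i where i: "\<alpha> i \<noteq> 0"
    by (metis (mono_tags, lifting) nat.distinct(1) sum.neutral)
  define \<beta> where "\<beta> = \<alpha>(i := \<alpha> i - 1)"
  have \<alpha>: "\<alpha> i = Suc (\<beta> i)" "\<And>j. j \<noteq> i \<Longrightarrow> \<alpha> j = \<beta> j"
    using i by (simp_all add: \<beta>_def)
  have "sum \<alpha> UNIV = Suc (sum \<beta> UNIV)"
    by (simp add: sum.remove[of UNIV i] \<alpha>)
  then obtain f where f: "f \<in> index_functions d" "\<And>x. (\<Prod>i\<in>UNIV. x $ i ^ \<beta> i) = monomial d f x"
    using Suc.IH[of \<beta>] Suc.prems by auto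
  have "(\<Prod>j\<in>UNIV. x $ j ^ \<alpha> j) = monomial (Suc d) (f(d := i)) x" for x :: "real ^ 'n"
  proof -
    have "(\<Prod>j\<in>UNIV. x $ j ^ \<alpha> j) = x $ i * (\<Prod>j\<in>UNIV. x $ j ^ \<beta> j)"
      by (simp add: prod.remove[of UNIV i] \<alpha>)
    also have "\<dots> = monomial (Suc d) (f(d := i)) x"
      by (simp add: f monomial_def)
    finally show ?thesis .
  qed
  moreover have "f(d := i) \<in> index_functions (Suc d)"
    using f(1) by (auto simp: index_functions_def PiE_def extensional_def)
  ultimately show ?case by blast
qed

lemma monomial_in_polynomials_upto:
  fixes f :: "nat \<Rightarrow> 'n::finite"
  assumes "d \<le> e"
  shows "monomial d f \<in> polynomials_upto e"
proof -
  define \<alpha> where "\<alpha> i = card {j\<in>{..<d}. f j = i}" for i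
  have "(\<Sum>i\<in>UNIV. \<alpha> i) = d"
    using sum.group[of "{..<d}" UNIV f "\<lambda>_. 1::nat"] by (simp add: \<alpha>_def)
  then have \<alpha>: "\<alpha> \<in> exponents e"
    using assms by (simp add: exponents_def)
  have "monomial d f x = (\<Prod>i\<in>UNIV. x $ i ^ \<alpha> i)" for x
    using prod.group[of "{..<d}" UNIV f "\<lambda>j. x $ f j"] by (simp add: \<alpha>_def monomial_def)
  then have "monomial d f = (\<lambda>x. \<Sum>\<beta>\<in>exponents e. of_bool (\<beta> = \<alpha>) * (\<Prod>i\<in>UNIV. x $ i ^ \<beta> i))"
    using \<alpha> by (simp add: finite_exponents fun_eq_iff[of "monomial d f"])
  then show ?thesis
    unfolding polynomials_upto_def by (intro CollectI exI)
qed

text \<open>A monomial of total degree \<open>d\<close> is a coordinate of the \<open>d\<close>-th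
  tensor power, so averages may be compared one degree at a time.\<close>

lemma spherical_designI:
  fixes C :: "(real ^ 'n::{finite,wellorder}) set"
  assumes fin: "finite C" and sph: "C \<subseteq> sphere 0 1" and ne: "C \<noteq> {}"
    and pairs: "\<And>d. d \<le> \<tau> \<Longrightarrow> (\<Sum>x\<in>C. \<Sum>y\<in>C. (x \<bullet> y) ^ d) = (card C)\<^sup>2 * sphere_moment CARD('n) d"
  shows "spherical_design \<tau> C"
proof -
  have "(\<Sum>x\<in>C. p x) / card C = (\<integral>x. p x \<partial>sphere_measure)" if p: "p \<in> polynomials_upto \<tau>" for p
  proof -
    from p obtain c where p: "p = (\<lambda>x. \<Sum>\<alpha>\<in>exponents \<tau>. c \<alpha> * (\<Prod>i\<in>UNIV. x $ i ^ \<alpha> i))"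
      unfolding polynomials_upto_def by blast
    have *: "integrable sphere_measure (\<lambda>x :: (real, 'n) vec. \<Prod>i\<in>UNIV. x $ i ^ \<alpha> i) \<and>
      (\<Sum>x\<in>C. (\<Prod>i\<in>UNIV. x $ i ^ \<alpha> i)) = card C * (\<integral>x. (\<Prod>i\<in>UNIV. x $ i ^ \<alpha> i) \<partial>sphere_measure)"
      if "\<alpha> \<in> exponents \<tau>" for \<alpha>
    proof -
      obtain f where "f \<in> index_functions (sum \<alpha> UNIV)"
        "\<And>x. (\<Prod>i\<in>UNIV. x $ i ^ \<alpha> i) = monomial (sum \<alpha> UNIV) f x"
        using exponents_monomial[OF refl, of \<alpha>] by blast
      then show ?thesis
        using that pairs[of "sum \<alpha> UNIV"]
        by (simp add: integrable_monomial monomial_averages_eq[OF fin sph] exponents_def)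
    qed
    have "(\<Sum>x\<in>C. p x) = (\<Sum>\<alpha>\<in>exponents \<tau>. c \<alpha> * (\<Sum>x\<in>C. \<Prod>i\<in>UNIV. x $ i ^ \<alpha> i))"
      unfolding p sum_distrib_left by (rule sum.swap)
    also have "\<dots> = card C * (\<integral>x. p x \<partial>sphere_measure)"
      unfolding p using * by (simp add: sum_distrib_left mult_ac)
    finally show ?thesis
      using fin ne by simp
  qed
  then show ?thesis
    using fin sph ne by (simp add: spherical_design_def spherical_code_def)
qed

text \<open>The form in which the linear programming bound uses a design.\<close>

lemma spherical_design_sum_inner_power:
  fixes C :: "(real ^ 'n::{finite,wellorder}) set"
  assumes C: "spherical_design \<tau> C" and d: "d \<le> \<tau>"
  shows "(\<Sum>y\<in>C. (a \<bullet> y) ^ d) = card C * sphere_moment CARD('n) d * norm a ^ d"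
proof -
  have N: "card C \<noteq> 0"
    using C by (auto simp: spherical_design_def spherical_code_def)
  have m: "(\<Sum>y\<in>C. monomial d f y) = card C * (\<integral>u. monomial d f u \<partial>sphere_measure)" for f :: "nat \<Rightarrow> 'n"
    using C monomial_in_polynomials_upto[OF d, of f] N
    by (auto simp: spherical_design_def field_simps)
  have "(\<Sum>y\<in>C. (a \<bullet> y) ^ d) = (\<Sum>f\<in>index_functions d. monomial d f a * (\<Sum>y\<in>C. monomial d f y))"
    unfolding inner_power_eq_sum_monomials sum_distrib_left by (rule sum.swap)
  also have "\<dots> = card C * (\<integral>u. (a \<bullet> u) ^ d \<partial>sphere_measure)"
    unfolding inner_power_eq_sum_monomials m by (simp add: integrable_monomial sum_distrib_left mult_ac)
  finally show ?thesis
    by (simp add: integral_sphere_inner_power)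
qed

section \<open>The generators of the Golay code\<close>

text \<open>Numbers the coordinates from 0 to 23, with 23 for the point at infinity, so that the
  finite checks run on naturals.\<close>

definition pts :: "nat \<Rightarrow> 23 option" where
  "pts n = (if n = 23 then None else Some (of_nat n))"

definition residues :: "nat list" where
  "residues = [1, 2, 3, 4, 6, 8, 9, 12, 13, 16, 18]"

text \<open>Executable membership of point \<open>n\<close> in generator \<open>a\<close>; the
  summand 23 keeps the subtraction from being truncated.\<close>

definition incident :: "nat \<Rightarrow> nat \<Rightarrow> bool" where
  "incident a n \<longleftrightarrow> n = 23 \<or> (n + 23 - a) mod 23 \<in> set residues"

lemma of_nat_23_eq_iff: "(of_nat m :: 23) = of_nat n \<longleftrightarrow> m mod 23 = n mod 23"
proof -
  have "Rep_bit1 (of_nat k :: 23) = int (k mod 23)" for k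
    unfolding bit1.of_nat_eq bit1.Rep_Abs_mod by (simp add: zmod_int)
  then show ?thesis
    by (metis Rep_bit1_inject of_nat_eq_iff)
qed

lemma UNIV_23: "(UNIV :: 23 set) = of_nat ` {..<23}"
proof -
  have "card (of_nat ` {..<23} :: 23 set) = CARD(23)"
    by (subst card_image) (auto simp: inj_on_def of_nat_23_eq_iff)
  then show ?thesis
    by (metis card_subset_eq finite subset_UNIV)
qed

lemma nonzero_squares_23:
  "{b\<^sup>2 | b :: 23. b \<noteq> 0} = of_nat ` set residues"
proof -
  have "{b\<^sup>2 | b :: 23. b \<noteq> 0} = (\<lambda>b. b\<^sup>2) ` of_nat ` {1..<23}"
  proof -
    have "{b :: 23. b \<noteq> 0} = of_nat ` {1..<23}"
    proof -
      have "{b :: 23. b \<noteq> 0} = UNIV - {of_nat 0}" by auto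
      also have "\<dots> = of_nat ` ({..<23} - {0})"
        unfolding UNIV_23 by (subst inj_on_image_set_diff[of _ "{..<23}"]) (auto simp: inj_on_def of_nat_23_eq_iff)
      also have "{..<23} - {0 :: nat} = {1..<23}" by auto
      finally show ?thesis .
    qed
    then show ?thesis by blast
  qed
  also have "\<dots> = of_nat ` (\<lambda>n. n\<^sup>2 mod 23) ` {1..<23}"
    by (auto simp: image_image of_nat_23_eq_iff simp flip: of_nat_power intro!: image_cong)
  also have "(\<lambda>n. n\<^sup>2 mod 23) ` {1..<23} = set residues"
    by code_simp
  finally show ?thesis .
qed

lemma golay_generator_incident:
  assumes "a < 23" "n < 24"
  shows "pts n \<in> golay_generator (of_nat a) \<longleftrightarrow> incident a n"
proof (cases "n = 23")
  case False
  have "{of_nat a + b\<^sup>2 | b :: 23. b \<noteq> 0} = (\<lambda>c. of_nat a + c) ` {b\<^sup>2 | b :: 23. b \<noteq> 0}"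
    by blast
  then have "pts n \<in> golay_generator (of_nat a) \<longleftrightarrow>
      (\<exists>c\<in>set residues. (of_nat n :: 23) = of_nat (a + c))"
    using False unfolding golay_generator_def nonzero_squares_23
    by (auto simp: pts_def)
  also have "\<dots> \<longleftrightarrow> (n + 23 - a) mod 23 \<in> set residues"
  proof -
    have "(of_nat n :: 23) = of_nat (a + c) \<longleftrightarrow> (n + 23 - a) mod 23 = c" if "c \<in> set residues" for c
    proof -
      obtain k where k: "n + 23 = a + k"
        using assms by (metis le_Suc_ex less_imp_le trans_le_add2)
      have "(of_nat n :: 23) = of_nat (a + k)"
        unfolding k[symmetric] of_nat_23_eq_iff by simp
      moreover have "c < 23"
        using that by (auto simp: residues_def)
      ultimately have "(of_nat n :: 23) = of_nat (a + c) \<longleftrightarrow> (of_nat k :: 23) = of_nat c"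
        by simp
      also have "\<dots> \<longleftrightarrow> (n + 23 - a) mod 23 = c"
        using \<open>c < 23\<close> by (simp add: k of_nat_23_eq_iff)
      finally show ?thesis .
    qed
    then show ?thesis by blast
  qed
  finally show ?thesis
    using False by (simp add: incident_def)
qed (simp add: pts_def golay_generator_def incident_def)

lemma bij_betw_pts: "bij_betw pts {..<24} UNIV"
proof -
  have "inj_on pts {..<24}"
    by (auto simp: inj_on_def pts_def of_nat_23_eq_iff split: if_splits)
  moreover have "pts ` {..<24} = UNIV"
  proof -
    have "card (pts ` {..<24}) = CARD(23 option)"
      using \<open>inj_on pts {..<24}\<close> by (simp add: card_image)
    then show ?thesis
      by (metis card_subset_eq finite subset_UNIV)
  qed
  ultimately show ?thesis by (simp add: bij_betw_def)
qed

lemma pts_cases: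
  obtains n where "n < 24" "x = pts n"
  using bij_betw_imp_surj_on[OF bij_betw_pts] by (metis UNIV_I imageE lessThan_iff)

text \<open>Columns of the generator matrix formed by the first twelve generators: any four of them are
  linearly independent over the field with two elements.\<close>

definition column :: "nat \<Rightarrow> bool list" where
  "column n = map (\<lambda>a. incident a n) [0..<12]"

definition columns :: "bool list list" where
  "columns = map column [0..<24]"

text \<open>Entrywise \<open>(\<noteq>)\<close> is addition over the field with two elements. The
  three nested searches run through increasing positions and exclude that the sum of three entries
  is a fourth, that is, that four entries sum to zero.\<close>

fun no_sum2 :: "bool list list \<Rightarrow> bool list \<Rightarrow> bool" where
  "no_sum2 [] c = True"
| "no_sum2 (d # ds) c = (map2 (\<noteq>) c d \<notin> set ds \<and> no_sum2 ds c)"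

fun no_sum3 :: "bool list list \<Rightarrow> bool list \<Rightarrow> bool" where
  "no_sum3 [] c = True"
| "no_sum3 (d # ds) c = (no_sum2 ds (map2 (\<noteq>) c d) \<and> no_sum3 ds c)"

fun no_relation4 :: "bool list list \<Rightarrow> bool" where
  "no_relation4 [] = True"
| "no_relation4 (c # cs) = (no_sum3 cs c \<and> no_relation4 cs)"

text \<open>The incidence matrix as a literal, so that the searches below need no arithmetic modulo
  23.\<close>

definition rows :: "bool list list" where
  "rows =
   [[False, True, True, True, True, False, True, False, True, True, False, False, True, True, False, False, True, False, True, False, False, False, False, True],
    [False, False, True, True, True, True, False, True, False, True, True, False, False, True, True, False, False, True, False, True, False, False, False, True],
    [False, False, False, True, True, True, True, False, True, False, True, True, False, False, True, True, False, False, True, False, True, False, False, True],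
    [False, False, False, False, True, True, True, True, False, True, False, True, True, False, False, True, True, False, False, True, False, True, False, True],
    [False, False, False, False, False, True, True, True, True, False, True, False, True, True, False, False, True, True, False, False, True, False, True, True],
    [True, False, False, False, False, False, True, True, True, True, False, True, False, True, True, False, False, True, True, False, False, True, False, True],
    [False, True, False, False, False, False, False, True, True, True, True, False, True, False, True, True, False, False, True, True, False, False, True, True],
    [True, False, True, False, False, False, False, False, True, True, True, True, False, True, False, True, True, False, False, True, True, False, False, True],
    [False, True, False, True, False, False, False, False, False, True, True, True, True, False, True, False, True, True, False, False, True, True, False, True],
    [False, False, True, False, True, False, False, False, False, False, True, True, True, True, False, True, False, True, True, False, False, True, True, True],
    [True, False, False, True, False, True, False, False, False, False, False, True, True, True, True, False, True, False, True, True, False, False, True, True],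
    [True, True, False, False, True, False, True, False, False, False, False, False, True, True, True, True, False, True, False, True, True, False, False, True],
    [False, True, True, False, False, True, False, True, False, False, False, False, False, True, True, True, True, False, True, False, True, True, False, True],
    [False, False, True, True, False, False, True, False, True, False, False, False, False, False, True, True, True, True, False, True, False, True, True, True],
    [True, False, False, True, True, False, False, True, False, True, False, False, False, False, False, True, True, True, True, False, True, False, True, True],
    [True, True, False, False, True, True, False, False, True, False, True, False, False, False, False, False, True, True, True, True, False, True, False, True],
    [False, True, True, False, False, True, True, False, False, True, False, True, False, False, False, False, False, True, True, True, True, False, True, True],
    [True, False, True, True, False, False, True, True, False, False, True, False, True, False, False, False, False, False, True, True, True, True, False, True],
    [False, True, False, True, True, False, False, True, True, False, False, True, False, True, False, False, False, False, False, True, True, True, True, True],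
    [True, False, True, False, True, True, False, False, True, True, False, False, True, False, True, False, False, False, False, False, True, True, True, True],
    [True, True, False, True, False, True, True, False, False, True, True, False, False, True, False, True, False, False, False, False, False, True, True, True],
    [True, True, True, False, True, False, True, True, False, False, True, True, False, False, True, False, True, False, False, False, False, False, True, True],
    [True, True, True, True, False, True, False, True, True, False, False, True, True, False, False, True, False, True, False, False, False, False, False, True]]"

lemma rows_eq: "map (\<lambda>a. map (incident a) [0..<24]) [0..<23] = rows"
  by code_simp

lemma nth_rows: "a < 23 \<Longrightarrow> rows ! a = map (incident a) [0..<24]"
  unfolding rows_eq[symmetric] by simp

lemma columns_eq: "columns = map (\<lambda>n. map (\<lambda>r. r ! n) (take 12 rows)) [0..<24]"
  unfolding columns_def column_def rows_eq[symmetric]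
  by (simp add: take_map del: upt_Suc)

lemma distinct_columns: "distinct columns"
  unfolding columns_eq by code_simp

lemma no_relation4_columns: "no_relation4 columns"
  unfolding columns_eq by code_simp

fun parity_Int :: "bool list \<Rightarrow> bool list \<Rightarrow> bool" where
  "parity_Int (x # xs) (y # ys) = ((x \<and> y) \<noteq> parity_Int xs ys)"
| "parity_Int _ _ = False"

lemma parity_Int_map:
  "parity_Int (map f ns) (map g ns) \<longleftrightarrow> odd (length (filter (\<lambda>n. f n \<and> g n) ns))"
  by (induction ns) auto

lemma parity_Int_rows: "list_all (\<lambda>r. list_all (\<lambda>s. \<not> parity_Int r s) rows) rows"
  by code_simp

section \<open>From independent columns to odd intersections\<close>

lemma no_sum2_nth:
  "no_sum2 ds c \<Longrightarrow> i < j \<Longrightarrow> j < length ds \<Longrightarrow> map2 (\<noteq>) c (ds ! i) \<noteq> ds ! j"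
proof (induction ds arbitrary: i j)
  case (Cons d ds)
  obtain j' where "j = Suc j'" using Cons.prems by (cases j) auto
  then show ?case using Cons by (cases i) auto
qed simp

lemma no_sum3_nth:
  "no_sum3 ds c \<Longrightarrow> i < j \<Longrightarrow> j < k \<Longrightarrow> k < length ds \<Longrightarrow>
    map2 (\<noteq>) (map2 (\<noteq>) c (ds ! i)) (ds ! j) \<noteq> ds ! k"
proof (induction ds arbitrary: i j k)
  case (Cons d ds)
  obtain j' k' where "j = Suc j'" "k = Suc k'" using Cons.prems by (cases j; cases k) auto
  then show ?case using Cons by (cases i) (auto dest: no_sum2_nth)
qed simp

lemma no_relation4_nth:
  "no_relation4 cs \<Longrightarrow> i < j \<Longrightarrow> j < k \<Longrightarrow> k < l \<Longrightarrow> l < length cs \<Longrightarrow>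
    map2 (\<noteq>) (map2 (\<noteq>) (cs ! i) (cs ! j)) (cs ! k) \<noteq> cs ! l"
proof (induction cs arbitrary: i j k l)
  case (Cons c cs)
  obtain j' k' l' where "j = Suc j'" "k = Suc k'" "l = Suc l'"
    using Cons.prems by (cases j; cases k; cases l) auto
  then show ?case using Cons by (cases i) (auto dest: no_sum3_nth)
qed simp

lemma incident_parity2:
  assumes "i < j" "j < 24"
  shows "\<exists>a<23. incident a i \<noteq> incident a j"
proof -
  have "columns ! i \<noteq> columns ! j"
    using distinct_columns assms
    by (subst nth_eq_iff_index_eq) (auto simp: columns_def)
  then have "map (\<lambda>a. incident a i) [0..<12] \<noteq> map (\<lambda>a. incident a j) [0..<12]"
    using assms by (simp add: columns_def column_def del: upt_Suc)
  then have "\<not> (\<forall>a\<in>set [0..<12]. incident a i = incident a j)"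
    by (simp only: map_eq_conv not_False_eq_True)
  then obtain a where "a \<in> set [0..<12]" "incident a i \<noteq> incident a j"
    by blast
  then show ?thesis by (intro exI[of _ a]) simp
qed

lemma incident_parity4:
  assumes "i < j" "j < k" "k < l" "l < 24"
  shows "\<exists>a<23. ((incident a i \<noteq> incident a j) \<noteq> incident a k) \<noteq> incident a l"
proof -
  have "map2 (\<noteq>) (map2 (\<noteq>) (columns ! i) (columns ! j)) (columns ! k) \<noteq> columns ! l"
    using no_relation4_nth[OF no_relation4_columns assms(1-3)] assms
    by (simp add: columns_def)
  then have "map (\<lambda>a. (incident a i \<noteq> incident a j) \<noteq> incident a k) [0..<12]
      \<noteq> map (\<lambda>a. incident a l) [0..<12]"
    using assms by (simp add: columns_def column_def map2_map_map del: upt_Suc)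
  then have "\<not> (\<forall>a\<in>set [0..<12]. ((incident a i \<noteq> incident a j) \<noteq> incident a k) = incident a l)"
    by (simp only: map_eq_conv not_False_eq_True)
  then obtain a where "a \<in> set [0..<12]" "((incident a i \<noteq> incident a j) \<noteq> incident a k) \<noteq> incident a l"
    by blast
  then show ?thesis by (intro exI[of _ a]) simp
qed

lemma generator_intersections:
  assumes "a < 23" "b < 23"
  shows "even (length (filter (\<lambda>n. incident a n \<and> incident b n) [0..<24]))"
proof -
  have "rows ! a \<in> set rows" "rows ! b \<in> set rows"
    using assms by (auto simp flip: rows_eq intro!: nth_mem)
  then have "\<not> parity_Int (rows ! a) (rows ! b)"
    using parity_Int_rows by (auto simp: list_all_iff)
  then show ?thesis
    using assms by (simp only: nth_rows parity_Int_map not_not)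
qed

lemma generator_weights:
  "\<forall>a\<in>set [0..<23]. length (filter (incident a) [0..<24]) = 12"
  by code_simp

text \<open>A finite point lies in 11 generators and the point at infinity in all 23, so the sum of
  all generators is the full set.\<close>

lemma generator_sum:
  "\<forall>n\<in>set [0..<24]. odd (length (filter (\<lambda>a. incident a n) [0..<23]))"
  by code_simp

lemma card_generator_filter:
  assumes "a < 23"
  shows "card (S \<inter> golay_generator (of_nat a)) = card {n\<in>{..<24}. pts n \<in> S \<and> incident a n}"
proof -
  have "bij_betw pts {n\<in>{..<24}. pts n \<in> S \<and> incident a n} (S \<inter> golay_generator (of_nat a))"
  proof (rule bij_betw_subset[OF bij_betw_pts])
    show "pts ` {n\<in>{..<24}. pts n \<in> S \<and> incident a n} = S \<inter> golay_generator (of_nat a)"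
    proof (rule set_eqI)
      fix x
      obtain n where n: "n < 24" "x = pts n" by (rule pts_cases)
      show "x \<in> pts ` {n\<in>{..<24}. pts n \<in> S \<and> incident a n} \<longleftrightarrow> x \<in> S \<inter> golay_generator (of_nat a)"
        using inj_on_image_mem_iff[OF bij_betw_imp_inj_on[OF bij_betw_pts],
            of n "{n\<in>{..<24}. pts n \<in> S \<and> incident a n}"] n golay_generator_incident[OF assms n(1)]
        by auto
    qed
  qed auto
  then show ?thesis
    by (rule bij_betw_same_card[symmetric])
qed

text \<open>If every generator met \<open>S\<close> in an even number of points, the columns of the
  incidence matrix at the points of \<open>S\<close> would sum to zero.\<close>

lemma odd_generator_intersection:
  assumes "card S = 2 \<or> card S = 4"
  shows "\<exists>a. odd (card (S \<inter> golay_generator a))"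
proof -
  define I where "I = {n\<in>{..<24}. pts n \<in> S}"
  have "bij_betw pts I S"
  proof (rule bij_betw_subset[OF bij_betw_pts])
    show "pts ` I = S"
      by (auto simp: I_def image_iff) (metis pts_cases)
  qed (auto simp: I_def)
  then have card: "card I = card S" by (rule bij_betw_same_card)
  \<comment> \<open>Sorting matches the increasing positions in the searches.\<close>
  define xs where "xs = sorted_list_of_set I"
  have xs: "sorted xs" "distinct xs" "set xs = I" "length xs = card S"
    by (simp_all add: xs_def I_def flip: card)
  have "\<exists>a<23. odd (card {n\<in>set xs. incident a n})"
    using assms
  proof
    assume "card S = 2"
    with xs(4) obtain i j where ij: "xs = [i, j]"
      by (auto simp: numeral_eq_Suc length_Suc_conv)
    have "i < j" "j < 24"
      using xs by (auto simp: ij I_def)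
    from incident_parity2[OF this] obtain a where a: "a < 23" "incident a i \<noteq> incident a j"
      by blast
    have "card {n\<in>set xs. incident a n} = (\<Sum>n\<in>set xs. of_bool (incident a n))"
      by (simp add: Int_def)
    also have "odd \<dots>"
      using a \<open>i < j\<close> by (auto simp: ij simp del: sum_of_bool_eq)
    finally show ?thesis using a by blast
  next
    assume "card S = 4"
    with xs(4) obtain i j k l where ijkl: "xs = [i, j, k, l]"
      by (auto simp: numeral_eq_Suc length_Suc_conv)
    have *: "i < j" "j < k" "k < l" "l < 24"
      using xs by (auto simp: ijkl I_def)
    from incident_parity4[OF this] obtain a where
      a: "a < 23" "((incident a i \<noteq> incident a j) \<noteq> incident a k) \<noteq> incident a l"
      by blast
    have "card {n\<in>set xs. incident a n} = (\<Sum>n\<in>set xs. of_bool (incident a n))"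
      by (simp add: Int_def)
    also have "odd \<dots>"
      using a * by (auto simp: ijkl simp del: sum_of_bool_eq split: if_splits)
    finally show ?thesis using a by blast
  qed
  then obtain a where "a < 23" "odd (card {n\<in>I. incident a n})"
    using xs by auto
  then show ?thesis
    using card_generator_filter[of a S] by (intro exI[of _ "of_nat a"]) (simp add: I_def conj_assoc)
qed

section \<open>The extended binary Golay code\<close>

lemma sym_diff_golay:
  assumes "V \<in> golay_code" "W \<in> golay_code"
  shows "sym_diff V W \<in> golay_code"
  using assms(2)
proof induction
  case (2 W a)
  have "sym_diff V (sym_diff W (golay_generator a)) = sym_diff (sym_diff V W) (golay_generator a)"
    by blast
  then show ?case
    using golay_code.intros(2)[OF 2(2)] by simp
qed (simp add: assms(1))

lemma golay_generator_in_code: "golay_generator a \<in> golay_code"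
  using golay_code.intros(2)[OF golay_code.intros(1), of a] by simp

lemma of_nat_23_cases:
  obtains n where "n < 23" "(a :: 23) = of_nat n"
  using UNIV_23 by (metis UNIV_I imageE lessThan_iff)

lemma card_golay_generator: "card (golay_generator a) = 12"
proof -
  obtain n where n: "n < 23" "a = of_nat n" by (rule of_nat_23_cases)
  have "card (UNIV \<inter> golay_generator a) = card {m\<in>{..<24}. incident n m}"
    unfolding n(2) by (subst card_generator_filter[OF n(1)]) simp
  also have "{m\<in>{..<24}. incident n m} = set (filter (incident n) [0..<24])"
    by auto
  also have "card \<dots> = 12"
    using generator_weights n(1) by (subst distinct_card) auto
  finally show ?thesis by simp
qed

lemma even_generator_intersections: "even (card (golay_generator a \<inter> golay_generator b))"
proof -
  obtain m where m: "m < 23" "a = of_nat m" by (rule of_nat_23_cases)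
  obtain n where n: "n < 23" "b = of_nat n" by (rule of_nat_23_cases)
  have "card (golay_generator a \<inter> golay_generator b)
      = card {k\<in>{..<24}. pts k \<in> golay_generator a \<and> incident n k}"
    unfolding n(2) by (rule card_generator_filter[OF n(1)])
  also have "{k\<in>{..<24}. pts k \<in> golay_generator a \<and> incident n k}
      = set (filter (\<lambda>k. incident m k \<and> incident n k) [0..<24])"
    unfolding m(2) using golay_generator_incident[OF m(1)] by auto
  also have "card \<dots> = length (filter (\<lambda>k. incident m k \<and> incident n k) [0..<24])"
    by (subst distinct_card) auto
  also have "even \<dots>"
    using generator_intersections[OF m(1) n(1)] .
  finally show ?thesis .
qed

lemma card_sym_diff_eq:
  fixes V W :: "'a::finite set"
  shows "card (sym_diff V W) + 2 * card (V \<inter> W) = card V + card W"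
proof -
  have "card V = card (V - W) + card (V \<inter> W)" "card W = card (W - V) + card (V \<inter> W)"
    by (simp_all add: card_Diff_subset_Int Int_commute card_mono)
  moreover have "card (sym_diff V W) = card (V - W) + card (W - V)"
    by (rule card_Un_disjoint) auto
  ultimately show ?thesis by simp
qed

lemma even_card_sym_diff_Int:
  fixes V W U :: "'a::finite set"
  assumes "even (card (V \<inter> U))" "even (card (W \<inter> U))"
  shows "even (card (sym_diff V W \<inter> U))"
proof -
  have "sym_diff V W \<inter> U = sym_diff (V \<inter> U) (W \<inter> U)" by blast
  then show ?thesis
    using card_sym_diff_eq[of "V \<inter> U" "W \<inter> U"] assms
    by (metis dvd_add even_add even_mult_iff even_numeral)
qed

lemma even_golay_Int_generator:
  "W \<in> golay_code \<Longrightarrow> even (card (W \<inter> golay_generator b))"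
  by (induction rule: golay_code.induct)
     (simp_all add: even_card_sym_diff_Int even_generator_intersections)

lemma even_golay_Int:
  assumes "V \<in> golay_code" "W \<in> golay_code"
  shows "even (card (V \<inter> W))"
  using assms(1)
proof induction
  case (2 V a)
  have "even (card (golay_generator a \<inter> W))"
    using even_golay_Int_generator[OF assms(2)] by (simp add: Int_commute)
  with 2 show ?case by (simp add: even_card_sym_diff_Int)
qed simp

text \<open>Adding a generator changes the weight by 12 minus twice the size of the intersection,
  and the intersection is even.\<close>

lemma golay_doubly_even: "W \<in> golay_code \<Longrightarrow> 4 dvd card W"
proof (induction rule: golay_code.induct)
  case (2 W a)
  obtain k where "card (W \<inter> golay_generator a) = 2 * k"
    using even_golay_Int_generator[OF 2(1)] by blast
  then have "card (sym_diff W (golay_generator a)) + 4 * k = card W + 12"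
    using card_sym_diff_eq[of W "golay_generator a"] by (simp add: card_golay_generator)
  then show ?case
    using 2 by presburger
qed simp

lemma UNIV_in_golay: "UNIV \<in> golay_code"
proof -
  define f where "f = foldr (\<lambda>a W. sym_diff W (golay_generator (of_nat a))) "
  have "f as {} \<in> golay_code" for as
    by (induction as) (simp_all add: f_def golay_code.intros)
  moreover have "x \<in> f as {} \<longleftrightarrow> odd (length (filter (\<lambda>a. x \<in> golay_generator (of_nat a)) as))" for x as
    by (induction as) (auto simp: f_def)
  moreover have "odd (length (filter (\<lambda>a. x \<in> golay_generator (of_nat a)) [0..<23]))" for x
  proof -
    obtain n where n: "n < 24" "x = pts n" by (rule pts_cases)
    have "filter (\<lambda>a. x \<in> golay_generator (of_nat a)) [0..<23] = filter (\<lambda>a. incident a n) [0..<23]"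
      by (rule filter_cong) (use n golay_generator_incident in auto)
    then show ?thesis
      using generator_sum n(1) by simp
  qed
  ultimately have "f [0..<23] {} = UNIV" by blast
  with \<open>f [0..<23] {} \<in> golay_code\<close> show ?thesis by simp
qed

lemma Compl_in_golay: "W \<in> golay_code \<Longrightarrow> - W \<in> golay_code"
  using sym_diff_golay[OF _ UNIV_in_golay, of W] by (simp add: Compl_eq_Diff_UNIV)

text \<open>The code is orthogonal to itself, whereas no set of four points is orthogonal to all
  generators.\<close>

lemma golay_card_ne_4:
  assumes "W \<in> golay_code"
  shows "card W \<noteq> 4"
  using odd_generator_intersection[of W] even_golay_Int_generator[OF assms] by blast

text \<open>Complementation excludes the weight 20 along with the weight 4.\<close>

lemma golay_weights:
  assumes W: "W \<in> golay_code"
  shows "card W \<in> {0, 8, 12, 16, 24}"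
proof -
  have c: "card W + card (- W) = 24"
    using card_Un_disjoint[of W "- W"] by simp
  obtain k where k: "card W = 4 * k"
    using golay_doubly_even[OF W] by blast
  have "card W \<noteq> 4" "card (- W) \<noteq> 4"
    using golay_card_ne_4 W Compl_in_golay by blast+
  with c have "k \<le> 6" "k \<noteq> 1" "k \<noteq> 5" by (auto simp: k)
  then have "k \<in> {0, 2, 3, 4, 6}" by auto
  then show ?thesis by (auto simp: k)
qed

section \<open>Sign characters of the codewords and weight counts\<close>

definition word_sign :: "'a set \<Rightarrow> 'a \<Rightarrow> real" where
  "word_sign W i = (if i \<in> W then - 1 else 1)"

lemma word_sign_sym_diff: "word_sign (sym_diff V W) i = word_sign V i * word_sign W i"
  by (auto simp: word_sign_def)

lemma word_sign_square [simp]: "word_sign W i * word_sign W i = 1" "word_sign W i * (word_sign W i * x) = x"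
  by (simp_all add: word_sign_def)

lemma prod_sign: "finite S \<Longrightarrow> (\<Prod>i\<in>S. word_sign W i) = (- 1) ^ card (S \<inter> W)"
  by (simp add: word_sign_def prod.If_cases)

text \<open>Every point occurs an even number of times among the four indices; exactly then is the
  product of the four signs 1 for all codewords.\<close>

definition paired :: "'a \<Rightarrow> 'a \<Rightarrow> 'a \<Rightarrow> 'a \<Rightarrow> bool" where
  "paired i j k l \<longleftrightarrow> i = j \<and> k = l \<or> i = k \<and> j = l \<or> i = l \<and> j = k"

lemma word_sign_paired: "paired i j k l \<Longrightarrow> word_sign W i * word_sign W j * word_sign W k * word_sign W l = 1"
  by (auto simp: paired_def word_sign_def)

text \<open>If two of the indices coincide, their signs cancel and the other two are distinct;
  otherwise all four are distinct. Both cases are instances of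
  \<open>odd_generator_intersection\<close>.\<close>

lemma exists_odd_generator:
  assumes "\<not> paired i j k l"
  shows "\<exists>a. word_sign (golay_generator a) i * word_sign (golay_generator a) j *
    word_sign (golay_generator a) k * word_sign (golay_generator a) l = - 1"
proof -
  have two: "\<exists>a. word_sign (golay_generator a) x * word_sign (golay_generator a) y = - 1" if "x \<noteq> y" for x y
  proof -
    obtain a where "odd (card ({x, y} \<inter> golay_generator a))"
      using odd_generator_intersection[of "{x, y}"] \<open>x \<noteq> y\<close> by auto
    then have "(\<Prod>i\<in>{x, y}. word_sign (golay_generator a) i) = - 1"
      by (subst prod_sign) auto
    then show ?thesis using \<open>x \<noteq> y\<close> by auto
  qed
  consider "i = j" "k \<noteq> l" | "i = k" "j \<noteq> l" | "i = l" "j \<noteq> k" | "j = k" "i \<noteq> l" | "j = l" "i \<noteq> k"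
    | "k = l" "i \<noteq> j" | "distinct [i, j, k, l]"
    using assms by (auto simp: paired_def)
  then show ?thesis
  proof cases
    case 7
    obtain a where "odd (card ({i, j, k, l} \<inter> golay_generator a))"
      using odd_generator_intersection[of "{i, j, k, l}"] 7 by auto
    then have "(\<Prod>i\<in>{i, j, k, l}. word_sign (golay_generator a) i) = - 1"
      by (subst prod_sign) auto
    then show ?thesis using 7 by (intro exI[of _ a]) (simp add: mult.assoc)
  next
    case 1 with two[of k l] show ?thesis by (auto simp: mult.assoc)
  next
    case 2 with two[of j l] show ?thesis by (auto simp: mult_ac)
  next
    case 3 with two[of j k] show ?thesis by (auto simp: mult_ac)
  next
    case 4 with two[of i l] show ?thesis by (auto simp: mult.assoc)
  next
    case 5 with two[of i k] show ?thesis by (auto simp: mult_ac)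
  next
    case 6 with two[of i j] show ?thesis by (auto simp: mult.assoc)
  qed
qed

text \<open>Translation by \<open>V\<close> permutes the code and negates the summand.\<close>

lemma golay_sum_eq_0:
  fixes f :: "23 option set \<Rightarrow> real"
  assumes V: "V \<in> golay_code" and f: "\<And>W. W \<in> golay_code \<Longrightarrow> f (sym_diff W V) = - f W"
  shows "(\<Sum>W\<in>golay_code. f W) = 0"
proof -
  have inv: "sym_diff (sym_diff W V) V = W" for W by blast
  have "(\<Sum>W\<in>golay_code. f W) = (\<Sum>W\<in>golay_code. - f W)"
    by (rule sum.reindex_bij_witness[of _ "\<lambda>W. sym_diff W V" "\<lambda>W. sym_diff W V"])
       (use f sym_diff_golay[OF _ V] inv in auto)
  then show ?thesis by (simp add: sum_negf)
qed

lemma golay_sign_sum4: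
  "(\<Sum>W\<in>golay_code. word_sign W i * word_sign W j * word_sign W k * word_sign W l)
    = (if paired i j k l then real (card golay_code) else 0)"
proof (cases "paired i j k l")
  case False
  then obtain a where "word_sign (golay_generator a) i * word_sign (golay_generator a) j *
    word_sign (golay_generator a) k * word_sign (golay_generator a) l = - 1"
    using exists_odd_generator by blast
  then have "(\<Sum>W\<in>golay_code. word_sign W i * word_sign W j * word_sign W k * word_sign W l) = 0"
    by (intro golay_sum_eq_0[OF golay_generator_in_code[of a]])
       (simp add: word_sign_sym_diff mult_ac)
  then show ?thesis using False by simp
qed (simp add: word_sign_paired)

definition sign_sum :: "23 option set \<Rightarrow> real" where
  "sign_sum W = (\<Sum>i\<in>UNIV. word_sign W i)"

lemma sign_sum_eq: "sign_sum W = 24 - 2 * real (card W)"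
proof -
  have c: "card W + card (- W) = 24"
    using card_Un_disjoint[of W "- W"] by simp
  have "sign_sum W = real (card (- W)) - card W"
    unfolding sign_sum_def word_sign_def by (simp add: sum.If_cases Compl_eq)
  with c show ?thesis by linarith
qed

lemma golay_odd_sums:
  "(\<Sum>W\<in>golay_code. sign_sum W) = 0"
  "(\<Sum>W\<in>golay_code. word_sign W i * (sign_sum W)\<^sup>2) = 0"
  "(\<Sum>W\<in>golay_code. word_sign W i * word_sign W j * sign_sum W) = 0"
proof -
  have "word_sign (sym_diff W UNIV) i = - word_sign W i" for W :: "23 option set" and i
    by (simp add: word_sign_def)
  then have "sign_sum (sym_diff W UNIV) = - sign_sum W"
      "word_sign (sym_diff W UNIV) i = - word_sign W i" for W i
    by (simp_all add: sign_sum_def sum_negf)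
  then show "(\<Sum>W\<in>golay_code. sign_sum W) = 0"
    "(\<Sum>W\<in>golay_code. word_sign W i * (sign_sum W)\<^sup>2) = 0"
    "(\<Sum>W\<in>golay_code. word_sign W i * word_sign W j * sign_sum W) = 0"
    by (simp_all only: golay_sum_eq_0[OF UNIV_in_golay] power2_minus minus_mult_left[symmetric]
          mult_minus_left mult_minus_right minus_minus)
qed

lemma golay_sign_sum_product:
  "(\<Sum>W\<in>golay_code. word_sign W i * sign_sum W) = real (card golay_code)"
proof -
  \<comment> \<open>Two further signs at \<open>i\<close>, whose product is 1, bring the product of
    two signs into the four-fold form.\<close>
  have *: "word_sign W i * sign_sum W = (\<Sum>j\<in>UNIV. word_sign W i * word_sign W j * word_sign W i * word_sign W i)" for W
    by (simp add: sign_sum_def sum_distrib_left mult.assoc)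
  have "(\<Sum>W\<in>golay_code. word_sign W i * sign_sum W)
      = (\<Sum>j\<in>UNIV. if paired i j i i then real (card golay_code) else 0)"
    unfolding * by (subst sum.swap) (simp add: golay_sign_sum4)
  also have "\<dots> = (\<Sum>j\<in>UNIV. if j = i then real (card golay_code) else 0)"
    by (intro sum.cong) (auto simp: paired_def)
  finally show ?thesis by simp
qed

text \<open>For \<open>i = j\<close> the paired quadruples are the 24 with \<open>k = l\<close>; for
  \<open>i \<noteq> j\<close> they are the two in which \<open>k\<close> and \<open>l\<close> are
  \<open>i\<close> and \<open>j\<close> in some order.\<close>

lemma golay_sign_sum_square:
  "(\<Sum>W\<in>golay_code. word_sign W i * word_sign W j * (sign_sum W)\<^sup>2)
    = (if i = j then 24 else 2) * real (card golay_code)"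
proof -
  have *: "word_sign W i * word_sign W j * (sign_sum W)\<^sup>2
      = (\<Sum>k\<in>UNIV. \<Sum>l\<in>UNIV. word_sign W i * word_sign W j * word_sign W k * word_sign W l)" for W
    unfolding sign_sum_def power2_eq_square sum_product by (simp add: sum_distrib_left mult_ac)
  have "(\<Sum>W\<in>golay_code. word_sign W i * word_sign W j * (sign_sum W)\<^sup>2)
      = (\<Sum>k\<in>UNIV. \<Sum>l\<in>UNIV. \<Sum>W\<in>golay_code. word_sign W i * word_sign W j * word_sign W k * word_sign W l)"
    unfolding * by (subst sum.swap) (intro sum.cong refl sum.swap)
  also have "\<dots> = (\<Sum>k\<in>UNIV. \<Sum>l\<in>UNIV. if paired i j k l then real (card golay_code) else 0)"
    by (simp add: golay_sign_sum4)
  also have "\<dots> = (if i = j then 24 else 2) * real (card golay_code)"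
  proof (cases "i = j")
    case True
    then have "paired i j k l \<longleftrightarrow> k = l" for k l
      by (auto simp: paired_def)
    then show ?thesis using True by simp
  next
    case False
    then have "(if paired i j k l then real (card golay_code) else 0)
        = (if l = j then if k = i then real (card golay_code) else 0 else 0)
        + (if l = i then if k = j then real (card golay_code) else 0 else 0)" for k l
      by (auto simp: paired_def)
    then show ?thesis using False by (simp add: sum.distrib)
  qed
  finally show ?thesis .
qed

lemma sign_sum_values:
  assumes "W \<in> golay_code"
  shows "(sign_sum W = 24 \<and> W = {}) \<or> (sign_sum W = 8 \<and> card W = 8) \<or> sign_sum W = 0 \<and> card W = 12
    \<or> sign_sum W = - 8 \<and> card W = 16 \<or> sign_sum W = - 24 \<and> W = UNIV"
  using golay_weights[OF assms] card_subset_eq[of UNIV W] by (auto simp: sign_sum_eq)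

text \<open>The polynomial \<open>X\<^sup>2 (X\<^sup>2 - 64)\<close> in \<open>X = sign_sum W\<close> vanishes except at the words \<open>{}\<close> and \<open>UNIV\<close>.\<close>

lemma card_golay_code: "card golay_code = 4096"
proof -
  let ?M = "real (card golay_code)"
  have sq: "(\<Sum>W\<in>golay_code. (sign_sum W)\<^sup>2) = 24 * ?M"
    using golay_sign_sum_square[of undefined undefined] by simp
  have "(sign_sum W)\<^sup>2 * x = (\<Sum>i\<in>UNIV. \<Sum>j\<in>UNIV. word_sign W i * word_sign W j * x)" for W x
    by (simp only: sign_sum_def power2_eq_square sum_product) (simp only: sum_distrib_right)
  then have "(\<Sum>W\<in>golay_code. (sign_sum W)\<^sup>2 * (sign_sum W)\<^sup>2)
      = (\<Sum>W\<in>golay_code. \<Sum>i\<in>UNIV. \<Sum>j\<in>UNIV. word_sign W i * word_sign W j * (sign_sum W)\<^sup>2)"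
    by (simp only:)
  also have "\<dots> = (\<Sum>i\<in>UNIV. \<Sum>j\<in>UNIV. \<Sum>W\<in>golay_code. word_sign W i * word_sign W j * (sign_sum W)\<^sup>2)"
    by (subst sum.swap) (intro sum.cong refl sum.swap)
  \<comment> \<open>Each of the 576 pairs contributes \<open>2 * ?M\<close>, the 24 diagonal ones
    \<open>22 * ?M\<close> more: 1152 + 528 = 1680.\<close>
  also have "\<dots> = (\<Sum>i\<in>UNIV. \<Sum>j\<in>(UNIV :: 23 option set). 2 * ?M + (if i = j then 22 * ?M else 0))"
    by (intro sum.cong refl) (simp add: golay_sign_sum_square)
  also have "\<dots> = 1680 * ?M"
    by (simp add: sum.distrib)
  finally have fourth: "(\<Sum>W\<in>golay_code. (sign_sum W)\<^sup>2 * (sign_sum W)\<^sup>2) = 1680 * ?M" .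
  \<comment> \<open>The value at \<open>sign_sum W = 24\<close> or \<open>- 24\<close> is 576 * 512
    = 294912.\<close>
  have "(\<Sum>W\<in>golay_code. (sign_sum W)\<^sup>2 * (sign_sum W)\<^sup>2 - 64 * (sign_sum W)\<^sup>2)
      = (\<Sum>W\<in>golay_code. (if W = {} then 294912 else 0) + (if W = UNIV then 294912 else 0))"
  proof (rule sum.cong)
    fix W assume "W \<in> golay_code"
    from sign_sum_values[OF this]
    show "(sign_sum W)\<^sup>2 * (sign_sum W)\<^sup>2 - 64 * (sign_sum W)\<^sup>2
        = (if W = {} then 294912 else 0) + (if W = UNIV then 294912 else 0)"
      by (elim disjE conjE) (auto simp: power2_eq_square)
  qed simp
  also have "\<dots> = 589824"
    by (simp add: sum.distrib UNIV_in_golay golay_code.intros)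
  finally have "1680 * ?M - 64 * (24 * ?M) = 589824"
    unfolding sum_subtractf sum_distrib_left[symmetric] fourth sq .
  then show ?thesis by simp
qed

text \<open>On the nonempty words, \<open>X (X + 8)\<close> with \<open>X = sign_sum W\<close> vanishes except at the octads and at
  \<open>UNIV\<close>; multiplied by two linear factors in the signs it is still within the reach of the four-wise
  independence.\<close>

lemma octads_through_two_points:
  "card {W\<in>golay_code. card W = 8 \<and> i \<in> W \<and> j \<in> W} = (if i = j then 253 else 77)"
proof -
  let ?O = "{W\<in>golay_code. card W = 8 \<and> i \<in> W \<and> j \<in> W}"
  let ?f = "\<lambda>W. (1 - word_sign W i) * (1 - word_sign W j) * (sign_sum W * (sign_sum W + 8))"
  \<comment> \<open>Each of the two linear factors is 2 on the words through its point and 0 on the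
    others, in particular on the empty word. The values are 4 * 8 * 16 = 512 at the octads and 4 *
    24 * 16 = 1536 at \<open>UNIV\<close>.\<close>
  have "(\<Sum>W\<in>golay_code. ?f W)
      = (\<Sum>W\<in>golay_code. (if card W = 8 \<and> i \<in> W \<and> j \<in> W then 512 else 0) + (if W = UNIV then 1536 else 0))"
  proof (rule sum.cong)
    fix W assume "W \<in> golay_code"
    from sign_sum_values[OF this]
    show "?f W = (if card W = 8 \<and> i \<in> W \<and> j \<in> W then 512 else 0) + (if W = UNIV then 1536 else 0)"
      by (auto simp: word_sign_def)
  qed simp
  also have "\<dots> = 512 * real (card ?O) + 1536"
    by (simp add: sum.distrib UNIV_in_golay sum.If_cases Int_def)
  finally have 1: "(\<Sum>W\<in>golay_code. ?f W) = 512 * real (card ?O) + 1536" .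
  have "?f W = word_sign W i * word_sign W i * (sign_sum W)\<^sup>2 - word_sign W i * (sign_sum W)\<^sup>2
      - word_sign W j * (sign_sum W)\<^sup>2 + word_sign W i * word_sign W j * (sign_sum W)\<^sup>2 + 8 * sign_sum W
      - 8 * (word_sign W i * sign_sum W) - 8 * (word_sign W j * sign_sum W)
      + 8 * (word_sign W i * word_sign W j * sign_sum W)" for W
    by (simp add: algebra_simps power2_eq_square)
  then have "(\<Sum>W\<in>golay_code. ?f W) = 24 * 4096 + (if i = j then 24 else 2) * 4096 - 8 * 4096 - 8 * 4096"
    by (simp only: sum.distrib sum_subtractf sum_distrib_left[symmetric] golay_odd_sums
          golay_sign_sum_product golay_sign_sum_square card_golay_code) simp
  with 1 show ?thesis by (auto split: if_splits)
qed

section \<open>The Leech lattice in integer coordinates\<close>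

definition leech_int :: "(23 option \<Rightarrow> int) set" where
  "leech_int = {z. \<exists>m::int. (\<forall>i. z i mod 2 = m mod 2) \<and>
        (\<forall>k::int. 0 \<le> k \<and> k < 4 \<longrightarrow> {i. z i mod 4 = k} \<in> golay_code) \<and>
        (\<Sum>i\<in>UNIV. z i) mod 8 = (4 * m) mod 8}"

text \<open>\<open>P\<close> collects the coordinates congruent to \<open>m + 2\<close> modulo 4. As
  \<open>card P\<close> is divisible by 4, the condition on the sum modulo 8 becomes a parity
  condition on \<open>x\<close>, which makes all later lattice arguments parity arguments.\<close>

lemma leech_int_representation:
  assumes "z \<in> leech_int"
  shows "\<exists>m P x. P \<in> golay_code \<and> (\<forall>i. z i = m + 2 * of_bool (i \<in> P) + 4 * x i) \<and>
    even ((\<Sum>i\<in>UNIV. x i) - m)"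
proof -
  from assms obtain m where m: "\<And>i. z i mod 2 = m mod 2"
    "\<And>k::int. 0 \<le> k \<Longrightarrow> k < 4 \<Longrightarrow> {i. z i mod 4 = k} \<in> golay_code"
    "(\<Sum>i\<in>UNIV. z i) mod 8 = (4 * m) mod 8"
    by (auto simp: leech_int_def)
  define P where "P = {i. z i mod 4 = (m + 2) mod 4}"
  define x where "x i = (z i - m - 2 * of_bool (i \<in> P)) div 4" for i
  have P: "P \<in> golay_code"
    unfolding P_def by (rule m(2)) auto
  have z: "z i = m + 2 * of_bool (i \<in> P) + 4 * x i" for i
  proof (cases "i \<in> P")
    case True
    then have "4 dvd z i - (m + 2)"
      by (simp add: P_def mod_eq_dvd_iff)
    then show ?thesis
      using True by (simp add: x_def algebra_simps)
  next
    case False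
    have "even (z i - m)"
      using m(1)[of i] by (simp add: mod_eq_dvd_iff)
    then obtain k where k: "z i - m = 2 * k" by blast
    have "even k"
    proof (rule ccontr)
      assume "odd k"
      then obtain j where "k = 2 * j + 1" by (auto elim: oddE)
      with k have "z i - (m + 2) = 4 * j" by simp
      then have "z i mod 4 = (m + 2) mod 4" by (simp add: mod_eq_dvd_iff)
      with False show False by (simp add: P_def)
    qed
    then have "4 dvd z i - m" using k by auto
    then show ?thesis
      using False by (simp add: x_def)
  qed
  obtain c where c: "card P = 4 * c"
    using golay_doubly_even[OF P] by blast
  have "(\<Sum>i\<in>UNIV. z i) = 24 * m + 2 * (\<Sum>i\<in>UNIV. of_bool (i \<in> P)) + 4 * (\<Sum>i\<in>UNIV. x i)"
    unfolding z by (simp add: sum.distrib sum_distrib_left)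
  also have "\<dots> = 24 * m + 8 * int c + 4 * (\<Sum>i\<in>UNIV. x i)"
    by (simp add: c)
  finally have "8 dvd 24 * m + 8 * int c + 4 * (\<Sum>i\<in>UNIV. x i) - 4 * m"
    using m(3) by (simp add: mod_eq_dvd_iff)
  then obtain q where "24 * m + 8 * int c + 4 * (\<Sum>i\<in>UNIV. x i) - 4 * m = 8 * q"
    by blast
  then have "4 * ((\<Sum>i\<in>UNIV. x i) - m) = 4 * (2 * (q - int c - 3 * m))"
    by (simp add: algebra_simps)
  then have "(\<Sum>i\<in>UNIV. x i) - m = 2 * (q - int c - 3 * m)"
    by (metis mult_left_cancel zero_neq_numeral)
  then have "even ((\<Sum>i\<in>UNIV. x i) - m)"
    by (metis dvd_triv_left)
  with P z show ?thesis by blast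
qed

text \<open>Only two residues modulo 4 occur, on \<open>P\<close> and on its complement; the other
  residue classes are empty, and all three sets are codewords.\<close>

lemma leech_intI:
  assumes P: "P \<in> golay_code" and z: "\<And>i. z i = m + 2 * of_bool (i \<in> P) + 4 * x i"
    and even: "even ((\<Sum>i\<in>UNIV. x i) - m)"
  shows "z \<in> leech_int"
proof -
  obtain c where c: "card P = 4 * c"
    using golay_doubly_even[OF P] by blast
  have "(\<Sum>i\<in>UNIV. z i) = 24 * m + 2 * (\<Sum>i\<in>UNIV. of_bool (i \<in> P)) + 4 * (\<Sum>i\<in>UNIV. x i)"
    unfolding z by (simp add: sum.distrib sum_distrib_left)
  also have "\<dots> = 24 * m + 8 * int c + 4 * (\<Sum>i\<in>UNIV. x i)"
    by (simp add: c)
  finally have sum_z: "(\<Sum>i\<in>UNIV. z i) = 24 * m + 8 * int c + 4 * (\<Sum>i\<in>UNIV. x i)" .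
  obtain t where "(\<Sum>i\<in>UNIV. x i) - m = 2 * t" using even by blast
  then have t: "(\<Sum>i\<in>UNIV. x i) = m + 2 * t" by simp
  have "(\<Sum>i\<in>UNIV. z i) - 4 * m = 8 * (3 * m + int c + t)"
    unfolding sum_z t by simp
  then have sum: "(\<Sum>i\<in>UNIV. z i) mod 8 = (4 * m) mod 8"
    by (simp add: mod_eq_dvd_iff)
  have "{i. z i mod 4 = k} \<in> golay_code" if "0 \<le> k" "k < 4" for k
  proof -
    define r s where "r = (m + 2) mod 4" and "s = m mod 4"
    have z4: "z i mod 4 = (if i \<in> P then r else s)" for i
      unfolding z r_def s_def by simp
    have ne: "r \<noteq> s" unfolding r_def s_def by presburger
    consider "k = r" | "k = s" | "k \<noteq> r" "k \<noteq> s" by blast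
    then show ?thesis
    proof cases
      case 1
      then have "{i. z i mod 4 = k} = P" using z4 ne by auto
      then show ?thesis using P by simp
    next
      case 2
      then have "{i. z i mod 4 = k} = - P" using z4 ne by auto
      then show ?thesis using Compl_in_golay[OF P] by simp
    next
      case 3
      then have "{i. z i mod 4 = k} = {}" using z4 by auto
      then show ?thesis by (simp add: golay_code.intros)
    qed
  qed
  moreover have "z i mod 2 = m mod 2" for i
    unfolding z by (simp add: mod_eq_dvd_iff)
  ultimately show ?thesis
    using sum by (auto simp: leech_int_def)
qed

text \<open>Modulo 8, the terms with \<open>card P\<close> and \<open>card R\<close> vanish by
  double evenness and \<open>4 * card (P \<inter> R)\<close> by self-orthogonality, while the parity
  conditions turn the terms with the sums of \<open>x\<close> and \<open>y\<close> into
  \<open>8 * m * n\<close>.\<close>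

lemma leech_int_product:
  assumes "z \<in> leech_int" "w \<in> leech_int"
  shows "8 dvd (\<Sum>i\<in>UNIV. z i * w i)"
proof -
  obtain m P x where z: "P \<in> golay_code" "\<And>i. z i = m + 2 * of_bool (i \<in> P) + 4 * x i"
    "even ((\<Sum>i\<in>UNIV. x i) - m)" using leech_int_representation[OF assms(1)] by blast
  obtain n R y where w: "R \<in> golay_code" "\<And>i. w i = n + 2 * of_bool (i \<in> R) + 4 * y i"
    "even ((\<Sum>i\<in>UNIV. y i) - n)" using leech_int_representation[OF assms(2)] by blast
  obtain a where a: "card P = 4 * a" using golay_doubly_even[OF z(1)] by blast
  obtain b where b: "card R = 4 * b" using golay_doubly_even[OF w(1)] by blast
  obtain c where c: "card (P \<inter> R) = 2 * c" using even_golay_Int[OF z(1) w(1)] by blast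
  obtain s where s: "(\<Sum>i\<in>UNIV. x i) = m + 2 * s" using z(3) by (metis dvdE diff_eq_eq add.commute)
  obtain t where t: "(\<Sum>i\<in>UNIV. y i) = n + 2 * t" using w(3) by (metis dvdE diff_eq_eq add.commute)
  have "z i * w i = m * n + 2 * m * of_bool (i \<in> R) + 2 * n * of_bool (i \<in> P)
      + 4 * of_bool (i \<in> P \<inter> R) + 4 * m * y i + 4 * n * x i
      + 8 * (x i * of_bool (i \<in> R) + of_bool (i \<in> P) * y i + 2 * x i * y i)" for i
    unfolding z(2) w(2) by (simp add: algebra_simps of_bool_def)
  then have "(\<Sum>i\<in>UNIV. z i * w i) = 24 * (m * n) + 2 * m * (\<Sum>i\<in>UNIV. of_bool (i \<in> R))
      + 2 * n * (\<Sum>i\<in>UNIV. of_bool (i \<in> P)) + 4 * (\<Sum>i\<in>UNIV. of_bool (i \<in> P \<inter> R))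
      + 4 * m * (\<Sum>i\<in>UNIV. y i) + 4 * n * (\<Sum>i\<in>UNIV. x i)
      + 8 * (\<Sum>i\<in>UNIV. x i * of_bool (i \<in> R) + of_bool (i \<in> P) * y i + 2 * x i * y i)"
    by (simp only: sum.distrib sum_distrib_left[symmetric]) simp
  also have "\<dots> = 8 * (4 * (m * n) + m * int b + n * int a + int c + m * t + n * s
      + (\<Sum>i\<in>UNIV. x i * of_bool (i \<in> R) + of_bool (i \<in> P) * y i + 2 * x i * y i))"
    unfolding s t using a b c by (simp add: Int_def[symmetric] algebra_simps)
  finally show ?thesis by simp
qed

text \<open>The difference of the indicators of \<open>P\<close> and \<open>R\<close> is that of the
  symmetric difference minus twice that of \<open>R - P\<close>. This carry affects an even number
  of coordinates, so the parity condition survives.\<close>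

lemma leech_int_diff:
  assumes "z \<in> leech_int" "w \<in> leech_int"
  shows "(\<lambda>i. z i - w i) \<in> leech_int"
proof -
  obtain m P x where z: "P \<in> golay_code" "\<And>i. z i = m + 2 * of_bool (i \<in> P) + 4 * x i"
    "even ((\<Sum>i\<in>UNIV. x i) - m)" using leech_int_representation[OF assms(1)] by blast
  obtain n R y where w: "R \<in> golay_code" "\<And>i. w i = n + 2 * of_bool (i \<in> R) + 4 * y i"
    "even ((\<Sum>i\<in>UNIV. y i) - n)" using leech_int_representation[OF assms(2)] by blast
  have ev: "even (card (R - P))"
  proof -
    have "card R = card (R - P) + card (R \<inter> P)"
      by (simp add: card_Diff_subset_Int card_mono)
    then show ?thesis
      using golay_doubly_even[OF w(1)] even_golay_Int[OF w(1) z(1)] by presburger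
  qed
  show ?thesis
  proof (rule leech_intI)
    show "sym_diff P R \<in> golay_code" using z(1) w(1) by (rule sym_diff_golay)
    show "z i - w i = (m - n) + 2 * of_bool (i \<in> sym_diff P R) + 4 * (x i - y i - of_bool (i \<in> R - P))" for i
      unfolding z(2) w(2) by auto
    have "(\<Sum>i\<in>UNIV. x i - y i - of_bool (i \<in> R - P))
        = (\<Sum>i\<in>UNIV. x i) - (\<Sum>i\<in>UNIV. y i) - (\<Sum>i\<in>UNIV. of_bool (i \<in> R - P))"
      by (simp only: sum_subtractf)
    also have "(\<Sum>i\<in>UNIV. of_bool (i \<in> R - P)) = int (card (R - P))"
      by (simp add: set_diff_eq)
    finally show "even ((\<Sum>i\<in>UNIV. x i - y i - of_bool (i \<in> R - P)) - (m - n))"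
      using z(3) w(3) ev by (auto simp: even_diff_iff)
  qed
qed

lemma leech_int_0: "(\<lambda>i. 0) \<in> leech_int"
  by (rule leech_intI[of "{}" _ 0 "\<lambda>i. 0"]) (auto intro: golay_code.intros)

lemma leech_int_uminus: "z \<in> leech_int \<Longrightarrow> (\<lambda>i. - z i) \<in> leech_int"
  using leech_int_diff[OF leech_int_0] by simp

section \<open>Sign changes on codewords\<close>

definition flip :: "'a set \<Rightarrow> ('a \<Rightarrow> int) \<Rightarrow> 'a \<Rightarrow> int" where
  "flip V z i = (if i \<in> V then - z i else z i)"

lemma flip_flip [simp]: "flip V (flip V z) = z"
  by (simp add: flip_def fun_eq_iff)

text \<open>For even \<open>m\<close> negation preserves residues modulo 4 and hence
  \<open>P\<close>. For odd \<open>m\<close> it exchanges the two residues, so \<open>P\<close>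
  becomes its symmetric difference with \<open>V\<close>.\<close>

lemma leech_int_flip:
  assumes V: "V \<in> golay_code" and "z \<in> leech_int"
  shows "flip V z \<in> leech_int"
proof -
  obtain m P x where z: "P \<in> golay_code" "\<And>i. z i = m + 2 * of_bool (i \<in> P) + 4 * x i"
    "even ((\<Sum>i\<in>UNIV. x i) - m)" using leech_int_representation[OF assms(2)] by blast
  have sumV: "(\<Sum>i\<in>UNIV. if i \<in> V then f i else (0::int)) = sum f V" for f
    by (simp add: sum.If_cases)
  have evV: "even (card V)" using golay_doubly_even[OF V] by presburger
  show ?thesis
  proof (cases "even m")
    case True
    then obtain k where k: "m = 2 * k" by blast
    define d where "d i = (if i \<in> V then - 2 * x i - of_bool (i \<in> P) - k else 0)" for i
    show ?thesis
    proof (rule leech_intI[OF z(1)])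
      show "flip V z i = m + 2 * of_bool (i \<in> P) + 4 * (x i + d i)" for i
        unfolding flip_def z(2) d_def k by (simp add: algebra_simps)
      have "(\<Sum>i\<in>UNIV. d i) = - 2 * sum x V - int (card (V \<inter> P)) - int (card V) * k"
        unfolding d_def sumV by (simp add: sum_subtractf sum_distrib_left Int_def)
      then have "even (\<Sum>i\<in>UNIV. d i)"
        using evV even_golay_Int[OF V z(1)] by simp
      then show "even ((\<Sum>i\<in>UNIV. x i + d i) - m)"
        using z(3) by (auto simp: sum.distrib even_diff_iff)
    qed
  next
    case False
    then obtain k where k: "m = 2 * k + 1" by (auto elim: oddE)
    define d where "d i = (if i \<in> V then - 2 * x i - (k + 1) else 0)" for i
    show ?thesis
    proof (rule leech_intI[OF sym_diff_golay[OF z(1) V]])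
      show "flip V z i = m + 2 * of_bool (i \<in> sym_diff P V) + 4 * (x i + d i)" for i
        unfolding flip_def z(2) d_def k by (simp add: algebra_simps)
      have "(\<Sum>i\<in>UNIV. d i) = - 2 * sum x V - int (card V) * (k + 1)"
        unfolding d_def sumV by (simp add: sum_subtractf sum_distrib_left)
      then have "even (\<Sum>i\<in>UNIV. d i)"
        using evV by simp
      then show "even ((\<Sum>i\<in>UNIV. x i + d i) - m)"
        using z(3) by (auto simp: sum.distrib even_diff_iff)
    qed
  qed
qed

section \<open>Minimal vectors\<close>

definition sqnorm :: "(23 option \<Rightarrow> int) \<Rightarrow> int" where
  "sqnorm z = (\<Sum>i\<in>UNIV. (z i)\<^sup>2)"

text \<open>In integer coordinates squared lengths are multiplied by 8, so 32 stands for the minimal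
  norm 4.\<close>

definition leech_min :: "(23 option \<Rightarrow> int) set" where
  "leech_min = {z \<in> leech_int. sqnorm z = 32}"

text \<open>The minimal vectors have the three shapes (4, 4, 0, ..., 0), (2, ..., 2, 0, ..., 0) with
  support an octad, and (3, 1, ..., 1), up to order and signs: here \<open>A\<close>,
  \<open>B\<close> and \<open>C\<close>. In \<open>B\<close> the set \<open>E\<close> of minus signs
  is even; in \<open>C\<close> a codeword \<open>V\<close> gives the sign changes of a vector with
  one entry \<open>- 3\<close>.\<close>

definition shape_B :: "23 option set \<times> 23 option set \<Rightarrow> 23 option \<Rightarrow> int" where
  "shape_B = (\<lambda>(Q, E) i. if i \<in> Q then if i \<in> E then - 2 else 2 else 0)"

definition index_B :: "(23 option set \<times> 23 option set) set" where
  "index_B = Sigma {Q\<in>golay_code. card Q = 8} (\<lambda>Q. {E. E \<subseteq> Q \<and> even (card E)})"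

definition shape_C :: "23 option \<times> 23 option set \<Rightarrow> 23 option \<Rightarrow> int" where
  "shape_C = (\<lambda>(k, V) i. (if i \<in> V then - 1 else 1) * (if i = k then - 3 else 1))"

definition shape_A :: "(23 option \<Rightarrow> int) set" where
  "shape_A = {z \<in> leech_min. \<forall>i. 4 dvd z i}"

lemma sqnorm_remove: "sqnorm z = (z k)\<^sup>2 + (\<Sum>i\<in>- {k}. (z i)\<^sup>2)"
  unfolding sqnorm_def Compl_eq_Diff_UNIV by (rule sum.remove) auto

lemma sqnorm_flip [simp]: "sqnorm (flip V z) = sqnorm z"
  by (simp add: sqnorm_def flip_def if_distrib[of "\<lambda>x. x\<^sup>2"] cong: if_cong)

lemma leech_min_flip: "V \<in> golay_code \<Longrightarrow> z \<in> leech_min \<Longrightarrow> flip V z \<in> leech_min"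
  by (simp add: leech_min_def leech_int_flip)

section \<open>The minimal norm and the vectors that attain it\<close>

lemma odd_square_ge: "odd (a::int) \<Longrightarrow> a\<^sup>2 = 1 \<or> a\<^sup>2 \<ge> 9"
proof -
  assume "odd a"
  then have "\<bar>a\<bar> = 1 \<or> \<bar>a\<bar> \<ge> 3" by presburger
  then show ?thesis
    using power_mono[of 3 "\<bar>a\<bar>" 2] by (auto simp: abs_if power2_eq_square split: if_splits)
qed

lemma even_square_ge: "even (a::int) \<Longrightarrow> a \<noteq> 0 \<Longrightarrow> a\<^sup>2 \<ge> 4"
proof -
  assume "even a" "a \<noteq> 0"
  then have "\<bar>a\<bar> \<ge> 2" by presburger
  then show ?thesis
    using power_mono[of 2 "\<bar>a\<bar>" 2] by simp
qed

lemma sum_int_ge_card: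
  assumes "finite S" "\<And>i. i \<in> S \<Longrightarrow> (f i :: int) \<ge> c"
  shows "sum f S \<ge> c * int (card S)"
  using sum_bounded_below[of S c f] assms by (simp add: mult.commute)

lemma sum_int_eq_card:
  assumes "finite S" "\<And>i. i \<in> S \<Longrightarrow> (f i :: int) \<ge> c" "sum f S = c * int (card S)" "i \<in> S"
  shows "f i = c"
proof -
  have "sum (\<lambda>i. f i - c) S = 0"
    using assms(3) by (simp add: sum_subtractf mult.commute)
  then show ?thesis
    using assms by (subst (asm) sum_nonneg_eq_0_iff) auto
qed

text \<open>If all entries were 1 or -1, their sum would be \<open>24 - 2 * card V\<close>, a
  multiple of 8, against the required residue 4. So some square is at least 9, and 9 + 23 =
  32.\<close>

lemma leech_odd:
  assumes z: "z \<in> leech_int" and odd: "odd (z j)"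
  shows "sqnorm z \<ge> 32" and "sqnorm z = 32 \<Longrightarrow> z \<in> shape_C ` (UNIV \<times> golay_code)"
proof -
  from z obtain m where m: "\<And>i. z i mod 2 = m mod 2"
    "\<And>k::int. 0 \<le> k \<Longrightarrow> k < 4 \<Longrightarrow> {i. z i mod 4 = k} \<in> golay_code"
    "(\<Sum>i\<in>UNIV. z i) mod 8 = (4 * m) mod 8"
    by (auto simp: leech_int_def)
  have oddm: "odd m" using m(1)[of j] odd by presburger
  have oddz: "odd (z i)" for i using m(1)[of i] oddm by presburger
  define V where "V = {i. z i mod 4 = 3}"
  have V: "V \<in> golay_code" unfolding V_def by (rule m(2)) auto
  have sq: "(z i)\<^sup>2 = 1 \<or> (z i)\<^sup>2 \<ge> 9" for i by (rule odd_square_ge) (rule oddz)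
  have sq1: "(z i)\<^sup>2 \<ge> 1" for i using sq[of i] by linarith
  have unit: "z i = (if i \<in> V then - 1 else 1)" if "(z i)\<^sup>2 = 1" for i
    using that by (auto simp: power2_eq_1_iff V_def)
  obtain k where k: "(z k)\<^sup>2 \<ge> 9"
  proof (rule ccontr)
    assume "\<not> thesis"
    with that sq have "(z i)\<^sup>2 = 1" for i by blast
    then have "z i = 1 - 2 * of_bool (i \<in> V)" for i using unit[of i] by simp
    then have "(\<Sum>i\<in>UNIV. z i) = 24 - 2 * int (card V)"
      by (simp add: sum_subtractf sum_distrib_left[symmetric])
    moreover obtain c where "card V = 4 * c" using golay_doubly_even[OF V] by blast
    moreover obtain n where "m = 2 * n + 1" using oddm by (auto elim: oddE)
    ultimately have "(24 - 8 * int c) mod 8 = (8 * n + 4) mod 8"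
      using m(3) by simp
    then show False by presburger
  qed
  have rest: "(\<Sum>i\<in>- {k}. (z i)\<^sup>2) \<ge> 1 * int (card (- {k}))"
    by (rule sum_int_ge_card) (use sq1 in auto)
  have card: "card (- {k}) = 23" by (simp add: Compl_eq_Diff_UNIV card_Diff_subset)
  show "sqnorm z \<ge> 32"
    using rest k unfolding sqnorm_remove[of z k] card by linarith
  show "z \<in> shape_C ` (UNIV \<times> golay_code)" if "sqnorm z = 32"
  proof -
    have eq: "(z k)\<^sup>2 = 9" "(\<Sum>i\<in>- {k}. (z i)\<^sup>2) = 1 * int (card (- {k}))"
      using that rest k unfolding sqnorm_remove[of z k] card by linarith+
    have one: "(z i)\<^sup>2 = 1" if "i \<noteq> k" for i
      by (rule sum_int_eq_card[OF _ _ eq(2)]) (use sq1 that in auto)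
    have "(z k)\<^sup>2 = 3\<^sup>2" using eq(1) by simp
    then have "z k = 3 \<or> z k = - 3" by (simp only: power2_eq_iff)
    then have "z k = (if k \<in> V then - 1 else 1) * - 3"
      by (auto simp: V_def)
    then have "z = shape_C (k, V)"
      using one unit by (auto simp: shape_C_def fun_eq_iff)
    then show ?thesis using V by blast
  qed
qed

text \<open>The entries congruent to 2 modulo 4 form a nonempty codeword, hence at least 8 squares
  are at least 4. In the case of equality the sum is \<open>16 - 4 * card E\<close>, and its residue
  modulo 8 makes \<open>card E\<close> even.\<close>

lemma leech_even:
  assumes z: "z \<in> leech_int" and even: "\<And>i. even (z i)" and j: "\<not> 4 dvd z j"
  shows "sqnorm z \<ge> 32" and "sqnorm z = 32 \<Longrightarrow> z \<in> shape_B ` index_B"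
proof -
  from z obtain m where m: "\<And>i. z i mod 2 = m mod 2"
    "\<And>k::int. 0 \<le> k \<Longrightarrow> k < 4 \<Longrightarrow> {i. z i mod 4 = k} \<in> golay_code"
    "(\<Sum>i\<in>UNIV. z i) mod 8 = (4 * m) mod 8"
    by (auto simp: leech_int_def)
  define P where "P = {i. z i mod 4 = 2}"
  have P: "P \<in> golay_code" unfolding P_def by (rule m(2)) auto
  have P4: "i \<in> P \<longleftrightarrow> \<not> 4 dvd z i" for i
    using even[of i] unfolding P_def mem_Collect_eq by presburger
  have "j \<in> P" using j P4 by simp
  then have "card P \<noteq> 0" by auto
  then have cP: "card P \<ge> 8" using golay_weights[OF P] by auto
  have split: "sqnorm z = (\<Sum>i\<in>P. (z i)\<^sup>2) + (\<Sum>i\<in>- P. (z i)\<^sup>2)"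
    unfolding sqnorm_def by (subst sum.union_disjoint[symmetric]) auto
  have nz: "(z i)\<^sup>2 \<ge> 4" if "i \<in> P" for i
    using that P4[of i] by (intro even_square_ge even) auto
  have ge: "(\<Sum>i\<in>P. (z i)\<^sup>2) \<ge> 4 * int (card P)"
    by (rule sum_int_ge_card) (use nz in auto)
  have ge0: "(\<Sum>i\<in>- P. (z i)\<^sup>2) \<ge> 0" by (rule sum_nonneg) simp
  show "sqnorm z \<ge> 32"
    using ge ge0 cP unfolding split by linarith
  show "z \<in> shape_B ` index_B" if 32: "sqnorm z = 32"
  proof -
    have c8: "card P = 8" and eq: "(\<Sum>i\<in>P. (z i)\<^sup>2) = 4 * int (card P)" "(\<Sum>i\<in>- P. (z i)\<^sup>2) = 0"
      using 32 ge ge0 cP unfolding split by linarith+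
    have four: "(z i)\<^sup>2 = 4" if "i \<in> P" for i
      by (rule sum_int_eq_card[OF _ _ eq(1)]) (use nz that in auto)
    have zero: "z i = 0" if "i \<notin> P" for i
      using eq(2) that by (subst (asm) sum_nonneg_eq_0_iff) auto
    have two: "z i = 2 \<or> z i = - 2" if "i \<in> P" for i
    proof -
      have "(z i)\<^sup>2 = 2\<^sup>2" using four[OF that] by simp
      then show ?thesis by (simp only: power2_eq_iff)
    qed
    define E where "E = {i\<in>P. z i = - 2}"
    have zE: "z i = 2 * of_bool (i \<in> P) - 4 * of_bool (i \<in> E)" for i
      using two[of i] zero[of i] by (auto simp: E_def)
    have "(\<Sum>i\<in>UNIV. z i) = 2 * (\<Sum>i\<in>UNIV. of_bool (i \<in> P)) - 4 * (\<Sum>i\<in>UNIV. of_bool (i \<in> E))"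
      unfolding zE by (simp only: sum_subtractf sum_distrib_left)
    then have "(\<Sum>i\<in>UNIV. z i) = 16 - 4 * int (card E)"
      by (simp add: c8)
    moreover have "even m" using m(1)[of j] even[of j] by presburger
    then obtain n where "m = 2 * n" by blast
    ultimately have "(16 - 4 * int (card E)) mod 8 = (8 * n) mod 8"
      using m(3) by simp
    then have "even (card E)" by presburger
    then have "(P, E) \<in> index_B"
      using P c8 by (auto simp: index_B_def E_def)
    moreover have "z = shape_B (P, E)"
      using two zero by (auto simp: shape_B_def E_def fun_eq_iff)
    ultimately show ?thesis by blast
  qed
qed

lemma sum_four_dvd:
  assumes z: "z \<in> leech_int" and "\<And>i. z i = 4 * w i"
  shows "even (\<Sum>i\<in>UNIV. w i)"
proof -
  from z obtain m where m: "\<And>i. z i mod 2 = m mod 2" "(\<Sum>i\<in>UNIV. z i) mod 8 = (4 * m) mod 8"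
    by (auto simp: leech_int_def)
  have "even m" using m(1)[of None] by (simp add: assms(2)) presburger
  then obtain n where n: "m = 2 * n" by blast
  have "(4 * (\<Sum>i\<in>UNIV. w i)) mod 8 = (8 * n) mod 8"
    using m(2) unfolding assms(2) n by (simp add: sum_distrib_left)
  then show ?thesis by presburger
qed

text \<open>For \<open>z = 4 * w\<close> the sum of the \<open>w i\<close> is even, and an integer
  has the parity of its square; so the squares of \<open>w\<close> add up to at least 2.\<close>

lemma leech_four_dvd:
  assumes z: "z \<in> leech_int" and dvd: "\<And>i. 4 dvd z i" and nz: "z j \<noteq> 0"
  shows "sqnorm z \<ge> 32"
proof -
  define w where "w i = z i div 4" for i
  have w: "z i = 4 * w i" for i using dvd by (simp add: w_def)
  have "even (\<Sum>i\<in>UNIV. w i)" using z w by (rule sum_four_dvd)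
  moreover have "even ((\<Sum>i\<in>UNIV. (w i)\<^sup>2) - (\<Sum>i\<in>UNIV. w i))"
    unfolding sum_subtractf[symmetric] by (rule dvd_sum) (simp add: power2_eq_square)
  ultimately have "even (\<Sum>i\<in>UNIV. (w i)\<^sup>2)" by (simp add: even_diff_iff)
  moreover have "(\<Sum>i\<in>UNIV. (w i)\<^sup>2) > 0"
    using nz by (intro sum_pos2[of _ j]) (auto simp: w)
  ultimately have "(\<Sum>i\<in>UNIV. (w i)\<^sup>2) \<ge> 2" by presburger
  then show ?thesis
    by (simp add: sqnorm_def w power_mult_distrib sum_distrib_left[symmetric])
qed

lemma leech_sqnorm_ge:
  assumes z: "z \<in> leech_int" and nz: "z \<noteq> (\<lambda>_. 0)"
  shows "sqnorm z \<ge> 32"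
proof -
  obtain j where "z j \<noteq> 0" using nz by auto
  then show ?thesis
    using leech_odd(1)[OF z] leech_even(1)[OF z] leech_four_dvd[OF z] by metis
qed

lemma shape_C_in_leech_min:
  assumes V: "V \<in> golay_code"
  shows "shape_C (k, V) \<in> leech_min"
proof -
  \<comment> \<open>The unsigned vector has \<open>m = 1\<close>, \<open>P = {}\<close> and
    \<open>x\<close> equal to -1 at \<open>k\<close> only; the codeword \<open>V\<close> then
    supplies the signs.\<close>
  define z :: "23 option \<Rightarrow> int" where "z i = (if i = k then - 3 else 1)" for i
  have "z \<in> leech_int"
    by (rule leech_intI[of "{}" _ 1 "\<lambda>i. if i = k then - 1 else 0"])
       (auto simp: z_def intro: golay_code.intros)
  then have "flip V z \<in> leech_int" by (rule leech_int_flip[OF V])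
  moreover have "flip V z = shape_C (k, V)"
    by (auto simp: flip_def z_def shape_C_def)
  moreover have "sqnorm z = 32"
  proof -
    have "(\<Sum>i\<in>- {k}. (z i)\<^sup>2) = 23" by (simp add: z_def Compl_eq_Diff_UNIV card_Diff_subset)
    then show ?thesis by (simp add: sqnorm_remove[of z k]) (simp add: z_def)
  qed
  ultimately show ?thesis
    by (metis (mono_tags, lifting) leech_min_def mem_Collect_eq sqnorm_flip)
qed

lemma shape_B_in_leech_min:
  assumes "p \<in> index_B"
  shows "shape_B p \<in> leech_min"
proof -
  obtain P E where p: "p = (P, E)" "P \<in> golay_code" "card P = 8" "E \<subseteq> P" "even (card E)"
    using assms by (auto simp: index_B_def)
  have "shape_B p \<in> leech_int"
    by (rule leech_intI[OF p(2), of _ 0 "\<lambda>i. - of_bool (i \<in> E)"])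
       (use p in \<open>auto simp: shape_B_def sum_negf\<close>)
  moreover have "sqnorm (shape_B p) = (\<Sum>i\<in>UNIV. 4 * of_bool (i \<in> P))"
    unfolding sqnorm_def by (rule sum.cong) (auto simp: shape_B_def p)
  then have "sqnorm (shape_B p) = 32"
    by (simp add: sum_distrib_left[symmetric] p)
  ultimately show ?thesis by (simp add: leech_min_def)
qed

lemma leech_min_cases:
  "leech_min = shape_A \<union> shape_B ` index_B \<union> shape_C ` (UNIV \<times> golay_code)"
proof
  show "leech_min \<subseteq> shape_A \<union> shape_B ` index_B \<union> shape_C ` (UNIV \<times> golay_code)"
  proof
    fix z assume "z \<in> leech_min"
    then have z: "z \<in> leech_int" "sqnorm z = 32" by (auto simp: leech_min_def)
    consider j where "odd (z j)" | j where "\<And>i. even (z i)" "\<not> 4 dvd z j" | "\<And>i. 4 dvd z i"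
      by blast
    then show "z \<in> shape_A \<union> shape_B ` index_B \<union> shape_C ` (UNIV \<times> golay_code)"
    proof cases
      case 1 then show ?thesis using leech_odd(2)[OF z(1) _ z(2)] by blast
    next
      case 2 then show ?thesis using leech_even(2)[OF z(1) _ _ z(2)] by blast
    next
      case 3 then show ?thesis using z by (simp add: shape_A_def leech_min_def)
    qed
  qed
  show "shape_A \<union> shape_B ` index_B \<union> shape_C ` (UNIV \<times> golay_code) \<subseteq> leech_min"
    using shape_B_in_leech_min shape_C_in_leech_min by (auto simp: shape_A_def)
qed

section \<open>Fourth moments of the minimal vectors\<close>

lemma finite_leech_min: "finite leech_min"
proof (rule finite_subset)
  show "leech_min \<subseteq> PiE UNIV (\<lambda>_. {- 32..32})"
  proof
    fix z assume z: "z \<in> leech_min"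
    have "\<bar>z i\<bar> \<le> 32" for i
    proof -
      have "\<bar>z i\<bar> \<le> (z i)\<^sup>2"
        using self_le_power[of "\<bar>z i\<bar>" 2] by (cases "z i = 0") auto
      also have "\<dots> \<le> sqnorm z"
        unfolding sqnorm_def by (rule member_le_sum) auto
      finally show ?thesis using z by (simp add: leech_min_def)
    qed
    then show "z \<in> PiE UNIV (\<lambda>_. {- 32..32})"
      by (auto simp: abs_le_iff minus_le_iff)
  qed
qed (intro finite_PiE; simp)

lemma inj_on_shape_B: "inj_on shape_B index_B"
proof (rule inj_onI, clarify)
  fix P E Q F assume mem: "(P, E) \<in> index_B" "(Q, F) \<in> index_B" and eq: "shape_B (P, E) = shape_B (Q, F)"
  have "P = {i. shape_B (P, E) i \<noteq> 0}" "E = {i. shape_B (P, E) i = - 2}" if "(P, E) \<in> index_B" for P E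
    using that by (auto simp: shape_B_def index_B_def)
  then show "P = Q \<and> E = F"
    using mem eq by metis
qed

lemma inj_on_shape_C: "inj_on shape_C (UNIV \<times> golay_code)"
proof (rule inj_onI, clarify)
  fix k V l U assume eq: "shape_C (k, V) = shape_C (l, U)"
  have k: "{i. \<bar>shape_C (k, V) i\<bar> = 3} = {k}" for k V
    by (auto simp: shape_C_def)
  have V: "V = {i. shape_C (k, V) i \<in> {- 1, 3}}" for k V
    by (auto simp: shape_C_def)
  show "k = l \<and> V = U"
    using k[of k V] k[of l U] V[where V = V and k = k] V[where V = U and k = l] eq by simp
qed

lemma sum_leech_min:
  "sum f leech_min = sum f shape_A + (\<Sum>p\<in>index_B. f (shape_B p)) + (\<Sum>k\<in>UNIV. \<Sum>V\<in>golay_code. f (shape_C (k, V)))"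
proof -
  have fin: "finite shape_A" "finite (shape_B ` index_B)" "finite (shape_C ` (UNIV \<times> golay_code))"
    by (rule finite_subset[OF _ finite_leech_min], use leech_min_cases in blast)+
  have B: "\<exists>i. shape_B p i \<in> {2, - 2}" if pB: "p \<in> index_B" for p
  proof -
    obtain P E where p: "p = (P, E)" "card P = 8" using pB by (auto simp: index_B_def)
    then obtain i where "i \<in> P" by (metis card.empty ex_in_conv zero_neq_numeral)
    then show ?thesis by (auto simp: shape_B_def p)
  qed
  have Bodd: "even (shape_B p i)" for p i
    by (cases p) (simp add: shape_B_def)
  have C: "odd (shape_C q i)" for q i
    by (cases q) (simp add: shape_C_def)
  have disj: "(shape_A \<union> shape_B ` index_B) \<inter> shape_C ` (UNIV \<times> golay_code) = {}"
  proof -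
    have "even (z i)" if "z \<in> shape_A" for z i
    proof -
      have "4 dvd z i" using that by (simp add: shape_A_def)
      then show ?thesis by (rule dvd_trans[rotated]) simp
    qed
    note A = this
    show ?thesis
    proof (rule ccontr)
      assume "\<not> ?thesis"
      then obtain z where z: "z \<in> shape_A \<union> shape_B ` index_B" "z \<in> shape_C ` (UNIV \<times> golay_code)"
        by (meson disjoint_iff)
      from z(2) obtain q where q: "z = shape_C q" by (rule imageE)
      from z(1) have "shape_C q \<in> shape_A \<union> shape_B ` index_B" by (simp only: q)
      then have "even (shape_C q None)"
      proof
        assume "shape_C q \<in> shape_A"
        then show ?thesis by (rule A)
      next
        assume "shape_C q \<in> shape_B ` index_B"
        then obtain p where "shape_C q = shape_B p" by blast
        then show ?thesis by (simp only: Bodd)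
      qed
      then show False using C[of q None] by simp
    qed
  qed
  have disj': "shape_A \<inter> shape_B ` index_B = {}"
  proof -
    have "z \<notin> shape_A" if "z \<in> shape_B ` index_B" for z
    proof -
      from that obtain p where p: "p \<in> index_B" "z = shape_B p" by blast
      from B[OF p(1)] obtain i where "z i = 2 \<or> z i = - 2" by (auto simp: p(2))
      then have "\<not> 4 dvd z i" by auto
      then show ?thesis by (auto simp: shape_A_def)
    qed
    then show ?thesis by blast
  qed
  show ?thesis
    unfolding leech_min_cases
    by (subst sum.union_disjoint[OF _ _ disj], (use fin in blast)+,
        subst sum.union_disjoint[OF _ _ disj'], (use fin in blast)+)
       (simp add: sum.reindex inj_on_shape_B inj_on_shape_C sum.cartesian_product)
qed

section \<open>The contributions of the three shapes\<close>

lemma shape_A_square: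
  assumes z: "z \<in> shape_A" and i: "z i \<noteq> 0"
  shows "(z i)\<^sup>2 = 16"
proof -
  obtain w where w: "z i = 4 * w" using z by (auto simp: shape_A_def)
  have "(z i)\<^sup>2 \<le> sqnorm z"
    unfolding sqnorm_def by (rule member_le_sum) auto
  then have "w\<^sup>2 \<le> 2"
    using z by (simp add: shape_A_def leech_min_def w power_mult_distrib)
  moreover have "\<bar>w\<bar> < 2"
  proof (rule ccontr)
    assume "\<not> \<bar>w\<bar> < 2"
    then have "2\<^sup>2 \<le> \<bar>w\<bar>\<^sup>2" by (intro power_mono) auto
    with \<open>w\<^sup>2 \<le> 2\<close> show False by simp
  qed
  then have "w = 1 \<or> w = - 1" using i w by auto
  then show ?thesis by (auto simp: w)
qed

lemma shape_A_pair:
  assumes "i \<noteq> k"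
  shows "{z\<in>shape_A. z i \<noteq> 0 \<and> z k \<noteq> 0} = (\<lambda>(s, t) j. if j = i then s else if j = k then t else 0) ` ({- 4, 4} \<times> {- 4, 4})"
    (is "?L = ?R")
proof
  show "?L \<subseteq> ?R"
  proof
    fix z assume "z \<in> ?L"
    then have z: "z \<in> shape_A" "z i \<noteq> 0" "z k \<noteq> 0" by auto
    have sq: "(z i)\<^sup>2 = 16" "(z k)\<^sup>2 = 16" using z shape_A_square by auto
    then have "(z i)\<^sup>2 = 4\<^sup>2" "(z k)\<^sup>2 = 4\<^sup>2" by auto
    then have val: "z i \<in> {- 4, 4}" "z k \<in> {- 4, 4}" by (simp_all only: power2_eq_iff) auto
    have "sqnorm z = (z i)\<^sup>2 + ((z k)\<^sup>2 + (\<Sum>j\<in>- {i} - {k}. (z j)\<^sup>2))"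
      unfolding sqnorm_remove[of z i] using assms by (subst sum.remove[of "- {i}" k]) auto
    then have "(\<Sum>j\<in>- {i} - {k}. (z j)\<^sup>2) = 0"
      using sq z(1) by (simp add: shape_A_def leech_min_def)
    then have "z j = 0" if "j \<noteq> i" "j \<noteq> k" for j
      using that by (subst (asm) sum_nonneg_eq_0_iff) auto
    then have "z = (\<lambda>j. if j = i then z i else if j = k then z k else 0)"
      by (auto simp: fun_eq_iff)
    then show "z \<in> ?R"
      using val by (intro image_eqI[of _ _ "(z i, z k)"]) auto
  qed
  show "?R \<subseteq> ?L"
  proof
    fix z assume "z \<in> ?R"
    then obtain s' t' :: int where st': "s' \<in> {- 4, 4}" "t' \<in> {- 4, 4}"
      "z = (\<lambda>j. if j = i then s' else if j = k then t' else 0)"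
      by auto
    define s t where "s = s' div 4" and "t = t' div 4"
    have st: "s \<in> {- 1, 1}" "t \<in> {- 1, 1}"
      "z = (\<lambda>j. if j = i then 4 * s else if j = k then 4 * t else 0)"
      using st' by (auto simp: s_def t_def)
    have "z \<in> leech_int"
    proof (rule leech_intI)
      show "z j = 0 + 2 * of_bool (j \<in> {}) + 4 * (if j = i then s else if j = k then t else 0)" for j
        by (simp add: st)
      have "(\<Sum>j\<in>UNIV. if j = i then s else if j = k then t else 0)
          = (\<Sum>j\<in>UNIV. (if j = i then s else 0) + (if j = k then t else 0))"
        using assms by (intro sum.cong) auto
      also have "\<dots> = s + t" by (simp add: sum.distrib)
      finally show "even ((\<Sum>j\<in>UNIV. if j = i then s else if j = k then t else 0) - 0)"
        using st by auto
    qed (rule golay_code.intros)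
    moreover have "sqnorm z = 32"
    proof -
      have "sqnorm z = (\<Sum>j\<in>UNIV. (if j = i then 16 else 0) + (if j = k then 16 else 0))"
        unfolding sqnorm_def using assms st(1,2) by (intro sum.cong) (auto simp: st(3))
      also have "\<dots> = 32" by (simp add: sum.distrib)
      finally show ?thesis .
    qed
    ultimately show "z \<in> ?L"
      using st assms by (auto simp: shape_A_def leech_min_def)
  qed
qed

text \<open>Off the diagonal there are four vectors, each contributing 256. On it, a vector with
  \<open>(z i)\<^sup>2 = 16\<close> has exactly 16 left for its other squares, so
  \<open>(z i) ^ 4\<close> is the sum of its 23 off-diagonal products.\<close>

lemma sum_shape_A:
  "(\<Sum>z\<in>shape_A. (z i)\<^sup>2 * (z k)\<^sup>2) = (if i = k then 23 * 1024 else 1024)"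
proof -
  have finA: "finite shape_A"
    by (rule finite_subset[OF _ finite_leech_min]) (auto simp: shape_A_def)
  have off: "(\<Sum>z\<in>shape_A. (z i)\<^sup>2 * (z k)\<^sup>2) = 1024" if "i \<noteq> k" for i k
  proof -
    let ?g = "\<lambda>(s::int, t) j. if j = i then s else if j = k then t else 0"
    have "inj_on ?g ({- 4, 4} \<times> {- 4, 4})"
    proof (rule inj_onI, clarify)
      fix s t s' t' :: int
      assume "(\<lambda>j. if j = i then s else if j = k then t else 0) = (\<lambda>j. if j = i then s' else if j = k then t' else 0)"
      from fun_cong[OF this, of i] fun_cong[OF this, of k] show "s = s' \<and> t = t'"
        using that by simp
    qed
    then have "card {z\<in>shape_A. z i \<noteq> 0 \<and> z k \<noteq> 0} = 4"
      unfolding shape_A_pair[OF that] by (simp add: card_image)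
    moreover have "(\<Sum>z\<in>shape_A. (z i)\<^sup>2 * (z k)\<^sup>2)
        = (\<Sum>z\<in>{z\<in>shape_A. z i \<noteq> 0 \<and> z k \<noteq> 0}. 256)"
      using finA by (intro sum.mono_neutral_cong_right) (auto simp: shape_A_square)
    ultimately show ?thesis by simp
  qed
  show ?thesis
  proof (cases "i = k")
    case True
    have "(z i)\<^sup>2 * (z i)\<^sup>2 = (\<Sum>k\<in>- {i}. (z i)\<^sup>2 * (z k)\<^sup>2)" if z: "z \<in> shape_A" for z
    proof (cases "z i = 0")
      case False
      then have "(z i)\<^sup>2 = 16" using z by (simp add: shape_A_square)
      moreover have "sqnorm z = 32" using z by (simp add: shape_A_def leech_min_def)
      ultimately show ?thesis
        unfolding sum_distrib_left[symmetric] using sqnorm_remove[of z i] by simp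
    qed simp
    then have "(\<Sum>z\<in>shape_A. (z i)\<^sup>2 * (z i)\<^sup>2) = (\<Sum>k\<in>- {i}. \<Sum>z\<in>shape_A. (z i)\<^sup>2 * (z k)\<^sup>2)"
      by (subst sum.swap) simp
    also have "\<dots> = (\<Sum>k\<in>- {i}. 1024)"
      by (intro sum.cong) (auto simp: off)
    also have "\<dots> = 23 * 1024"
      by (simp add: Compl_eq_Diff_UNIV card_Diff_subset)
    finally show ?thesis using True by simp
  qed (simp add: off)
qed

lemma card_even_subsets:
  assumes "finite S" "card S = 8"
  shows "card {E. E \<subseteq> S \<and> even (card E)} = 128"
proof -
  have eq: "card {E. E \<subseteq> S \<and> even (card E)} = card {E. E \<subseteq> S \<and> odd (card E)}"
  proof -
    have "{} \<subset> S" using assms by auto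
    then show ?thesis using card_subsupersets_even_odd[of S "{}"] assms by simp
  qed
  have "256 = card (Pow S)" using assms by (simp add: card_Pow)
  also have "Pow S = {E. E \<subseteq> S \<and> even (card E)} \<union> {E. E \<subseteq> S \<and> odd (card E)}" by auto
  also have "card \<dots> = card {E. E \<subseteq> S \<and> even (card E)} + card {E. E \<subseteq> S \<and> odd (card E)}"
    using assms by (intro card_Un_disjoint) auto
  finally show ?thesis using eq by simp
qed

text \<open>Each octad through both points carries 128 even sign patterns with product 16.\<close>

lemma sum_shape_B:
  "(\<Sum>p\<in>index_B. (shape_B p i)\<^sup>2 * (shape_B p k)\<^sup>2) = 2048 * (if i = k then 253 else 77)"
proof -
  let ?O = "{Q\<in>golay_code. card Q = 8}"
  have "(\<Sum>p\<in>index_B. (shape_B p i)\<^sup>2 * (shape_B p k)\<^sup>2)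
      = (\<Sum>Q\<in>?O. \<Sum>E | E \<subseteq> Q \<and> even (card E). (shape_B (Q, E) i)\<^sup>2 * (shape_B (Q, E) k)\<^sup>2)"
    unfolding index_B_def by (subst sum.Sigma) (auto intro!: sum.cong)
  also have "\<dots> = (\<Sum>Q\<in>?O. \<Sum>E | E \<subseteq> Q \<and> even (card E). if i \<in> Q \<and> k \<in> Q then 16 else 0)"
    by (intro sum.cong refl) (auto simp: shape_B_def)
  also have "\<dots> = (\<Sum>Q\<in>?O. if i \<in> Q \<and> k \<in> Q then 2048 else 0)"
    by (intro sum.cong refl) (simp add: card_even_subsets)
  also have "\<dots> = 2048 * int (card {Q\<in>golay_code. card Q = 8 \<and> i \<in> Q \<and> k \<in> Q})"
    by (simp add: sum.If_cases Int_def conj_ac)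
  finally show ?thesis by (simp add: octads_through_two_points)
qed

text \<open>For fixed signs, the 24 positions of the entry 3 give 81 + 23 = 104 on the diagonal and
  9 + 9 + 22 = 40 off it.\<close>

lemma sum_shape_C:
  "(\<Sum>l\<in>UNIV. \<Sum>V\<in>golay_code. (shape_C (l, V) i)\<^sup>2 * (shape_C (l, V) k)\<^sup>2) = 4096 * (if i = k then 104 else 40)"
proof -
  have "(shape_C (l, V) i)\<^sup>2 = (if i = l then 9 else 1)" for l V i
    by (auto simp: shape_C_def)
  then have "(\<Sum>l\<in>UNIV. \<Sum>V\<in>golay_code. (shape_C (l, V) i)\<^sup>2 * (shape_C (l, V) k)\<^sup>2)
      = 4096 * (\<Sum>l\<in>UNIV. (if i = l then 9 else 1) * (if k = l then 9 else 1))"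
    by (simp add: card_golay_code sum_distrib_left[symmetric])
  also have "(\<Sum>l\<in>UNIV. (if i = l then 9 else 1) * (if k = l then 9 else (1::int)))
      = (\<Sum>l\<in>UNIV. 1 + (if l = i then 8 else 0) + (if l = k then 8 else 0) + (if l = i then if i = k then 64 else 0 else 0))"
    by (intro sum.cong) auto
  also have "\<dots> = (if i = k then 104 else 40)"
    by (simp add: sum.distrib)
  finally show ?thesis .
qed

text \<open>The totals 1024 + 2048 * 77 + 4096 * 40 = 322560 and 23 * 1024 + 2048 * 253 + 4096 * 104
  = 3 * 322560 are in the ratio 1 : 3 that makes the fourth-order tensor isotropic. The sums over
  unpaired indices vanish, since sign changes on codewords preserve
  \<open>leech_min\<close>.\<close>

lemma leech_min_sum4:
  "(\<Sum>z\<in>leech_min. z i * z j * z k * z l)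
    = 322560 * (of_bool (i = j) * of_bool (k = l) + of_bool (i = k) * of_bool (j = l) + of_bool (i = l) * of_bool (j = k))"
proof -
  have pair: "(\<Sum>z\<in>leech_min. (z i)\<^sup>2 * (z k)\<^sup>2) = (if i = k then 3 * 322560 else 322560)" for i k
    unfolding sum_leech_min sum_shape_A sum_shape_B sum_shape_C by simp
  show ?thesis
  proof (cases "paired i j k l")
    case True
    then consider "i = j" "k = l" | "i = k" "j = l" | "i = l" "j = k"
      by (auto simp: paired_def)
    then show ?thesis
    proof cases
      case 1
      then show ?thesis using pair[of i k] by (auto simp: power2_eq_square mult_ac split: if_splits)
    next
      case 2
      then show ?thesis using pair[of i j] by (auto simp: power2_eq_square mult_ac split: if_splits)
    next
      case 3
      then show ?thesis using pair[of i j] by (auto simp: power2_eq_square mult_ac split: if_splits)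
    qed
  next
    case False
    then obtain a where a: "word_sign (golay_generator a) i * word_sign (golay_generator a) j *
      word_sign (golay_generator a) k * word_sign (golay_generator a) l = - 1"
      using exists_odd_generator by blast
    let ?V = "golay_generator a"
    have V: "?V \<in> golay_code" by (rule golay_generator_in_code)
    have "flip ?V z i * flip ?V z j * flip ?V z k * flip ?V z l = - (z i * z j * z k * z l)" for z
      using a by (simp add: flip_def word_sign_def split: if_splits)
    then have "(\<Sum>z\<in>leech_min. z i * z j * z k * z l) = (\<Sum>z\<in>leech_min. - (z i * z j * z k * z l))"
      by (intro sum.reindex_bij_witness[of _ "flip ?V" "flip ?V"]) (auto simp: leech_min_flip[OF V])
    then show ?thesis
      using False by (auto simp: sum_negf paired_def)
  qed
qed

text \<open>Contracted with \<open>a\<close>, each of the three pairings in the isotropic tensor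
  contributes 322560 times the square of the squared norm.\<close>

lemma leech_min_fourth_moment:
  fixes a :: "23 option \<Rightarrow> real"
  shows "(\<Sum>z\<in>leech_min. (\<Sum>i\<in>UNIV. a i * z i) ^ 4) = 967680 * (\<Sum>i\<in>UNIV. (a i)\<^sup>2)\<^sup>2"
proof -
  let ?X = "\<lambda>z. \<Sum>i\<in>UNIV. a i * real_of_int (z i)"
  let ?S = "\<Sum>i\<in>UNIV. (a i)\<^sup>2"
  have sq: "(\<Sum>z\<in>leech_min. (?X z)\<^sup>2 * y z)
      = (\<Sum>i\<in>UNIV. \<Sum>j\<in>UNIV. a i * a j * (\<Sum>z\<in>leech_min. real_of_int (z i) * real_of_int (z j) * y z))" for y :: "(23 option \<Rightarrow> int) \<Rightarrow> real"
  proof -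
    have "(?X z)\<^sup>2 = (\<Sum>i\<in>UNIV. \<Sum>j\<in>UNIV. a i * z i * (a j * z j))" for z
      by (simp only: power2_eq_square sum_product)
    then have "(?X z)\<^sup>2 * y z = (\<Sum>i\<in>UNIV. \<Sum>j\<in>UNIV. a i * a j * (real_of_int (z i) * real_of_int (z j) * y z))" for z
      by (simp only: sum_distrib_right) (simp add: mult_ac)
    then have "(\<Sum>z\<in>leech_min. (?X z)\<^sup>2 * y z)
        = (\<Sum>z\<in>leech_min. \<Sum>i\<in>UNIV. \<Sum>j\<in>UNIV. a i * a j * (real_of_int (z i) * real_of_int (z j) * y z))" by (simp only:)
    also have "\<dots> = (\<Sum>i\<in>UNIV. \<Sum>j\<in>UNIV. \<Sum>z\<in>leech_min. a i * a j * (real_of_int (z i) * real_of_int (z j) * y z))"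
      by (subst sum.swap) (intro sum.cong refl sum.swap)
    finally show ?thesis by (simp only: sum_distrib_left)
  qed
  have inner: "(\<Sum>z\<in>leech_min. real_of_int (z i) * real_of_int (z j) * (?X z)\<^sup>2) = 322560 * (if i = j then ?S else 0) + 645120 * (a i * a j)" for i j
  proof -
    have T: "(\<Sum>z\<in>leech_min. real_of_int (z k) * real_of_int (z l) * (real_of_int (z i) * real_of_int (z j)))
        = 322560 * ((if k = l then of_bool (i = j) else 0) + (if l = j then of_bool (k = i) else 0)
          + (if l = i then of_bool (k = j) else 0))" for k l
    proof -
      have "(\<Sum>z\<in>leech_min. real_of_int (z k) * real_of_int (z l) * (real_of_int (z i) * real_of_int (z j))) = real_of_int (\<Sum>z\<in>leech_min. z k * z l * z i * z j)"
        by (simp add: mult.assoc)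
      also have "\<dots> = 322560 * ((if k = l then of_bool (i = j) else 0) + (if l = j then of_bool (k = i) else 0)
          + (if l = i then of_bool (k = j) else 0))"
        unfolding leech_min_sum4 by simp
      finally show ?thesis .
    qed
    have "(\<Sum>z\<in>leech_min. real_of_int (z i) * real_of_int (z j) * (?X z)\<^sup>2) = (\<Sum>z\<in>leech_min. (?X z)\<^sup>2 * (real_of_int (z i) * real_of_int (z j)))"
      by (simp add: mult.commute)
    also have "\<dots> = (\<Sum>k\<in>UNIV. \<Sum>l\<in>UNIV. a k * a l * (322560 * ((if k = l then of_bool (i = j) else 0) + (if l = j then of_bool (k = i) else 0)
          + (if l = i then of_bool (k = j) else 0))))"
      unfolding sq T ..
    also have "\<dots> = (\<Sum>k\<in>UNIV. \<Sum>l\<in>UNIV. (if k = l then 322560 * (a k * a l) * of_bool (i = j) else 0)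
         + (if l = j then 322560 * (a k * a l) * of_bool (k = i) else 0)
         + (if l = i then 322560 * (a k * a l) * of_bool (k = j) else 0))"
      by (intro sum.cong refl) (simp add: algebra_simps)
    also have "\<dots> = (\<Sum>k\<in>UNIV. 322560 * (a k * a k) * of_bool (i = j)
        + (if k = i then 322560 * (a k * a j) else 0) + (if k = j then 322560 * (a k * a i) else 0))"
      by (intro sum.cong refl) (simp add: sum.distrib)
    also have "\<dots> = 322560 * (if i = j then ?S else 0) + 645120 * (a i * a j)"
      by (simp add: sum.distrib power2_eq_square sum_distrib_left[symmetric])
    finally show ?thesis .
  qed
  have "(\<Sum>z\<in>leech_min. (?X z) ^ 4) = (\<Sum>z\<in>leech_min. (?X z)\<^sup>2 * (?X z)\<^sup>2)"
    by (simp add: power4_eq_xxxx power2_eq_square mult.assoc)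
  also have "\<dots> = (\<Sum>i\<in>UNIV. \<Sum>j\<in>UNIV. a i * a j * (322560 * (if i = j then ?S else 0) + 645120 * (a i * a j)))"
    unfolding sq inner ..
  also have "\<dots> = (\<Sum>i\<in>UNIV. \<Sum>j\<in>UNIV. (if i = j then 322560 * ?S * (a i)\<^sup>2 else 0) + 645120 * ((a i)\<^sup>2 * (a j)\<^sup>2))"
    by (intro sum.cong refl) (simp add: algebra_simps power2_eq_square)
  also have "\<dots> = 322560 * ?S * ?S + 645120 * (?S * ?S)"
    by (simp only: sum.distrib sum_distrib_left[symmetric] sum_distrib_right[symmetric] sum.delta' finite UNIV_I if_True)
  finally show ?thesis by (simp add: power2_eq_square)
qed

section \<open>The code formed by the minimal vectors\<close>

definition unit_vector :: "(23 option \<Rightarrow> int) \<Rightarrow> real24" where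
  "unit_vector z = (1 / sqrt 32) *\<^sub>R (\<chi> i. of_int (z i))"

lemma inner_vector_of_int:
  "(\<chi> i. real_of_int (z i)) \<bullet> (\<chi> i. real_of_int (w i)) = of_int (\<Sum>i\<in>UNIV. z i * w i)"
  by (simp add: inner_vec_def)

lemma inner_unit_vector: "unit_vector z \<bullet> unit_vector w = of_int (\<Sum>i\<in>UNIV. z i * w i) / 32"
  unfolding unit_vector_def inner_scaleR_left inner_scaleR_right inner_vector_of_int by simp

lemma sqnorm_eq_product: "sqnorm z = (\<Sum>i\<in>UNIV. z i * z i)"
  by (simp add: sqnorm_def power2_eq_square)

lemma sqnorm_zero [simp]: "sqnorm (\<lambda>_. 0) = 0"
  by (simp add: sqnorm_def)

lemma inj_unit_vector: "inj unit_vector"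
  by (rule injI) (simp add: unit_vector_def vec_eq_iff fun_eq_iff)

lemma leech_min_nonempty: "leech_min \<noteq> {}"
  using shape_C_in_leech_min[of "{}" undefined] golay_code.intros(1) by blast

lemma minimal_vectors_leech:
  "minimal_vectors leech_lattice = (\<lambda>z. (1 / sqrt 8) *\<^sub>R (\<chi> i. of_int (z i))) ` leech_min"
proof -
  define v :: "(23 option \<Rightarrow> int) \<Rightarrow> real24" where "v z = (1 / sqrt 8) *\<^sub>R (\<chi> i. of_int (z i))" for z
  have lat: "leech_lattice = v ` leech_int"
    unfolding leech_lattice_def leech_int_def v_def by blast
  have norm: "(norm (v z))\<^sup>2 = of_int (sqnorm z) / 8" for z
    unfolding power2_norm_eq_inner v_def inner_scaleR_left inner_scaleR_right inner_vector_of_int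
    by (simp add: sqnorm_eq_product)
  have le: "norm (v z) \<le> norm (v w) \<longleftrightarrow> sqnorm z \<le> sqnorm w" for z w
    unfolding power2_le_iff_abs_le[OF norm_ge_zero, symmetric] abs_norm_cancel
    by (simp add: norm flip: abs_le_square_iff[of "norm (v z)" "norm (v w)", simplified])
  have zero: "v z = 0 \<longleftrightarrow> z = (\<lambda>_. 0)" for z
    by (simp add: v_def vec_eq_iff fun_eq_iff)
  obtain z0 where z0: "z0 \<in> leech_min" using leech_min_nonempty by blast
  have "z0 \<noteq> (\<lambda>_. 0)" using z0 by (auto simp: leech_min_def sqnorm_def)
  have nz: "z \<noteq> (\<lambda>_. 0)" if "z \<in> leech_min" for z
    using that by (auto simp: leech_min_def sqnorm_def)
  have "minimal_vectors leech_lattice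
      = v ` {z\<in>leech_int. z \<noteq> (\<lambda>_. 0) \<and> (\<forall>w\<in>leech_int. w \<noteq> (\<lambda>_. 0) \<longrightarrow> sqnorm z \<le> sqnorm w)}"
    unfolding minimal_vectors_def lat by (auto simp: le zero)
  also have "{z\<in>leech_int. z \<noteq> (\<lambda>_. 0) \<and> (\<forall>w\<in>leech_int. w \<noteq> (\<lambda>_. 0) \<longrightarrow> sqnorm z \<le> sqnorm w)} = leech_min"
  proof (intro equalityI subsetI)
    fix z assume z: "z \<in> {z\<in>leech_int. z \<noteq> (\<lambda>_. 0) \<and> (\<forall>w\<in>leech_int. w \<noteq> (\<lambda>_. 0) \<longrightarrow> sqnorm z \<le> sqnorm w)}"
    then have "sqnorm z \<le> sqnorm z0" using z0 nz by (auto simp: leech_min_def)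
    then show "z \<in> leech_min"
      using z z0 leech_sqnorm_ge[of z] by (auto simp: leech_min_def)
  next
    fix z assume z: "z \<in> leech_min"
    then show "z \<in> {z\<in>leech_int. z \<noteq> (\<lambda>_. 0) \<and> (\<forall>w\<in>leech_int. w \<noteq> (\<lambda>_. 0) \<longrightarrow> sqnorm z \<le> sqnorm w)}"
      using nz[OF z] leech_sqnorm_ge by (auto simp: leech_min_def)
  qed
  finally show ?thesis by (simp add: v_def[abs_def])
qed

lemma leech_code_eq: "leech_code = unit_vector ` leech_min"
proof -
  have "((1 / sqrt 8) *\<^sub>R (\<chi> i. of_int (z i))) /\<^sub>R norm ((1 / sqrt 8) *\<^sub>R (\<chi> i. of_int (z i)) :: real24) = unit_vector z"
    if "z \<in> leech_min" for z
  proof -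
    let ?v = "(1 / sqrt 8) *\<^sub>R (\<chi> i. of_int (z i)) :: real24"
    have "(norm ?v)\<^sup>2 = of_int (sqnorm z) / 8"
      unfolding power2_norm_eq_inner inner_scaleR_left inner_scaleR_right inner_vector_of_int
      by (simp add: sqnorm_eq_product)
    also have "\<dots> = 2\<^sup>2" using that by (simp add: leech_min_def)
    finally have n: "norm ?v = 2" by (rule power2_eq_imp_eq) auto
    have "sqrt 32 = sqrt 8 * 2"
      using real_sqrt_mult[of 8 4] by simp
    then show ?thesis unfolding n by (simp add: unit_vector_def field_simps)
  qed
  then show ?thesis
    unfolding leech_code_def minimal_vectors_leech image_image by (rule image_cong[OF refl])
qed

lemma finite_leech_code: "finite leech_code"
  by (simp add: leech_code_eq finite_leech_min)

lemma norm_leech_code: "x \<in> leech_code \<Longrightarrow> norm x = 1"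
  by (auto simp: leech_code_eq norm_eq_1 inner_unit_vector leech_min_def simp flip: sqnorm_eq_product)

lemma leech_code_nonempty: "leech_code \<noteq> {}"
  by (simp add: leech_code_eq leech_min_nonempty)

lemma uminus_leech_code: "x \<in> leech_code \<Longrightarrow> - x \<in> leech_code"
proof -
  assume "x \<in> leech_code"
  then obtain z where z: "z \<in> leech_min" "x = unit_vector z" by (auto simp: leech_code_eq)
  have "(\<lambda>i. - z i) \<in> leech_min"
    using z leech_int_uminus by (auto simp: leech_min_def sqnorm_def)
  moreover have "- x = unit_vector (\<lambda>i. - z i)"
    unfolding z(2) by (simp add: unit_vector_def vec_eq_iff)
  ultimately show ?thesis by (auto simp: leech_code_eq)
qed

lemma unit_inner_eq_1:
  fixes x y :: "'a::real_inner"
  assumes "norm x = 1" "norm y = 1" "x \<bullet> y = 1"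
  shows "x = y"
proof -
  have "(norm (x - y))\<^sup>2 = 0"
    using assms by (simp add: power2_norm_eq_inner norm_eq_1 inner_simps inner_commute)
  then show ?thesis by simp
qed

text \<open>Integrality leaves the multiples of 1/4. At 3/4 or -3/4 the difference or the sum of the
  two lattice vectors would be a nonzero lattice vector with \<open>sqnorm\<close> 16.\<close>

lemma leech_inner_products:
  assumes "x \<in> leech_code" "y \<in> leech_code"
  shows "x \<bullet> y \<in> {1, 1/2, 1/4, 0, - 1/4, - 1/2, - 1}"
proof -
  obtain z where z: "z \<in> leech_min" "x = unit_vector z" using assms by (auto simp: leech_code_eq)
  obtain w where w: "w \<in> leech_min" "y = unit_vector w" using assms by (auto simp: leech_code_eq)
  have zw: "z \<in> leech_int" "w \<in> leech_int" "sqnorm z = 32" "sqnorm w = 32"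
    using z w by (auto simp: leech_min_def)
  obtain q where q: "(\<Sum>i\<in>UNIV. z i * w i) = 8 * q"
    using leech_int_product[OF zw(1,2)] by blast
  have xy: "x \<bullet> y = of_int q / 4"
    by (simp add: z w inner_unit_vector q)
  have "\<bar>x \<bullet> y\<bar> \<le> 1"
    using Cauchy_Schwarz_ineq2[of x y] norm_leech_code assms by simp
  then have "\<bar>q\<bar> \<le> 4" unfolding xy by simp
  moreover have "q \<noteq> 3"
  proof
    assume "q = 3"
    have "sqnorm (\<lambda>i. z i - w i) = sqnorm z + sqnorm w - 2 * (\<Sum>i\<in>UNIV. z i * w i)"
      by (simp add: sqnorm_def power2_diff sum.distrib sum_subtractf sum_distrib_left mult.assoc)
    then have "sqnorm (\<lambda>i. z i - w i) = 16" by (simp add: zw q \<open>q = 3\<close>)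
    moreover have "(\<lambda>i. z i - w i) \<noteq> (\<lambda>_. 0)"
      using calculation sqnorm_zero by (metis zero_neq_numeral)
    ultimately show False using leech_sqnorm_ge[OF leech_int_diff[OF zw(1,2)]] by simp
  qed
  moreover have "q \<noteq> - 3"
  proof
    assume "q = - 3"
    have "sqnorm (\<lambda>i. z i - - w i) = sqnorm z + sqnorm w + 2 * (\<Sum>i\<in>UNIV. z i * w i)"
      by (simp add: sqnorm_def power2_sum sum.distrib sum_distrib_left mult.assoc)
    then have "sqnorm (\<lambda>i. z i - - w i) = 16" by (simp add: zw q \<open>q = - 3\<close>)
    moreover have "(\<lambda>i. z i - - w i) \<noteq> (\<lambda>_. 0)"
      using calculation sqnorm_zero by (metis zero_neq_numeral)
    ultimately show False
      using leech_sqnorm_ge[OF leech_int_diff[OF zw(1) leech_int_uminus[OF zw(2)]]] by simp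
  qed
  ultimately have "q \<in> {4, 2, 1, 0, - 1, - 2, - 4}" by auto
  then show ?thesis unfolding xy by auto
qed

lemma leech_code_fourth_moment:
  "(\<Sum>y\<in>leech_code. (a \<bullet> y) ^ 4) = 945 * norm a ^ 4"
proof -
  have "a \<bullet> unit_vector z = (\<Sum>i\<in>UNIV. a $ i * of_int (z i)) / sqrt 32" for z
    by (simp add: unit_vector_def inner_vec_def sum_divide_distrib)
  moreover have "(sqrt 32) ^ 4 = (1024 :: real)"
    using power_mult[of "sqrt 32" 2 2] by simp
  ultimately have "(\<Sum>y\<in>leech_code. (a \<bullet> y) ^ 4)
      = (\<Sum>z\<in>leech_min. (\<Sum>i\<in>UNIV. a $ i * of_int (z i)) ^ 4) / 1024"
    unfolding leech_code_eq
    by (subst sum.reindex[OF inj_on_subset[OF inj_unit_vector subset_UNIV]])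
       (simp add: power_divide flip: sum_divide_distrib)
  also have "\<dots> = 945 * (\<Sum>i\<in>UNIV. (a $ i)\<^sup>2)\<^sup>2"
    by (simp add: leech_min_fourth_moment)
  also have "(\<Sum>i\<in>UNIV. (a $ i)\<^sup>2) = (norm a)\<^sup>2"
    by (simp add: norm_vec_def L2_set_def sum_nonneg)
  finally show ?thesis by (simp flip: power_mult)
qed

text \<open>The counting measure makes the lemmas on moments of measures available for sums over the
  code.\<close>

lemma integral_count_space_leech: "(\<integral>y. f y \<partial>count_space leech_code) = (\<Sum>y\<in>leech_code. f y :: real)"
  by (rule lebesgue_integral_count_space_finite) (rule finite_leech_code)

lemma integrable_count_space_leech: "integrable (count_space leech_code) (f :: real24 \<Rightarrow> real)"
  by (rule integrable_count_space) (rule finite_leech_code)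

text \<open>Two descents in dimension 24: 945 * 26 / 3 = 8190 and 8190 * 24 = 196560.\<close>

lemma leech_code_second_moment: "(\<Sum>y\<in>leech_code. (a \<bullet> y) ^ 2) = 8190 * norm a ^ 2"
  and card_leech_code: "card leech_code = 196560"
proof -
  have AE: "AE y in count_space leech_code. norm y = 1"
    by (simp add: AE_count_space norm_leech_code)
  have two: "(\<Sum>y\<in>leech_code. (a \<bullet> y) ^ 2) = 8190 * norm a ^ 2" for a
    using moment_descent[OF integrable_count_space_leech AE, of 1 945 a] leech_code_fourth_moment
    by (simp add: integral_count_space_leech)
  show "(\<Sum>y\<in>leech_code. (a \<bullet> y) ^ 2) = 8190 * norm a ^ 2" by (rule two)
  have "real (card leech_code) = 196560"
  proof -
    have "(\<integral>y. (a \<bullet> y) ^ (2 * 0 + 2) \<partial>count_space leech_code) = 8190 * norm a ^ (2 * 0 + 2)" for a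
      by (simp only: mult_zero_right add_0 two integral_count_space_leech)
    from moment_descent[OF integrable_count_space_leech AE this] show ?thesis
      by (simp add: measure_count_space finite_leech_code)
  qed
  then show "card leech_code = 196560" by simp
qed

section \<open>Distance distribution and higher moments\<close>

definition leech_count :: "real24 \<Rightarrow> real \<Rightarrow> nat" where
  "leech_count x t = card {y\<in>leech_code. x \<bullet> y = t}"

lemma leech_count_uminus: "leech_count x (- t) = leech_count x t"
  unfolding leech_count_def
  by (rule bij_betw_same_card[of uminus])
     (rule bij_betw_byWitness[of _ uminus], use uminus_leech_code in auto)

lemma leech_sum_by_inner_product:
  fixes g :: "real \<Rightarrow> real"
  assumes x: "x \<in> leech_code" and g: "\<And>t. g (- t) = g t"
  shows "(\<Sum>y\<in>leech_code. g (x \<bullet> y))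
    = 2 * g 1 + 2 * real (leech_count x (1/2)) * g (1/2) + 2 * real (leech_count x (1/4)) * g (1/4) + real (leech_count x 0) * g 0"
proof -
  let ?T = "{1, 1/2, 1/4, 0, - 1/4, - 1/2, - 1 :: real}"
  have "{y\<in>leech_code. x \<bullet> y = 1} = {x}"
    using unit_inner_eq_1 norm_leech_code x by (auto simp: norm_eq_1)
  then have n1: "leech_count x 1 = 1" by (simp add: leech_count_def)
  have "(\<Sum>y\<in>leech_code. g (x \<bullet> y)) = (\<Sum>t\<in>?T. \<Sum>y\<in>{y\<in>leech_code. x \<bullet> y = t}. g (x \<bullet> y))"
  proof (rule sum.group[symmetric])
    show "(\<lambda>y. x \<bullet> y) ` leech_code \<subseteq> ?T"
      using leech_inner_products[OF x] by blast
  qed (simp_all add: finite_leech_code)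
  also have "\<dots> = (\<Sum>t\<in>?T. real (leech_count x t) * g t)"
    by (intro sum.cong refl) (simp add: leech_count_def)
  also have "\<dots> = 2 * g 1 + 2 * real (leech_count x (1/2)) * g (1/2) + 2 * real (leech_count x (1/4)) * g (1/4) + real (leech_count x 0) * g 0"
    using n1 leech_count_uminus[of x 1] leech_count_uminus[of x "1/2"] leech_count_uminus[of x "1/4"]
      g[of 1] g[of "1/2"] g[of "1/4"]
    by simp
  finally show ?thesis .
qed

text \<open>The inner product 0 contributes nothing to moments of positive degree, so degrees 2 and
  4 give a system of two equations for the two counts.\<close>

lemma leech_counts:
  assumes x: "x \<in> leech_code"
  shows "leech_count x (1/2) = 4600" "leech_count x (1/4) = 47104"
proof -
  have nx: "norm x = 1" using x by (rule norm_leech_code)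
  have "2 + 2 * real (leech_count x (1/2)) * (1/2)^2 + 2 * real (leech_count x (1/4)) * (1/4)^2 = 8190"
    using leech_sum_by_inner_product[OF x, of "\<lambda>t. t ^ 2"] leech_code_second_moment[of x] by (simp add: nx)
  moreover have "2 + 2 * real (leech_count x (1/2)) * (1/2)^4 + 2 * real (leech_count x (1/4)) * (1/4)^4 = 945"
    using leech_sum_by_inner_product[OF x, of "\<lambda>t. t ^ 4"] leech_code_fourth_moment[of x] by (simp add: nx)
  ultimately have "real (leech_count x (1/2)) = 4600" "real (leech_count x (1/4)) = 47104"
    by (simp_all add: power2_eq_square power4_eq_xxxx)
  then show "leech_count x (1/2) = 4600" "leech_count x (1/4) = 47104" by simp_all
qed

lemma leech_odd_sum:
  assumes "\<And>y. f (- y) = - f y"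
  shows "(\<Sum>y\<in>leech_code. f y :: real) = 0"
proof -
  have "(\<Sum>y\<in>leech_code. f y) = (\<Sum>y\<in>leech_code. - f y)"
    by (rule sum.reindex_bij_witness[of _ uminus uminus]) (auto simp: uminus_leech_code assms)
  then show ?thesis by (simp add: sum_negf)
qed

text \<open>For \<open>x\<close> in the code the claim is a numerical identity between the two
  counts and the moment of the sphere; \<open>sum_inner_power_eq\<close> extends it to all
  directions.\<close>

lemma leech_code_moments:
  assumes d: "d \<in> {2, 4, 6, 8, 10}"
  shows "(\<Sum>y\<in>leech_code. (a \<bullet> y) ^ d) = 196560 * sphere_moment 24 d * norm a ^ d"
proof -
  have "(\<Sum>y\<in>leech_code. (x \<bullet> y) ^ d) = 196560 * sphere_moment 24 d" if x: "x \<in> leech_code" for x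
  proof -
    have "(\<Sum>y\<in>leech_code. (x \<bullet> y) ^ d) = 2 + 2 * 4600 * (1/2) ^ d + 2 * 47104 * (1/4) ^ d"
      using leech_sum_by_inner_product[OF x, of "\<lambda>t. t ^ d"] leech_counts[OF x] d by auto
    also have "\<dots> = 196560 * sphere_moment 24 d"
      using d by (auto simp: sphere_moment_def lessThan_nat_numeral lessThan_Suc power_divide)
    finally show ?thesis .
  qed
  then have "(\<Sum>x\<in>leech_code. \<Sum>y\<in>leech_code. (x \<bullet> y) ^ d) = (real (card leech_code))\<^sup>2 * sphere_moment CARD(23 option) d"
    by (simp add: card_leech_code power2_eq_square)
  then have "(\<Sum>y\<in>leech_code. (a \<bullet> y) ^ d) = card leech_code * sphere_moment CARD(23 option) d * norm a ^ d"
    by (intro sum_inner_power_eq) (auto simp: finite_leech_code norm_leech_code)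
  then show ?thesis by (simp add: card_leech_code)
qed

section \<open>The derived code\<close>

lemma leech_joint_moments:
  assumes x: "x \<in> leech_code" and a: "a \<bullet> x = 0" and k: "k \<in> {1, 2, 3, 4, 5}"
  shows "i \<le> k \<Longrightarrow> ((2 * k) choose (2 * i)) * (\<Sum>y\<in>leech_code. (a \<bullet> y) ^ (2 * k - 2 * i) * (x \<bullet> y) ^ (2 * i))
      = 196560 * sphere_moment 24 (2 * k) * (k choose i) * norm a ^ (2 * (k - i))"
    and "i < k \<Longrightarrow> (\<Sum>y\<in>leech_code. (a \<bullet> y) ^ (2 * k - (2 * i + 1)) * (x \<bullet> y) ^ (2 * i + 1)) = 0"
proof -
  have "2 * k \<in> {2, 4, 6, 8, 10}" using k by auto
  then have eq: "(\<integral>y. (a \<bullet> y) ^ (2 * k) \<partial>count_space leech_code)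
      = (196560 * sphere_moment 24 (2 * k)) * norm a ^ (2 * k)" for a
    unfolding integral_count_space_leech by (rule leech_code_moments)
  note * = joint_moments[OF integrable_count_space_leech eq norm_leech_code[OF x] a,
      unfolded integral_count_space_leech]
  show "i \<le> k \<Longrightarrow> ((2 * k) choose (2 * i)) * (\<Sum>y\<in>leech_code. (a \<bullet> y) ^ (2 * k - 2 * i) * (x \<bullet> y) ^ (2 * i))
      = 196560 * sphere_moment 24 (2 * k) * (k choose i) * norm a ^ (2 * (k - i))"
    using *(1) by simp
  show "i < k \<Longrightarrow> (\<Sum>y\<in>leech_code. (a \<bullet> y) ^ (2 * k - (2 * i + 1)) * (x \<bullet> y) ^ (2 * i + 1)) = 0"
    using *(2) by simp
qed

definition neighbours :: "real24 \<Rightarrow> real24 set" where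
  "neighbours x = {y\<in>leech_code. x \<bullet> y = 1/4}"

text \<open>The quartic \<open>(t - 1/2) t (t + 1/4) (t + 1/2)\<close> vanishes at all inner products of the code except
  \<open>1/4\<close> and \<open>\<plusminus>1\<close>; at \<open>\<plusminus>1\<close> the factor \<open>(a \<bullet> y) ^ d\<close> vanishes.\<close>

lemma sum_neighbours:
  assumes x: "x \<in> leech_code" and a: "a \<bullet> x = 0" and d: "d > 0"
  defines "J \<equiv> \<lambda>i. \<Sum>y\<in>leech_code. (a \<bullet> y) ^ d * (x \<bullet> y) ^ i"
  shows "- (3 / 128) * (\<Sum>y\<in>neighbours x. (a \<bullet> y) ^ d) = J 4 + J 3 / 4 - J 2 / 4 - J 1 / 16"
proof -
  \<comment> \<open>The quartic in expanded form; its value at 1/4 is -3/128.\<close>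
  let ?q = "\<lambda>t::real. t ^ 4 + t ^ 3 / 4 - t ^ 2 / 4 - t ^ 1 / 16"
  have "?q (x \<bullet> y) * (a \<bullet> y) ^ d = 0" if y: "y \<in> leech_code - neighbours x" for y
  proof -
    have "x \<bullet> y \<in> {1, 1/2, 1/4, 0, - 1/4, - 1/2, - 1}" "x \<bullet> y \<noteq> 1/4"
      using leech_inner_products[OF x] y by (auto simp: neighbours_def)
    have nx: "norm x = 1" and ny: "norm y = 1" "norm (- y) = 1"
      using norm_leech_code[OF x] norm_leech_code[of y] y by (simp_all only: norm_minus_cancel DiffD1)
    from \<open>x \<bullet> y \<in> _\<close> \<open>x \<bullet> y \<noteq> _\<close>
    consider "x \<bullet> y = 1" | "x \<bullet> y = - 1" | "x \<bullet> y \<in> {1/2, 0, - 1/4, - 1/2}"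
      by blast
    then show ?thesis
    proof cases
      case 1
      then have "x = y" by (rule unit_inner_eq_1[OF nx ny(1)])
      then show ?thesis using a d by simp
    next
      case 2
      then have "x \<bullet> (- y) = 1" by simp
      then have "x = - y" by (rule unit_inner_eq_1[OF nx ny(2)])
      then have "y = - x" by simp
      then show ?thesis using a d by simp
    next
      case 3
      moreover have "?q t = 0" if "t \<in> {1/2, 0, - 1/4, - 1/2}" for t
        using that by (elim insertE emptyE; hypsubst; simp add: power_divide)
      ultimately have "?q (x \<bullet> y) = 0" by blast
      then show ?thesis by simp
    qed
  qed
  then have "(\<Sum>y\<in>leech_code. ?q (x \<bullet> y) * (a \<bullet> y) ^ d) = (\<Sum>y\<in>neighbours x. ?q (x \<bullet> y) * (a \<bullet> y) ^ d)"
    by (intro sum.mono_neutral_right finite_leech_code) (auto simp: neighbours_def)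
  also have "\<dots> = (\<Sum>y\<in>neighbours x. - (3 / 128) * (a \<bullet> y) ^ d)"
  proof (intro sum.cong refl)
    fix y assume "y \<in> neighbours x"
    then have xy: "x \<bullet> y = 1/4" by (simp only: neighbours_def mem_Collect_eq)
    show "?q (x \<bullet> y) * (a \<bullet> y) ^ d = - (3 / 128) * (a \<bullet> y) ^ d"
      unfolding xy by (simp add: power_divide)
  qed
  finally have "- (3 / 128) * (\<Sum>y\<in>neighbours x. (a \<bullet> y) ^ d) = (\<Sum>y\<in>leech_code. ?q (x \<bullet> y) * (a \<bullet> y) ^ d)"
    by (simp only: sum_distrib_left)
  also have "\<dots> = (\<Sum>y\<in>leech_code. (a \<bullet> y) ^ d * (x \<bullet> y) ^ 4 + (a \<bullet> y) ^ d * (x \<bullet> y) ^ 3 / 4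
      - (a \<bullet> y) ^ d * (x \<bullet> y) ^ 2 / 4 - (a \<bullet> y) ^ d * (x \<bullet> y) ^ 1 / 16)"
    by (intro sum.cong refl) (simp only: ring_distribs times_divide_eq_right times_divide_eq_left mult.commute)
  also have "\<dots> = J 4 + J 3 / 4 - J 2 / 4 - J 1 / 16"
    by (simp only: sum.distrib sum_subtractf sum_divide_distrib J_def)
  finally show ?thesis .
qed

lemma binomial_values:
  "(4::nat) choose 2 = 6" "(6::nat) choose 2 = 15" "(6::nat) choose 4 = 15" "(8::nat) choose 2 = 28"
  "(8::nat) choose 4 = 70" "(10::nat) choose 4 = 210" "(3::nat) choose 2 = 3" "(5::nat) choose 2 = 10"
  by (simp_all add: binomial_fact' fact_numeral)

lemma sphere_moment_values:
  "sphere_moment 24 4 = 1 / 208" "sphere_moment 24 6 = 5 / 5824" "sphere_moment 24 8 = 7 / 34944"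
  "sphere_moment 24 10 = 21 / 372736"
  "sphere_moment 23 0 = 1" "sphere_moment 23 2 = 1 / 23" "sphere_moment 23 4 = 3 / 575" "sphere_moment 23 6 = 1 / 1035"
  by (simp_all add: sphere_moment_def lessThan_nat_numeral lessThan_Suc)

text \<open>Terms of odd total degree vanish by antipodality, those of even degree with an odd power
  of \<open>x \<bullet> y\<close> by \<open>leech_joint_moments\<close>. The moments used there have
  degree at most 10, reached as 6 + 4 and 7 + 3. The factor \<open>sqrt (15 / 16)\<close> is the
  length of the component of a neighbour orthogonal to \<open>x\<close>.\<close>

lemma neighbours_moments:
  assumes x: "x \<in> leech_code" and a: "a \<bullet> x = 0" and d: "0 < d" "d \<le> 7"
  shows "(\<Sum>y\<in>neighbours x. (a \<bullet> y) ^ d) = 47104 * sphere_moment 23 d * sqrt (15 / 16) ^ d * norm a ^ d"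
proof -
  note J = leech_joint_moments[OF x a]
  note main = sum_neighbours[OF x a d(1)]
  have sq: "sqrt (15 / 16) ^ 2 = 15 / 16" "sqrt (15 / 16) ^ 4 = (15 / 16)\<^sup>2" "sqrt (15 / 16) ^ 6 = (15 / 16) ^ 3"
    using power_mult[of "sqrt (15 / 16)" 2 2] power_mult[of "sqrt (15 / 16)" 2 3] by simp_all
  have "d \<in> {2, 4, 6} \<or> d \<in> {1, 3, 5, 7}"
    using d by auto
  then show ?thesis
  proof
    assume ev: "d \<in> {2, 4, 6}"
    have odd: "(\<Sum>y\<in>leech_code. (a \<bullet> y) ^ d * (x \<bullet> y) ^ 3) = 0"
      "(\<Sum>y\<in>leech_code. (a \<bullet> y) ^ d * (x \<bullet> y) ^ 1) = 0"
      using ev by (intro leech_odd_sum; auto)+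
    from ev consider "d = 2" | "d = 4" | "d = 6" by auto
    then show ?thesis
    proof cases
      case 1
      then show ?thesis
        using main odd J(1)[of 3 2] J(1)[of 2 1]
        by (simp add: binomial_values sphere_moment_values sq)
    next
      case 2
      then show ?thesis
        using main odd J(1)[of 4 2] J(1)[of 3 1]
        by (simp add: binomial_values sphere_moment_values sq power_divide)
    next
      case 3
      then show ?thesis
        using main odd J(1)[of 5 2] J(1)[of 4 1]
        by (simp add: binomial_values sphere_moment_values sq power_divide)
    qed
  next
    assume od: "d \<in> {1, 3, 5, 7}"
    have even: "(\<Sum>y\<in>leech_code. (a \<bullet> y) ^ d * (x \<bullet> y) ^ 4) = 0"
      "(\<Sum>y\<in>leech_code. (a \<bullet> y) ^ d * (x \<bullet> y) ^ 2) = 0"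
      using od by (intro leech_odd_sum; auto)+
    have "(\<Sum>y\<in>leech_code. (a \<bullet> y) ^ d * (x \<bullet> y) ^ 3) = 0"
      "(\<Sum>y\<in>leech_code. (a \<bullet> y) ^ d * (x \<bullet> y) ^ 1) = 0"
      using od J(2)[of "(d + 3) div 2" 1] J(2)[of "(d + 1) div 2" 0] by auto
    with even main have "(\<Sum>y\<in>neighbours x. (a \<bullet> y) ^ d) = 0" by simp
    moreover have "sphere_moment 23 d = 0" using od by (auto simp: sphere_moment_def)
    ultimately show ?thesis by simp
  qed
qed

section \<open>Projection to the orthogonal complement\<close>

definition project :: "real24 \<Rightarrow> real24 \<Rightarrow> real24" where
  "project x y = (y - (1 / 4) *\<^sub>R x) /\<^sub>R sqrt (1 - 1 / 16)"

lemma quarter_code_eq: "quarter_code x = project x ` neighbours x"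
  by (auto simp: quarter_code_def project_def neighbours_def)

lemma card_neighbours: "x \<in> leech_code \<Longrightarrow> card (neighbours x) = 47104"
  using leech_counts(2) by (simp add: neighbours_def leech_count_def)

lemma inj_project: "inj (project x)"
  by (rule injI) (simp add: project_def)

lemma card_quarter_code: "x \<in> leech_code \<Longrightarrow> card (quarter_code x) = 47104"
  by (simp add: quarter_code_eq card_image inj_on_subset[OF inj_project] card_neighbours)

lemma inner_project:
  assumes "x \<in> leech_code" "y \<in> neighbours x" "z \<in> neighbours x"
  shows "project x y \<bullet> project x z = (y \<bullet> z - 1 / 16) * (16 / 15)"
proof -
  have "x \<bullet> x = 1" "x \<bullet> y = 1/4" "x \<bullet> z = 1/4"
    using assms norm_leech_code by (auto simp: neighbours_def norm_eq_1)
  then have "(y - (1 / 4) *\<^sub>R x) \<bullet> (z - (1 / 4) *\<^sub>R x) = y \<bullet> z - 1 / 16"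
    by (simp only: inner_diff_left inner_diff_right inner_scaleR_left inner_scaleR_right inner_commute[of y x]) simp
  moreover have "inverse (sqrt (1 - 1 / 16)) * inverse (sqrt (1 - 1 / 16)) = (16 / 15 :: real)"
    by (simp add: inverse_eq_divide)
  ultimately show ?thesis
    unfolding project_def inner_scaleR_left inner_scaleR_right
    by (simp only: mult.assoc[symmetric])
qed

lemma quarter_code_orthogonal:
  assumes "x \<in> leech_code" "v \<in> quarter_code x"
  shows "x \<bullet> v = 0"
  using assms norm_leech_code[OF assms(1)]
  by (auto simp: quarter_code_eq project_def neighbours_def norm_eq_1 inner_simps)

lemma norm_quarter_code:
  assumes x: "x \<in> leech_code" and v: "v \<in> quarter_code x"
  shows "norm v = 1"
proof -
  obtain y where y: "y \<in> neighbours x" "v = project x y"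
    using v by (auto simp: quarter_code_eq)
  have "y \<bullet> y = 1"
    using y norm_leech_code by (auto simp: neighbours_def norm_eq_1)
  then show ?thesis
    using inner_project[OF x y(1) y(1)] by (simp add: y(2) norm_eq_1)
qed

text \<open>The affine map of \<open>inner_project\<close> sends 1/2, 1/4, 0, -1/4, -1/2 to the five
  values. The inner product -1 does not occur, since antipodal vectors cannot both have inner
  product 1/4 with \<open>x\<close>.\<close>

lemma quarter_code_inner_products:
  assumes x: "x \<in> leech_code" and v: "v \<in> quarter_code x" and w: "w \<in> quarter_code x" and "v \<noteq> w"
  shows "v \<bullet> w \<in> {- 3 / 5, - 1 / 3, - 1 / 15, 1 / 5, 7 / 15}"
proof -
  obtain y where y: "y \<in> neighbours x" "v = project x y" using v by (auto simp: quarter_code_eq)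
  obtain z where z: "z \<in> neighbours x" "w = project x z" using w by (auto simp: quarter_code_eq)
  have L: "y \<in> leech_code" "z \<in> leech_code" "x \<bullet> y = 1/4" "x \<bullet> z = 1/4"
    using y z by (auto simp: neighbours_def)
  have "y \<noteq> z" using y z \<open>v \<noteq> w\<close> by auto
  then have "y \<bullet> z \<noteq> 1" using unit_inner_eq_1 L norm_leech_code by blast
  moreover have "y \<noteq> - z" using L by auto
  then have "y \<bullet> (- z) \<noteq> 1"
    using unit_inner_eq_1[of y "- z"] L norm_leech_code by auto
  ultimately have "y \<bullet> z \<in> {1/2, 1/4, 0, - 1/4, - 1/2}"
    using leech_inner_products[OF L(1,2)] by auto
  then show ?thesis
    unfolding y(2) z(2) inner_project[OF x y(1) z(1)] by auto
qed

text \<open>A point \<open>v\<close> of the derived code is itself a unit vector orthogonal to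
  \<open>x\<close>, so \<open>neighbours_moments\<close> applies with \<open>a = v\<close>, and the
  normalization cancels the power of \<open>sqrt (15 / 16)\<close>. Degree 0 is the
  cardinality.\<close>

lemma quarter_code_pair_moments:
  assumes x: "x \<in> leech_code" and d: "d \<le> 7"
  shows "(\<Sum>v\<in>quarter_code x. \<Sum>w\<in>quarter_code x. (v \<bullet> w) ^ d) = 47104\<^sup>2 * sphere_moment 23 d"
proof (cases "d = 0")
  case True
  then show ?thesis
    using card_quarter_code[OF x] by (simp add: sphere_moment_values power2_eq_square)
next
  case False
  let ?s = "sqrt (1 - 1 / 16) :: real"
  have "(\<Sum>w\<in>quarter_code x. (v \<bullet> w) ^ d) = 47104 * sphere_moment 23 d" if v: "v \<in> quarter_code x" for v
  proof -
    have ortho: "v \<bullet> x = 0"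
      using quarter_code_orthogonal[OF x v] by (simp add: inner_commute)
    have "(\<Sum>w\<in>quarter_code x. (v \<bullet> w) ^ d) = (\<Sum>y\<in>neighbours x. (v \<bullet> project x y) ^ d)"
      unfolding quarter_code_eq by (rule sum.reindex[OF inj_on_subset[OF inj_project subset_UNIV], unfolded comp_def])
    also have "\<dots> = (\<Sum>y\<in>neighbours x. (v \<bullet> y) ^ d / ?s ^ d)"
    proof (intro sum.cong refl)
      fix y
      have "v \<bullet> project x y = (v \<bullet> y) / ?s"
        unfolding project_def inner_scaleR_right inner_diff_right ortho by (simp only: mult_zero_right diff_zero divide_inverse_commute[of "v \<bullet> y"])
      then show "(v \<bullet> project x y) ^ d = (v \<bullet> y) ^ d / ?s ^ d"
        by (simp only: power_divide)
    qed
    also have "\<dots> = (\<Sum>y\<in>neighbours x. (v \<bullet> y) ^ d) / ?s ^ d"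
      by (simp add: sum_divide_distrib)
    also have "(\<Sum>y\<in>neighbours x. (v \<bullet> y) ^ d) = 47104 * sphere_moment 23 d * sqrt (15 / 16) ^ d"
      using neighbours_moments[OF x ortho _ d] False norm_quarter_code[OF x v] by simp
    finally show ?thesis by simp
  qed
  then show ?thesis
    using card_quarter_code[OF x] by (simp add: power2_eq_square)
qed

lemma complement_isometry_inner:
  assumes "complement_isometry x \<phi>" "x \<bullet> v = 0" "x \<bullet> w = 0"
  shows "\<phi> v \<bullet> \<phi> w = v \<bullet> w"
proof -
  have lin: "linear \<phi>" and norm: "\<And>v. x \<bullet> v = 0 \<Longrightarrow> norm (\<phi> v) = norm v"
    using assms(1) by (auto simp: complement_isometry_def)
  have "x \<bullet> (v + w) = 0" using assms by (simp add: inner_add_right)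
  then have "norm (\<phi> v + \<phi> w) = norm (v + w)"
    using norm[of "v + w"] by (simp add: linear_add[OF lin])
  then show ?thesis
    using norm assms(2,3) by (simp add: dot_norm)
qed

lemma complement_isometry_inj_on:
  assumes "complement_isometry x \<phi>" "S \<subseteq> {v. x \<bullet> v = 0}"
  shows "inj_on \<phi> S"
proof (rule inj_onI)
  fix v w assume "v \<in> S" "w \<in> S" "\<phi> v = \<phi> w"
  moreover from this have "x \<bullet> v = 0" "x \<bullet> w = 0"
    using assms(2) by auto
  ultimately have "x \<bullet> (v - w) = 0" "\<phi> (v - w) = 0"
    using assms(1) by (simp_all add: inner_diff_right complement_isometry_def linear_diff)
  then have "norm (v - w) = 0"
    using assms(1) by (metis complement_isometry_def norm_zero)
  then show "v = w" by simp
qed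

lemma quarter_code_design:
  fixes \<phi> :: "real24 \<Rightarrow> real ^ 23"
  assumes x: "x \<in> leech_code" and \<phi>: "complement_isometry x \<phi>" and \<tau>: "\<tau> \<le> 7"
  shows "card (\<phi> ` quarter_code x) = 47104"
    and "spherical_design \<tau> (\<phi> ` quarter_code x)"
    and "inner_products (\<phi> ` quarter_code x) \<subseteq> {- 3 / 5, - 1 / 3, - 1 / 15, 1 / 5, 7 / 15}"
proof -
  let ?Q = "quarter_code x"
  have ortho: "x \<bullet> v = 0" if "v \<in> ?Q" for v
    using quarter_code_orthogonal[OF x that] .
  have inner: "\<phi> v \<bullet> \<phi> w = v \<bullet> w" if "v \<in> ?Q" "w \<in> ?Q" for v w
    using complement_isometry_inner[OF \<phi>] ortho that by blast
  have inj: "inj_on \<phi> ?Q"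
    using complement_isometry_inj_on[OF \<phi>] ortho by blast
  show card: "card (\<phi> ` ?Q) = 47104"
    using card_image[OF inj] card_quarter_code[OF x] by simp
  show "spherical_design \<tau> (\<phi> ` ?Q)"
  proof (rule spherical_designI)
    show "finite (\<phi> ` ?Q)" "\<phi> ` ?Q \<noteq> {}"
      using card by (auto intro: card_ge_0_finite)
    show "\<phi> ` ?Q \<subseteq> sphere 0 1"
      using inner norm_quarter_code[OF x] by (auto simp: norm_eq_1)
    fix d assume "d \<le> \<tau>"
    then have d: "d \<le> 7" using \<tau> by simp
    have "(\<Sum>v\<in>\<phi> ` ?Q. \<Sum>w\<in>\<phi> ` ?Q. (v \<bullet> w) ^ d) = (\<Sum>v\<in>?Q. \<Sum>w\<in>?Q. (v \<bullet> w) ^ d)"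
      by (simp add: sum.reindex[OF inj] inner)
    then show "(\<Sum>v\<in>\<phi> ` ?Q. \<Sum>w\<in>\<phi> ` ?Q. (v \<bullet> w) ^ d) = (card (\<phi> ` ?Q))\<^sup>2 * sphere_moment CARD(23) d"
      using quarter_code_pair_moments[OF x d] card by simp
  qed
  show "inner_products (\<phi> ` ?Q) \<subseteq> {- 3 / 5, - 1 / 3, - 1 / 15, 1 / 5, 7 / 15}"
  proof
    fix t assume "t \<in> inner_products (\<phi> ` ?Q)"
    then obtain v w where vw: "v \<in> ?Q" "w \<in> ?Q" "\<phi> v \<noteq> \<phi> w" "t = \<phi> v \<bullet> \<phi> w"
      by (auto simp: inner_products_def)
    then have "v \<noteq> w" by auto
    with vw show "t \<in> {- 3 / 5, - 1 / 3, - 1 / 15, 1 / 5, 7 / 15}"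
      using quarter_code_inner_products[OF x vw(1,2)] inner by simp
  qed
qed

section \<open>Gegenbauer polynomials in dimension 23\<close>

text \<open>In dimension 23 the exponent \<open>(n - 3) / 2\<close> is 10, so the Gegenbauer weight
  is a polynomial.\<close>

definition weighted_integral :: "real poly \<Rightarrow> real" where
  "weighted_integral p = integral {- 1..1} (\<lambda>t. (1 - t\<^sup>2) ^ 10 * poly p t)"

lemma weighted_integrable: "(\<lambda>t. (1 - t\<^sup>2) ^ 10 * poly p t) integrable_on {- 1..1 :: real}"
  by (intro integrable_continuous_interval continuous_intros)

lemma weighted_integral_add: "weighted_integral (p + q) = weighted_integral p + weighted_integral q"
  unfolding weighted_integral_def poly_add distrib_left by (rule integral_add[OF weighted_integrable weighted_integrable])

lemma weighted_integral_smult: "weighted_integral (smult c p) = c * weighted_integral p"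
  unfolding weighted_integral_def poly_smult by (simp add: mult.left_commute)

lemma weighted_integral_0 [simp]: "weighted_integral 0 = 0"
  by (simp add: weighted_integral_def)

lemma weighted_integral_diff: "weighted_integral (p - q) = weighted_integral p - weighted_integral q"
  using weighted_integral_add[of p "- q"] weighted_integral_smult[of "- 1" q] by simp

text \<open>A nonnegative continuous integrand with integral 0 vanishes; as the weight is positive
  inside the interval, \<open>p\<close> would have infinitely many roots there.\<close>

lemma weighted_integral_square_eq_0:
  assumes "weighted_integral (p * p) = 0"
  shows "p = 0"
proof (rule ccontr)
  assume "p \<noteq> 0"
  have "\<forall>t\<in>{- 1..1}. (1 - t\<^sup>2) ^ 10 * poly (p * p) t = 0"
    using assms unfolding weighted_integral_def
    by (subst (asm) integral_eq_0_iff) (auto intro!: continuous_intros simp: abs_square_le_1 abs_le_iff)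
  have "{- 1<..<1} \<subseteq> {t. poly p t = 0}"
  proof
    fix t :: real assume t: "t \<in> {- 1<..<1}"
    then have "t\<^sup>2 \<noteq> 1" by (auto simp: power2_eq_1_iff)
    then show "t \<in> {t. poly p t = 0}"
      using \<open>\<forall>t\<in>{- 1..1}. _\<close>[rule_format, of t] t by simp
  qed
  then have "finite {- 1<..<1::real}"
    using poly_roots_finite[OF \<open>p \<noteq> 0\<close>] finite_subset by blast
  then show False by (simp add: infinite_Ioo)
qed

section \<open>Moments of the weight and explicit orthogonal polynomials\<close>

definition weighted_moment :: "nat \<Rightarrow> real" where
  "weighted_moment k = weighted_integral (monom 1 k)"

text \<open>The shift \<open>j\<close> makes integration a recursion along the coefficient list,
  which the simplifier can run.\<close>

definition shifted_integral :: "real poly \<Rightarrow> nat \<Rightarrow> real" where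
  "shifted_integral p j = weighted_integral (p * monom 1 j)"

lemma shifted_integral_0: "shifted_integral 0 j = 0"
  by (simp add: shifted_integral_def)

lemma shifted_integral_pCons:
  "shifted_integral (pCons c p) j = c * weighted_moment j + shifted_integral p (Suc j)"
proof -
  have "pCons c p * monom 1 j = smult c (monom 1 j) + p * monom 1 (Suc j)"
    by (simp add: monom_Suc)
  then show ?thesis
    by (simp add: shifted_integral_def weighted_integral_add weighted_integral_smult weighted_moment_def)
qed

text \<open>Integrate the derivative of \<open>t ^ (k + 1) * (1 - t\<^sup>2) ^ 11\<close>, a
  function that vanishes at both endpoints.\<close>

lemma weighted_moment_recurrence: "(k + 23) * weighted_moment (k + 2) = (k + 1) * weighted_moment k"
proof -
  have "((\<lambda>t. (1 - t\<^sup>2) ^ 10 * poly (monom (real k + 1) k - monom (real k + 23) (k + 2)) t) has_integral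
      (1 ^ (k + 1) * (1 - 1\<^sup>2) ^ 11 - (- 1) ^ (k + 1) * (1 - (- 1)\<^sup>2) ^ 11)) {- 1..1 :: real}"
  proof (rule fundamental_theorem_of_calculus)
    fix t :: real
    have "((\<lambda>t. t ^ (k + 1)) has_real_derivative (real k + 1) * t ^ k) (at t within {- 1..1})"
      by (rule has_field_derivative_at_within) (use DERIV_pow[of "k + 1" t] in \<open>simp add: add.commute\<close>)
    moreover have "((\<lambda>t. (1 - t\<^sup>2) ^ 11) has_real_derivative 11 * (1 - t\<^sup>2) ^ 10 * (- (2 * t))) (at t within {- 1..1})"
      by (auto intro!: derivative_eq_intros)
    ultimately have "((\<lambda>t. t ^ (k + 1) * (1 - t\<^sup>2) ^ 11) has_real_derivative
        ((real k + 1) * t ^ k * (1 - t\<^sup>2) ^ 11 + 11 * (1 - t\<^sup>2) ^ 10 * (- (2 * t)) * t ^ (k + 1))) (at t within {- 1..1})"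
      by (rule DERIV_mult)
    also have "(real k + 1) * t ^ k * (1 - t\<^sup>2) ^ 11 + 11 * (1 - t\<^sup>2) ^ 10 * (- (2 * t)) * t ^ (k + 1)
        = (1 - t\<^sup>2) ^ 10 * ((real k + 1) * t ^ k * (1 - t\<^sup>2) - 22 * t ^ (k + 2))"
      by (simp add: algebra_simps power2_eq_square eval_nat_numeral)
    also have "\<dots> = (1 - t\<^sup>2) ^ 10 * poly (monom (real k + 1) k - monom (real k + 23) (k + 2)) t"
      by (simp add: poly_monom algebra_simps power2_eq_square)
    finally show "((\<lambda>t. t ^ (k + 1) * (1 - t\<^sup>2) ^ 11) has_vector_derivative
        (1 - t\<^sup>2) ^ 10 * poly (monom (real k + 1) k - monom (real k + 23) (k + 2)) t) (at t within {- 1..1})"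
      by (simp add: has_real_derivative_iff_has_vector_derivative)
  qed simp
  then have "weighted_integral (monom (real k + 1) k - monom (real k + 23) (k + 2)) = 0"
    unfolding weighted_integral_def by (simp add: integral_unique)
  moreover have "monom c j = smult c (monom 1 j)" for c :: real and j
    by (simp add: smult_monom)
  ultimately show ?thesis
    by (metis weighted_integral_diff weighted_integral_smult weighted_moment_def eq_iff_diff_eq_0)
qed

lemma weighted_moment_1: "weighted_moment 1 = 0"
proof -
  have "((\<lambda>t. (1 - t\<^sup>2) ^ 10 * poly (monom 1 1) t) has_integral
      ((1 - 1\<^sup>2) ^ 11 / (- 22) - (1 - (- 1)\<^sup>2) ^ 11 / (- 22))) {- 1..1 :: real}"
  proof (rule fundamental_theorem_of_calculus)
    fix t :: real
    have "((\<lambda>t. (1 - t\<^sup>2) ^ 11 / (- 22)) has_real_derivative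
        (1 - t\<^sup>2) ^ 10 * poly (monom 1 1) t) (at t within {- 1..1})"
      by (auto intro!: derivative_eq_intros simp: poly_monom)
    then show "((\<lambda>t. (1 - t\<^sup>2) ^ 11 / (- 22)) has_vector_derivative
        (1 - t\<^sup>2) ^ 10 * poly (monom 1 1) t) (at t within {- 1..1})"
      by (simp add: has_real_derivative_iff_has_vector_derivative)
  qed simp
  then show ?thesis
    unfolding weighted_moment_def weighted_integral_def by (simp add: integral_unique)
qed

lemma weighted_moment_Suc_Suc:
  "weighted_moment (Suc (Suc k)) = (real k + 1) / (real k + 23) * weighted_moment k"
  using weighted_moment_recurrence[of k] by (simp add: field_simps)

text \<open>Candidates up to degree 6, the degree of \<open>lp_poly\<close>; the quadratic one, for
  example, is \<open>(23 * t\<^sup>2 - 1) / 22\<close>.\<close>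

definition gegenbauer23 :: "nat \<Rightarrow> real poly" where
  "gegenbauer23 i = [
    [:1:],
    [:0, 1:],
    [:- 1 / 22, 0, 23 / 22:],
    [:0, - 3 / 22, 0, 25 / 22:],
    [:1 / 176, 0, - 25 / 88, 0, 225 / 176:],
    [:0, 5 / 176, 0, - 45 / 88, 0, 261 / 176:],
    [:- 5 / 4576, 0, 405 / 4576, 0, - 3915 / 4576, 0, 8091 / 4576:]] ! i"

lemma le_6_cases: "(i::nat) \<le> 6 \<Longrightarrow> i \<in> {0, 1, 2, 3, 4, 5, 6}"
  by auto

lemma degree_gegenbauer23: "i \<le> 6 \<Longrightarrow> degree (gegenbauer23 i) = i"
  by (drule le_6_cases, elim insertE emptyE) (simp_all add: gegenbauer23_def)

lemma poly_gegenbauer23_1: "i \<le> 6 \<Longrightarrow> poly (gegenbauer23 i) 1 = 1"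
  by (drule le_6_cases, elim insertE emptyE) (simp_all add: gegenbauer23_def)

text \<open>The recurrence turns the integral into a combination of \<open>weighted_moment 0\<close>
  and \<open>weighted_moment 1\<close>. The latter is 0 and the factor of the former cancels, so
  orthogonality is a matter of rational arithmetic.\<close>

lemma gegenbauer23_orthogonal_monom:
  assumes "i \<le> 6" "j < i"
  shows "weighted_integral (gegenbauer23 i * monom 1 j) = 0"
proof -
  have j: "j \<in> {0, 1, 2, 3, 4, 5}" using assms by auto
  note simps = gegenbauer23_def shifted_integral_0 shifted_integral_pCons weighted_moment_Suc_Suc
    weighted_moment_1[unfolded One_nat_def]
  from le_6_cases[OF assms(1)] j assms(2) show ?thesis
    unfolding shifted_integral_def[symmetric]
    by (elim insertE emptyE; hypsubst; simp add: simps numeral_eq_Suc)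
qed

lemma weighted_integral_gegenbauer23:
  assumes "i \<le> 6" "degree q < i"
  shows "weighted_integral (gegenbauer23 i * q) = 0"
proof -
  have "weighted_integral (gegenbauer23 i * (\<Sum>j\<in>S. smult (coeff q j) (monom 1 j)))
      = (\<Sum>j\<in>S. coeff q j * weighted_integral (gegenbauer23 i * monom 1 j))" if "finite S" for S
    using that by induction (simp_all add: distrib_left weighted_integral_add weighted_integral_smult)
  from this[of "{..degree q}"]
  have "weighted_integral (gegenbauer23 i * (\<Sum>j\<le>degree q. smult (coeff q j) (monom 1 j))) = 0"
    using assms by (simp add: gegenbauer23_orthogonal_monom)
  moreover have "(\<Sum>j\<le>degree q. smult (coeff q j) (monom 1 j)) = q"
    using poly_as_sum_of_monoms[of q] by (simp add: smult_monom)
  ultimately show ?thesis by simp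
qed

text \<open>A candidate in the description that defines \<open>gegenbauer\<close> is known to be
  orthogonal only to the previous polynomials. Peeling off leading terms extends this to all
  polynomials of lower degree.\<close>

lemma orthogonal_to_lower_degree:
  assumes B: "\<And>j. j < i \<Longrightarrow> degree (B j) = j \<and> B j \<noteq> 0"
    and orth: "\<And>j. j < i \<Longrightarrow> weighted_integral (p * B j) = 0"
  shows "degree q < i \<Longrightarrow> weighted_integral (p * q) = 0"
proof (induction "degree q" arbitrary: q rule: less_induct)
  case less
  define c where "c = lead_coeff q / lead_coeff (B (degree q))"
  define r where "r = q - smult c (B (degree q))"
  have Bq: "degree (B (degree q)) = degree q" "B (degree q) \<noteq> 0"
    using B[OF less.prems] by auto
  have ne: "coeff (B (degree q)) (degree q) \<noteq> 0"
    using Bq by (metis leading_coeff_0_iff)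
  have zero: "weighted_integral (p * r) = 0"
  \<comment> \<open>For constant \<open>q\<close> the degree cannot drop; the remainder is then zero
    itself.\<close>
  proof (cases "degree q = 0")
    case True
    have "coeff r 0 = 0"
      using Bq ne True by (simp add: r_def c_def)
    moreover have "degree r = 0"
      using degree_diff_le[of q 0 "smult c (B (degree q))"] Bq True by (simp add: r_def)
    ultimately have "r = 0" by (metis degree_0_id of_nat_0 pCons_0_0 coeff_0)
    then show ?thesis by simp
  next
    case False
    have "degree r \<le> degree q"
      unfolding r_def using Bq by (intro degree_diff_le) (auto intro: order.trans[OF degree_smult_le])
    moreover have "coeff r (degree q) = 0"
      using Bq ne by (simp add: r_def c_def)
    ultimately have "degree r < degree q"
      using False by (metis degree_0 leading_coeff_0_iff le_neq_implies_less gr0I)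
    then show ?thesis
      using less.hyps[of r] less.prems by simp
  qed
  have "p * q = p * r + smult c (p * B (degree q))"
    by (simp add: r_def algebra_simps)
  then show ?case
    using zero orth[OF less.prems] by (simp add: weighted_integral_add weighted_integral_smult)
qed

text \<open>With leading terms matched, the remainder \<open>r\<close> has lower degree, hence is
  orthogonal to \<open>p\<close> and to \<open>gegenbauer23 i\<close>, hence to itself. The value at
  1 then fixes the scalar.\<close>

lemma gegenbauer23_unique:
  assumes i: "i \<le> 6" and p: "degree p = i" "poly p 1 = 1"
    and orth: "\<And>j. j < i \<Longrightarrow> weighted_integral (p * gegenbauer23 j) = 0"
  shows "p = gegenbauer23 i"
proof -
  let ?g = "gegenbauer23 i"
  have g: "degree ?g = i" "poly ?g 1 = 1"
    using i by (simp_all add: degree_gegenbauer23 poly_gegenbauer23_1)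
  define c where "c = lead_coeff p / lead_coeff ?g"
  define r where "r = p - smult c ?g"
  have "?g \<noteq> 0" using g(2) by auto
  then have ne: "coeff ?g i \<noteq> 0" using g(1) by (metis leading_coeff_0_iff)
  have "r = 0"
  proof (cases "i = 0")
    case True
    obtain a b where "p = [:a:]" "?g = [:b:]"
      using p(1) g(1) True by (metis degree_eq_zeroE)
    then show ?thesis using p(2) g(2) by (simp add: r_def c_def)
  next
    case False
    have "degree r \<le> i"
      unfolding r_def using g p by (intro degree_diff_le) (auto intro: order.trans[OF degree_smult_le])
    moreover have "coeff r i = 0"
      using ne g p by (simp add: r_def c_def)
    ultimately have "degree r < i"
      using False by (metis degree_0 leading_coeff_0_iff le_neq_implies_less gr0I)
    have "weighted_integral (p * r) = 0"
    proof (rule orthogonal_to_lower_degree[OF _ orth \<open>degree r < i\<close>])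
      fix j assume "j < i"
      then have "j \<le> 6" using i by simp
      then show "degree (gegenbauer23 j) = j \<and> gegenbauer23 j \<noteq> 0"
        using degree_gegenbauer23 poly_gegenbauer23_1 by (metis poly_0 zero_neq_one)
    qed
    moreover have "weighted_integral (?g * r) = 0"
      by (rule weighted_integral_gegenbauer23[OF i \<open>degree r < i\<close>])
    moreover have "r * r = p * r - smult c (?g * r)"
      by (subst (1) r_def) (simp add: left_diff_distrib)
    ultimately have "weighted_integral (r * r) = 0"
      by (simp add: weighted_integral_diff weighted_integral_smult)
    then show ?thesis by (rule weighted_integral_square_eq_0)
  qed
  then have pc: "p = smult c ?g" by (simp add: r_def)
  then have "poly p 1 = c * poly ?g 1" by (metis poly_smult)
  then have "c = 1" using p(2) g(2) by simp
  then show ?thesis using pc by simp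
qed

lemma weight_powr:
  assumes "t \<in> {- 1..1 :: real}"
  shows "(1 - t\<^sup>2) powr ((real 23 - 3) / 2) = (1 - t\<^sup>2) ^ 10"
proof -
  have "0 \<le> 1 - t\<^sup>2"
    using assms by (simp add: abs_square_le_1 abs_le_iff)
  then show ?thesis
    \<comment> \<open>\<open>powr_realpow\<close> needs a positive base; at the endpoints both
      powers of 0 are 0.\<close>
    by (cases "1 - t\<^sup>2 = 0") (simp_all add: powr_realpow[of _ 10, simplified])
qed

lemma weighted_integral_powr:
  "integral {- 1..1} (\<lambda>t. (1 - t\<^sup>2) powr ((real 23 - 3) / 2) * poly p t * poly q t) = weighted_integral (p * q)"
  unfolding weighted_integral_def
proof (rule Henstock_Kurzweil_Integration.integral_cong)
  fix t :: real assume "t \<in> {- 1..1}"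
  then show "(1 - t\<^sup>2) powr ((real 23 - 3) / 2) * poly p t * poly q t = (1 - t\<^sup>2) ^ 10 * poly (p * q) t"
    by (simp only: weight_powr poly_mult mult.assoc)
qed

lemma gegenbauer_eq_gegenbauer23: "i \<le> 6 \<Longrightarrow> gegenbauer 23 i = gegenbauer23 i"
proof (induction i rule: less_induct)
  case (less i)
  have IH: "gegenbauer 23 j = gegenbauer23 j" if "j < i" for j
    using less that by simp
  show ?case
    unfolding gegenbauer.simps[of 23 i] weighted_integral_powr
  proof (rule the_equality)
    have "weighted_integral (gegenbauer23 i * gegenbauer 23 j) = 0" if "j < i" for j
      using weighted_integral_gegenbauer23[OF less.prems, of "gegenbauer23 j"] that less.prems
      by (simp add: IH degree_gegenbauer23)
    then show "degree (gegenbauer23 i) = i \<and> poly (gegenbauer23 i) 1 = 1 \<and>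
        (\<forall>j\<in>{..<i}. weighted_integral (gegenbauer23 i * gegenbauer 23 j) = 0)"
      using less.prems by (simp add: degree_gegenbauer23 poly_gegenbauer23_1)
  next
    fix P assume P: "degree P = i \<and> poly P 1 = 1 \<and>
        (\<forall>j\<in>{..<i}. weighted_integral (P * gegenbauer 23 j) = 0)"
    then show "P = gegenbauer23 i"
      using IH by (intro gegenbauer23_unique[OF less.prems]) auto
  qed
qed

section \<open>The linear programming bound\<close>

text \<open>Equality in the bound requires a zero at each of the five inner products of the code. At
  the endpoints of the two intervals simple zeros suffice, as the sign may be negative within the
  intervals; the value -1/15 lies outside both, so its zero is double.\<close>

definition lp_poly :: "real poly" where
  "lp_poly = [:3 / 5, 1:] * [:1 / 3, 1:] * [:1 / 15, 1:]\<^sup>2 * [:- 1 / 5, 1:] * [:- 7 / 15, 1:]"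

text \<open>Obtained by dividing out leading terms, from \<open>4576 / 8091\<close> at the top down
  to \<open>f\<^sub>0 = 128 / 5821875\<close>, the average of \<open>lp_poly\<close> over the
  sphere.\<close>

definition lp_coeff :: "nat \<Rightarrow> real" where
  "lp_coeff i = (if i \<le> 6 then [128 / 5821875, 128 / 253125, 15488 / 3751875, 1408 / 32625,
     47872 / 313875, 352 / 1305, 4576 / 8091] ! i else 0)"

lemma lp_poly_eq:
  "lp_poly = [:7 / 84375, 578 / 253125, 559 / 50625, - 4 / 45, - 13 / 45, 2 / 5, 1:]"
  by (simp add: lp_poly_def power2_eq_square)

lemma lp_expansion: "gegenbauer_expansion 23 lp_coeff lp_poly"
proof -
  have supp: "{i. lp_coeff i \<noteq> 0} \<subseteq> {..6}"
    by (auto simp: lp_coeff_def split: if_splits)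
  have "(\<Sum>i | lp_coeff i \<noteq> 0. smult (lp_coeff i) (gegenbauer 23 i)) = (\<Sum>i\<le>6. smult (lp_coeff i) (gegenbauer 23 i))"
    by (rule sum.mono_neutral_left) (use supp in auto)
  also have "\<dots> = (\<Sum>i\<le>6. smult (lp_coeff i) (gegenbauer23 i))"
    by (intro sum.cong refl) (simp add: gegenbauer_eq_gegenbauer23)
  also have "\<dots> = lp_poly"
    by (simp add: atMost_nat_numeral lp_coeff_def gegenbauer23_def lp_poly_eq)
  finally show ?thesis
    using supp finite_subset by (auto simp: gegenbauer_expansion_def)
qed

text \<open>The two factors belonging to one interval have a nonnegative product outside it, and the
  rest is a square.\<close>

lemma lp_poly_nonneg:
  assumes "t \<notin> {- 3 / 5 <..< - 1 / 3} \<union> {1 / 5 <..< 7 / 15}"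
  shows "poly lp_poly t \<ge> 0"
proof -
  have A: "(3 / 5 + t) * (1 / 3 + t) \<ge> 0" and B: "(- 1 / 5 + t) * (- 7 / 15 + t) \<ge> 0"
    using assms by (auto simp: zero_le_mult_iff)
  have "((3 / 5 + t) * (1 / 3 + t)) * (1 / 15 + t)\<^sup>2 * ((- 1 / 5 + t) * (- 7 / 15 + t)) \<ge> 0"
    by (rule mult_nonneg_nonneg[OF mult_nonneg_nonneg[OF A zero_le_power2] B])
  also have "((3 / 5 + t) * (1 / 3 + t)) * (1 / 15 + t)\<^sup>2 * ((- 1 / 5 + t) * (- 7 / 15 + t)) = poly lp_poly t"
    by (simp only: lp_poly_def poly_mult poly_power poly_pCons poly_0 mult_zero_right add_0_right
        mult_1_right mult.assoc)
  finally show ?thesis .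
qed

lemma lp_bound:
  fixes C :: "(real ^ 23) set"
  assumes C: "spherical_design \<tau> C" and "6 \<le> \<tau>"
    and avoid: "avoiding ({- 3 / 5 <..< - 1 / 3} \<union> {1 / 5 <..< 7 / 15}) C"
  shows "card C \<ge> 47104"
proof -
  let ?N = "real (card C)"
  have fin: "finite C" and sph: "\<And>x. x \<in> C \<Longrightarrow> norm x = 1" and "C \<noteq> {}"
    using C by (auto simp: spherical_design_def spherical_code_def)
  then have N: "?N > 0" by (simp add: card_gt_0_iff)
  have "(\<Sum>y\<in>C. poly lp_poly (x \<bullet> y)) = ?N * (128 / 5821875)" if x: "x \<in> C" for x
  proof -
    have "(\<Sum>y\<in>C. poly lp_poly (x \<bullet> y)) = (\<Sum>d\<le>6. coeff lp_poly d * (\<Sum>y\<in>C. (x \<bullet> y) ^ d))"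
    proof -
      have "degree lp_poly = 6" by (simp add: lp_poly_eq)
      then show ?thesis
        by (simp only: poly_altdef sum_distrib_left) (rule sum.swap)
    qed
    also have "\<dots> = (\<Sum>d\<le>6. coeff lp_poly d * (?N * sphere_moment 23 d))"
      using spherical_design_sum_inner_power[OF C, of _ x] \<open>6 \<le> \<tau>\<close> sph[OF x]
      by (intro sum.cong refl) simp
    \<comment> \<open>Odd moments vanish, so only the four even coefficients enter.\<close>
    also have "\<dots> = ?N * (128 / 5821875)"
    proof -
      have odd: "sphere_moment 23 (Suc 0) = 0" "sphere_moment 23 3 = 0" "sphere_moment 23 5 = 0"
        by (simp_all add: sphere_moment_def)
      have even: "coeff lp_poly 0 = 7 / 84375" "coeff lp_poly 2 = 559 / 50625"
        "coeff lp_poly 4 = - 13 / 45" "coeff lp_poly 6 = 1"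
        by (simp_all add: lp_poly_eq numeral_eq_Suc)
      show ?thesis
        by (simp add: atMost_nat_numeral sphere_moment_values odd even)
    qed
    finally show ?thesis .
  qed
  then have "(\<Sum>x\<in>C. \<Sum>y\<in>C. poly lp_poly (x \<bullet> y)) = (\<Sum>x\<in>C. ?N * (128 / 5821875))"
    by (rule sum.cong[OF refl])
  then have "(\<Sum>x\<in>C. \<Sum>y\<in>C. poly lp_poly (x \<bullet> y)) = ?N * (?N * (128 / 5821875))"
    by simp
  moreover have "(\<Sum>x\<in>C. \<Sum>y\<in>C. poly lp_poly (x \<bullet> y)) \<ge> (\<Sum>x\<in>C. poly lp_poly 1)"
  proof (rule sum_mono)
    fix x assume x: "x \<in> C"
    have "poly lp_poly (x \<bullet> y) \<ge> 0" if "y \<in> C - {x}" for y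
    proof (rule lp_poly_nonneg)
      have "x \<bullet> y \<in> inner_products C"
        using x that unfolding inner_products_def by blast
      then show "x \<bullet> y \<notin> {- 3 / 5 <..< - 1 / 3} \<union> {1 / 5 <..< 7 / 15}"
        using avoid unfolding avoiding_def by blast
    qed
    then have "(\<Sum>y\<in>C - {x}. poly lp_poly (x \<bullet> y)) \<ge> 0" by (rule sum_nonneg)
    moreover have "x \<bullet> x = 1" using sph[OF x] by (simp add: norm_eq_1)
    ultimately show "(\<Sum>y\<in>C. poly lp_poly (x \<bullet> y)) \<ge> poly lp_poly 1"
      using fin x by (simp add: sum.remove[of C x])
  qed
  \<comment> \<open>Written as a multiple of the average so that the common factor cancels from the
    two estimates of the double sum.\<close>
  moreover have "poly lp_poly 1 = 47104 * (128 / 5821875)"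
    by (simp add: lp_poly_eq)
  ultimately have "?N * (47104 * (128 / 5821875)) \<le> ?N * (?N * (128 / 5821875))"
    by simp
  then have "47104 \<le> ?N"
    using N by simp
  then show ?thesis by simp
qed

theorem theorem6p1:
  fixes T\<^sub>1 :: "real set"
  assumes "T\<^sub>1 = {- 3 / 5 <..< - 1 / 3} \<union> {1 / 5 <..< 7 / 15}"
  shows "min_design_size TYPE(23) 6 T\<^sub>1 = 47104 \<and>
         min_design_size TYPE(23) 7 T\<^sub>1 = 47104 \<and>
         (\<forall>x\<in>leech_code. \<forall>\<phi> :: real24 \<Rightarrow> real ^ 23.
            complement_isometry x \<phi> \<longrightarrow>
            tight_avoiding_design 7 T\<^sub>1 (\<phi> ` quarter_code x))"
proof -
  have avoid: "avoiding T\<^sub>1 (\<phi> ` quarter_code x)"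
    if "x \<in> leech_code" "complement_isometry x \<phi>" for x and \<phi> :: "real24 \<Rightarrow> real ^ 23"
  proof -
    \<comment> \<open>Four of the values are endpoints of the open intervals, and -1/15 lies between
      the two intervals.\<close>
    have "{- 3 / 5, - 1 / 3, - 1 / 15, 1 / 5, 7 / 15} \<inter> T\<^sub>1 = {}"
      by (auto simp: assms)
    then show ?thesis
      using quarter_code_design(3)[OF that order.refl] unfolding avoiding_def by blast
  qed
  have size: "min_design_size TYPE(23) \<tau> T\<^sub>1 = 47104" if \<tau>: "6 \<le> \<tau>" "\<tau> \<le> 7" for \<tau>
    unfolding min_design_size_def
  proof (rule cInf_eq_minimum)
    obtain x where x: "x \<in> leech_code" using leech_code_nonempty by blast
    then have "x \<noteq> 0" using norm_leech_code by force
    then obtain \<phi> :: "real24 \<Rightarrow> real ^ 23" where \<phi>: "complement_isometry x \<phi>"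
      using complement_isometry_exists by blast
    show "47104 \<in> {card C |C :: (real ^ 23) set. spherical_design \<tau> C \<and> avoiding T\<^sub>1 C}"
      using quarter_code_design(1,2)[OF x \<phi> \<tau>(2)] avoid[OF x \<phi>] by force
  next
    fix n assume "n \<in> {card C |C :: (real ^ 23) set. spherical_design \<tau> C \<and> avoiding T\<^sub>1 C}"
    then show "47104 \<le> n"
      using lp_bound[OF _ \<tau>(1)] by (auto simp: assms)
  qed
  have "tight_avoiding_design 7 T\<^sub>1 (\<phi> ` quarter_code x)"
    if x: "x \<in> leech_code" and \<phi>: "complement_isometry x \<phi>" for x and \<phi> :: "real24 \<Rightarrow> real ^ 23"
    unfolding tight_avoiding_design_def
  proof (intro conjI exI)
    show "gegenbauer_expansion CARD(23) lp_coeff lp_poly"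
      using lp_expansion by simp
    show "\<forall>t\<in>{- 1..1} - T\<^sub>1. 0 \<le> poly lp_poly t"
      using lp_poly_nonneg assms by blast
    show "0 < lp_coeff 0" "\<forall>i\<ge>7 + 1. lp_coeff i \<le> 0"
      by (simp_all add: lp_coeff_def)
    show "real (card (\<phi> ` quarter_code x)) = poly lp_poly 1 / lp_coeff 0"
      using quarter_code_design(1)[OF x \<phi> order.refl] by (simp add: lp_poly_eq lp_coeff_def)
  qed (use quarter_code_design(2)[OF x \<phi>, of 7] avoid[OF x \<phi>] in simp_all)
  with size show ?thesis by simp
qed

end
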